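(* Let $m>1$ be an integer and $\lambda\in\mathbb{R}$. The space $H(s\ell_{m+1},\mathcal{D}^0_{\lambda\lambda}(\mathbb{R}^m))$ is isomorphic to $(\Lambda\, g\ell(m,\mathbb{R})^* )_{g\text{-}inv}$. The inclusion of $\mathcal{D}^0_{\lambda\lambda}(\mathbb{R}^m)$ into $\mathcal{D}_{\lambda\lambda}(\mathbb{R}^m)$ induces an isomorphism in cohomology of $s\ell_{m+1}$.
   Context: $s\ell_{m+1}$ denotes the Lie subalgebra of the Lie algebra $Vect(\mathbb{R}^m)$ of smooth vector fields on $\mathbb{R}^m$ spanned by $\partial_i$, $x^j\partial_i$ and $x^jE$ ($1\le i,j\le m$), where $E=\sum_i x^i\partial_i$; it is isomorphic to $s\ell(m+1,\mathbb{R})$. The space of scalar $\lambda$-densities on $\mathbb{R}^m$ is identified with $C_\infty(\mathbb{R}^m)$ with Lie derivative $L^\lambda_Xf=X.f+\lambda\,\mathrm{tr}(DX)f$, where $X.f=\sum_iX^i\partial_if$ and $DX=(\partial_jX^i)$. $\mathcal{D}^k_{\lambda\mu}(\mathbb{R}^m)$ is the space of linear differential operators of order $\le k$ from $\lambda$-densities to $\mu$-densities and $\mathcal{D}_{\lambda\mu}(\mathbb{R}^m)=\bigcup_k\mathcal{D}^k_{\lambda\mu}(\mathbb{R}^m)$, with $X$ acting by $A\mapsto L^\mu_X\circ A-A\circ L^\lambda_X$. $H(s\ell_{m+1},W)=\bigoplus_uH^u(s\ell_{m+1},W)$ is Chevalley–Eilenberg cohomology with coefficients in the module $W$; "isomorphic"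 means isomorphic as real vector spaces. $(\Lambda\, g\ell(m,\mathbb{R})^* )_{g\text{-}inv}$ is the space of alternating multilinear forms on $g\ell(m,\mathbb{R})$ (all degrees) invariant under the adjoint action of $g\ell(m,\mathbb{R})$. *)

theory Defs
  imports
    "HOL-Analysis.Analysis"
    "HOL-Library.Function_Algebras"
    "HOL-Algebra.AbelCoset"
    "HOL-Algebra.Module"
begin

section \<open>Pointwise real vector space structure on functions\<close>

instantiation "fun" :: (type, real_vector) real_vector
begin

definition scaleR_fun_def: "r *\<^sub>R f = (\<lambda>x. r *\<^sub>R f x)"

instance
  by standard (auto simp: scaleR_fun_def fun_eq_iff algebra_simps)

end

lemma scaleR_fun_apply [simp]: "(r *\<^sub>R f) x = r *\<^sub>R f x"
  by (simp add: scaleR_fun_def)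


section \<open>Smooth functions\<close>

definition partial_deriv :: "'m::finite \<Rightarrow> (real^'m \<Rightarrow> real) \<Rightarrow> (real^'m \<Rightarrow> real)" where
  "partial_deriv i f = (\<lambda>x. frechet_derivative f (at x) (axis i 1))"

primrec C_k :: "nat \<Rightarrow> (real^'m::finite \<Rightarrow> real) \<Rightarrow> bool" where
  "C_k 0 f \<longleftrightarrow> continuous_on UNIV f"
| "C_k (Suc k) f \<longleftrightarrow> f differentiable_on UNIV \<and> (\<forall>i. C_k k (partial_deriv i f))"

lemma C_k_SucD: "C_k (Suc k) f \<Longrightarrow> C_k k f"
proof (induction k arbitrary: f)
  case 0
  then show ?case by (simp add: differentiable_imp_continuous_on)
next
  case (Suc k)
  then show ?case by (meson C_k.simps(2))
qed

lemma partial_deriv_eqI: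
  assumes "\<And>x. (f has_derivative f' x) (at x)"
  shows "partial_deriv i f = (\<lambda>x. f' x (axis i 1))"
  by (simp add: partial_deriv_def frechet_derivative_at[OF assms, symmetric])

lemma has_frechet_derivative:
  "f differentiable_on UNIV \<Longrightarrow> (f has_derivative frechet_derivative f (at x)) (at x)"
  by (simp add: differentiable_on_def frechet_derivative_works)

lemma partial_deriv_const: "partial_deriv i (\<lambda>x. c) = (\<lambda>x. 0)"
  by (rule partial_deriv_eqI) auto

lemma partial_deriv_coord: "partial_deriv i (\<lambda>x. x $ j) = (\<lambda>x. axis i 1 $ j)"
  by (rule partial_deriv_eqI) (rule bounded_linear_imp_has_derivative[OF bounded_linear_vec_nth])

lemma partial_deriv_add:
  "f differentiable_on UNIV \<Longrightarrow> g differentiable_on UNIV \<Longrightarrow>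
    partial_deriv i (\<lambda>x. f x + g x) = (\<lambda>x. partial_deriv i f x + partial_deriv i g x)"
  unfolding partial_deriv_def[of i f] partial_deriv_def[of i g]
  by (rule partial_deriv_eqI) (intro has_derivative_add has_frechet_derivative)

lemma partial_deriv_mult:
  "f differentiable_on UNIV \<Longrightarrow> g differentiable_on UNIV \<Longrightarrow>
    partial_deriv i (\<lambda>x. f x * g x) = (\<lambda>x. f x * partial_deriv i g x + partial_deriv i f x * g x)"
  unfolding partial_deriv_def[of i f] partial_deriv_def[of i g]
  by (rule partial_deriv_eqI) (intro has_derivative_mult has_frechet_derivative)

lemma C_k_const: "C_k k (\<lambda>x. c)"
  by (induction k arbitrary: c) (auto simp: partial_deriv_const)

lemma C_k_coord: "C_k k (\<lambda>x. x $ j)"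
  by (cases k) (auto simp: partial_deriv_coord C_k_const intro!: continuous_intros
      bounded_linear_imp_differentiable_on bounded_linear_vec_nth)

lemma C_k_add: "C_k k f \<Longrightarrow> C_k k g \<Longrightarrow> C_k k (\<lambda>x. f x + g x)"
  by (induction k arbitrary: f g) (auto simp: partial_deriv_add intro: continuous_intros)

lemma C_k_mult: "C_k k f \<Longrightarrow> C_k k g \<Longrightarrow> C_k k (\<lambda>x. f x * g x)"
proof (induction k arbitrary: f g)
  case 0
  then show ?case by (auto intro: continuous_intros)
next
  case (Suc k)
  then show ?case
    using C_k_SucD[OF Suc.prems(1)] C_k_SucD[OF Suc.prems(2)]
    by (auto simp: partial_deriv_mult intro!: C_k_add)
qed

typedef (overloaded) 'm smooth_fun = "{f :: real^'m::finite \<Rightarrow> real. \<forall>k. C_k k f}"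
  morphisms sf_apply Abs_smooth_fun
  using C_k_const by blast

setup_lifting type_definition_smooth_fun

instantiation smooth_fun :: (finite) "{comm_ring_1, real_algebra_1}"
begin

lift_definition zero_smooth_fun :: "'a smooth_fun" is "\<lambda>x. 0"
  by (simp add: C_k_const)

lift_definition one_smooth_fun :: "'a smooth_fun" is "\<lambda>x. 1"
  by (simp add: C_k_const)

lift_definition plus_smooth_fun :: "'a smooth_fun \<Rightarrow> 'a smooth_fun \<Rightarrow> 'a smooth_fun"
  is "\<lambda>f g x. f x + g x"
  by (simp add: C_k_add)

lift_definition times_smooth_fun :: "'a smooth_fun \<Rightarrow> 'a smooth_fun \<Rightarrow> 'a smooth_fun"
  is "\<lambda>f g x. f x * g x"
  by (simp add: C_k_mult)

lift_definition scaleR_smooth_fun :: "real \<Rightarrow> 'a smooth_fun \<Rightarrow> 'a smooth_fun"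
  is "\<lambda>r f x. r * f x"
  by (intro allI C_k_mult C_k_const) blast

lift_definition uminus_smooth_fun :: "'a smooth_fun \<Rightarrow> 'a smooth_fun" is "\<lambda>f x. - f x"
proof -
  fix f :: "real^'a \<Rightarrow> real" and k
  assume "\<And>k. C_k k f"
  then show "C_k k (\<lambda>x. - f x)"
    using C_k_mult[OF C_k_const[of k "-1"]] by fastforce
qed

definition minus_smooth_fun :: "'a smooth_fun \<Rightarrow> 'a smooth_fun \<Rightarrow> 'a smooth_fun"
  where "f - g = f + (- g :: 'a smooth_fun)"

instance
proof
  fix f g h :: "'a smooth_fun" and r s :: real
  show "f + g + h = f + (g + h)" "f + g = g + f" "0 + f = f" "- f + f = 0"
    "f * g * h = f * (g * h)" "f * g = g * f" "1 * f = f" "f * 1 = f"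
    "(f + g) * h = f * h + g * h" "f * (g + h) = f * g + f * h"
    "r *\<^sub>R (f + g) = r *\<^sub>R f + r *\<^sub>R g" "(r + s) *\<^sub>R f = r *\<^sub>R f + s *\<^sub>R f"
    "r *\<^sub>R s *\<^sub>R f = (r * s) *\<^sub>R f" "1 *\<^sub>R f = f"
    "(r *\<^sub>R f) * g = r *\<^sub>R (f * g)" "f * (r *\<^sub>R g) = r *\<^sub>R (f * g)"
    by (transfer; simp add: algebra_simps)+
  show "f - g = f + - g"
    by (rule minus_smooth_fun_def)
  show "(0 :: 'a smooth_fun) \<noteq> 1"
    by transfer (simp add: fun_eq_iff)
qed

end

lift_definition coord :: "'m::finite \<Rightarrow> 'm smooth_fun" is "\<lambda>i x. x $ i"
  by (simp add: C_k_coord)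

lift_definition pd :: "'m::finite \<Rightarrow> 'm smooth_fun \<Rightarrow> 'm smooth_fun" is partial_deriv
  by (meson C_k.simps(2))


section \<open>Vector fields, densities and differential operators\<close>

text \<open>A vector field is the vector of its components \<open>X\<^sup>i = X $ i\<close>.\<close>

type_synonym 'm vector_field = "'m smooth_fun ^ 'm"

definition vf_apply :: "'m::finite vector_field \<Rightarrow> 'm smooth_fun \<Rightarrow> 'm smooth_fun" where
  "vf_apply X f = (\<Sum>i\<in>UNIV. X $ i * pd i f)"

definition vf_bracket :: "'m::finite vector_field \<Rightarrow> 'm vector_field \<Rightarrow> 'm vector_field" where
  "vf_bracket X Y = (\<chi> i. vf_apply X (Y $ i) - vf_apply Y (X $ i))"

definition vf_deriv :: "'m::finite vector_field \<Rightarrow> 'm smooth_fun ^ 'm ^ 'm" where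
  "vf_deriv X = (\<chi> i j. pd j (X $ i))"

definition lie_deriv :: "real \<Rightarrow> 'm::finite vector_field \<Rightarrow> 'm smooth_fun \<Rightarrow> 'm smooth_fun" where
  "lie_deriv lam X f = vf_apply X f + lam *\<^sub>R (trace (vf_deriv X) * f)"

definition euler_field :: "'m::finite vector_field" where
  "euler_field = (\<chi> i. coord i)"

definition sl_fields :: "'m::finite vector_field set" where
  "sl_fields = span (
      {axis i 1 | i. True}
    \<union> {axis i (coord j) | i j. True}
    \<union> {\<chi> i. coord j * euler_field $ i | j. True})"

text \<open>
  An operator of order at most \<open>k\<close> is a sum of terms \<open>a\<^sub>w \<partial>\<^bsub>i\<^sub>1\<^esub> \<dots> \<partial>\<^bsub>i\<^sub>r\<^esub>\<close> over the words
  \<open>w = [i\<^sub>1, \<dots>, i\<^sub>r]\<close> with \<open>r \<le> k\<close>. Words with the same letters give the same derivative, so the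
  coefficients \<open>a\<^sub>w\<close> are not unique, but the operators are those written with multi-indices.
\<close>

definition diff_ops_le :: "nat \<Rightarrow> ('m::finite smooth_fun \<Rightarrow> 'm smooth_fun) set" where
  "diff_ops_le k = {A. \<exists>a. A = (\<lambda>f. \<Sum>w\<in>{w. length w \<le> k}. a w * foldr pd w f)}"

definition diff_ops :: "('m::finite smooth_fun \<Rightarrow> 'm smooth_fun) set" where
  "diff_ops = (\<Union>k. diff_ops_le k)"

definition diff_op_action ::
  "real \<Rightarrow> real \<Rightarrow> 'm::finite vector_field \<Rightarrow> ('m smooth_fun \<Rightarrow> 'm smooth_fun) \<Rightarrow> ('m smooth_fun \<Rightarrow> 'm smooth_fun)"
  where "diff_op_action lam mu X A = (lie_deriv mu X \<circ> A) - (A \<circ> lie_deriv lam X)"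


section \<open>Real vector spaces as modules\<close>

text \<open>
  A record of type \<^typ>\<open>(real, 'a) module\<close> extends a ring record; its fields for the
  multiplication and the unit play no role for a vector space and are left unspecified.
\<close>

definition subspace_module :: "'a::real_vector set \<Rightarrow> (real, 'a) module" where
  "subspace_module S = \<lparr>carrier = S, monoid.mult = undefined, one = undefined,
     zero = 0, add = (+), smult = (*\<^sub>R)\<rparr>"

definition quotient_module :: "(real, 'a) module \<Rightarrow> 'a set \<Rightarrow> (real, 'a set) module" where
  "quotient_module M B = \<lparr>carrier = a_rcosets\<^bsub>M\<^esub> B, monoid.mult = undefined, one = undefined,
     zero = B, add = set_add M, smult = (\<lambda>r C. \<Union>c\<in>C. B +>\<^bsub>M\<^esub> (r \<odot>\<^bsub>M\<^esub> c))\<rparr>"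

definition direct_sum_module :: "(nat \<Rightarrow> (real, 'a) module) \<Rightarrow> (real, nat \<Rightarrow> 'a) module" where
  "direct_sum_module M = \<lparr>carrier = {h. (\<forall>u. h u \<in> carrier (M u)) \<and> finite {u. h u \<noteq> \<zero>\<^bsub>M u\<^esub>}},
     monoid.mult = undefined, one = undefined,
     zero = (\<lambda>u. \<zero>\<^bsub>M u\<^esub>), add = (\<lambda>g h u. g u \<oplus>\<^bsub>M u\<^esub> h u),
     smult = (\<lambda>r h u. r \<odot>\<^bsub>M u\<^esub> h u)\<rparr>"

definition module_iso :: "(real, 'a) module \<Rightarrow> (real, 'b) module \<Rightarrow> ('a \<Rightarrow> 'b) set" where
  "module_iso M N = {\<phi> \<in> iso (add_monoid M) (add_monoid N).
     \<forall>r. \<forall>x\<in>carrier M. \<phi> (r \<odot>\<^bsub>M\<^esub> x) = r \<odot>\<^bsub>N\<^esub> \<phi> x}"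

definition modules_isomorphic :: "(real, 'a) module \<Rightarrow> (real, 'b) module \<Rightarrow> bool" where
  "modules_isomorphic M N \<longleftrightarrow> module_iso M N \<noteq> {}"


section \<open>Chevalley--Eilenberg cohomology\<close>

text \<open>
  An alternating \<open>u\<close>-linear map from the subspace \<open>V\<close> to the subspace \<open>W\<close> is a function on lists,
  set to \<open>0\<close> on all lists other than those of length \<open>u\<close> with entries in \<open>V\<close>.
\<close>

definition alt_maps :: "'g::real_vector set \<Rightarrow> 'w::real_vector set \<Rightarrow> nat \<Rightarrow> ('g list \<Rightarrow> 'w) set" where
  "alt_maps V W u = {c.
     (\<forall>xs. length xs = u \<and> set xs \<subseteq> V \<longrightarrow> c xs \<in> W) \<and>
     (\<forall>xs. \<not> (length xs = u \<and> set xs \<subseteq> V) \<longrightarrow> c xs = 0) \<and>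
     (\<forall>xs i. length xs = u \<and> set xs \<subseteq> V \<and> i < u \<longrightarrow>
        (\<forall>x\<in>V. \<forall>y\<in>V. c (xs[i := x + y]) = c (xs[i := x]) + c (xs[i := y])) \<and>
        (\<forall>r. \<forall>x\<in>V. c (xs[i := r *\<^sub>R x]) = r *\<^sub>R c (xs[i := x]))) \<and>
     (\<forall>xs i j. length xs = u \<and> set xs \<subseteq> V \<and> i < j \<and> j < u \<and> xs ! i = xs ! j \<longrightarrow> c xs = 0)}"

text \<open>
  In the following, \<open>G\<close> is the carrier of a Lie algebra with bracket \<open>br\<close>, and \<open>W\<close> is the carrier of
  a representation with action \<open>act\<close>. The list \<open>nths xs (- {i})\<close> is \<open>xs\<close> without its \<open>i\<close>-th entry.
\<close>

definition ce_diff ::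
  "'g::real_vector set \<Rightarrow> ('g \<Rightarrow> 'g \<Rightarrow> 'g) \<Rightarrow> ('g \<Rightarrow> 'w \<Rightarrow> 'w) \<Rightarrow> nat \<Rightarrow>
    ('g list \<Rightarrow> 'w::real_vector) \<Rightarrow> ('g list \<Rightarrow> 'w)" where
  "ce_diff G br act u c = (\<lambda>xs.
     if length xs = Suc u \<and> set xs \<subseteq> G then
       (\<Sum>i\<le>u. (-1) ^ i *\<^sub>R act (xs ! i) (c (nths xs (- {i})))) +
       (\<Sum>j\<le>u. \<Sum>i<j. (-1) ^ (i + j) *\<^sub>R c (br (xs ! i) (xs ! j) # nths xs (- {i, j})))
     else 0)"

definition ce_cocycles ::
  "'g::real_vector set \<Rightarrow> ('g \<Rightarrow> 'g \<Rightarrow> 'g) \<Rightarrow> 'w set \<Rightarrow> ('g \<Rightarrow> 'w \<Rightarrow> 'w) \<Rightarrow> nat \<Rightarrow>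
    ('g list \<Rightarrow> 'w::real_vector) set" where
  "ce_cocycles G br W act u = {c \<in> alt_maps G W u. ce_diff G br act u c = 0}"

definition ce_coboundaries ::
  "'g::real_vector set \<Rightarrow> ('g \<Rightarrow> 'g \<Rightarrow> 'g) \<Rightarrow> 'w set \<Rightarrow> ('g \<Rightarrow> 'w \<Rightarrow> 'w) \<Rightarrow> nat \<Rightarrow>
    ('g list \<Rightarrow> 'w::real_vector) set" where
  "ce_coboundaries G br W act u =
     (case u of 0 \<Rightarrow> {0} | Suc v \<Rightarrow> ce_diff G br act v ` alt_maps G W v)"

definition ce_cohomology_deg ::
  "'g::real_vector set \<Rightarrow> ('g \<Rightarrow> 'g \<Rightarrow> 'g) \<Rightarrow> 'w set \<Rightarrow> ('g \<Rightarrow> 'w \<Rightarrow> 'w) \<Rightarrow> nat \<Rightarrow>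
    (real, ('g list \<Rightarrow> 'w::real_vector) set) module" where
  "ce_cohomology_deg G br W act u =
     quotient_module (subspace_module (ce_cocycles G br W act u)) (ce_coboundaries G br W act u)"

definition ce_cohomology ::
  "'g::real_vector set \<Rightarrow> ('g \<Rightarrow> 'g \<Rightarrow> 'g) \<Rightarrow> 'w set \<Rightarrow> ('g \<Rightarrow> 'w \<Rightarrow> 'w) \<Rightarrow>
    (real, nat \<Rightarrow> ('g list \<Rightarrow> 'w::real_vector) set) module" where
  "ce_cohomology G br W act = direct_sum_module (ce_cohomology_deg G br W act)"

text \<open>
  The map induced in cohomology by a homomorphism \<open>\<phi>\<close> to the representation \<open>(W', act')\<close>: in each
  degree it sends the class of \<open>c\<close> to the class of \<open>\<phi> \<circ> c\<close>.
\<close>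

definition ce_induced_map ::
  "'g::real_vector set \<Rightarrow> ('g \<Rightarrow> 'g \<Rightarrow> 'g) \<Rightarrow> 'v set \<Rightarrow> ('g \<Rightarrow> 'v \<Rightarrow> 'v) \<Rightarrow> ('w \<Rightarrow> 'v) \<Rightarrow>
    (nat \<Rightarrow> ('g list \<Rightarrow> 'w::real_vector) set) \<Rightarrow> (nat \<Rightarrow> ('g list \<Rightarrow> 'v::real_vector) set)" where
  "ce_induced_map G br W' act' \<phi> h = (\<lambda>u. \<Union>c\<in>h u.
     ce_coboundaries G br W' act' u
       +>\<^bsub>subspace_module (ce_cocycles G br W' act' u)\<^esub> (\<phi> \<circ> c))"


section \<open>Cohomology of the projective algebra and invariant forms\<close>

definition sl_cohomology ::
  "real \<Rightarrow> real \<Rightarrow> ('m::finite smooth_fun \<Rightarrow> 'm smooth_fun) set \<Rightarrow>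
    (real, nat \<Rightarrow> ('m vector_field list \<Rightarrow> 'm smooth_fun \<Rightarrow> 'm smooth_fun) set) module" where
  "sl_cohomology lam mu W = ce_cohomology sl_fields vf_bracket W (diff_op_action lam mu)"

definition gl_bracket :: "real^'m^'m \<Rightarrow> real^'m^'m \<Rightarrow> real^'m::finite^'m" where
  "gl_bracket A B = A ** B - B ** A"

definition gl_inv_forms_deg :: "nat \<Rightarrow> ((real^'m::finite^'m) list \<Rightarrow> real) set" where
  "gl_inv_forms_deg u = {c \<in> alt_maps UNIV UNIV u.
     \<forall>A xs. length xs = u \<longrightarrow> (\<Sum>i<u. c (xs[i := gl_bracket A (xs ! i)])) = 0}"

definition gl_inv_forms :: "(real, nat \<Rightarrow> (real^'m::finite^'m) list \<Rightarrow> real) module" where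
  "gl_inv_forms = direct_sum_module (\<lambda>u. subspace_module (gl_inv_forms_deg u))"

end

theory Submission
  imports Defs
begin

text \<open>
  Write \<open>g\<close> for the projective algebra, \<open>E\<close> for the Euler field, and \<open>W\<close> for one of the two
  coefficient modules, the multiplication operators or all differential operators. One homotopy
  computes the cohomology for both.

  A module \<open>W\<close> of this kind is a left module over the smooth functions, and a field \<open>X\<close> acts on a
  product \<open>f A\<close> by the Leibniz rule. Hence a cochain can be contracted with a section of the
  trivial bundle with fibre \<open>g\<close>. Take the section \<open>s\<close> whose value at \<open>x\<close> is the field
  \<open>y \<mapsto> 2 x - y\<close>, that is \<open>s = 2 \<Sum>\<^sub>k x\<^sup>k \<partial>\<^sub>k - E\<close>. The operator \<open>L\<^sub>s = d i\<^sub>s + i\<^sub>s d\<close> commutes with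
  \<open>d\<close> and is homotopic to \<open>0\<close> (\<open>radial_homotopy\<close>). It is diagonal in suitable coordinates: an
  element \<open>X\<close> of \<open>g\<close> is determined by the functions \<open>X\<^sup>k\<close>, \<open>\<partial>\<^sub>j X\<^sup>i\<close> and its quadratic coefficients
  \<open>q\<^sub>j\<close>, which are its Taylor coefficients at a moving point, so a cochain is a sum of products of
  these functions with operators \<open>a \<partial>\<^sup>w\<close>, and on such a term \<open>L\<^sub>s\<close> replaces \<open>a\<close> by \<open>x \<cdot> \<partial> a + n a\<close>,
  where \<open>n\<close> is the length of \<open>w\<close> plus the number of factors \<open>X\<^sup>k\<close> and \<open>q\<^sub>j\<close> (\<open>radial_monomial\<close>,
  \<open>frame_weight\<close>, \<open>radial_lie_of_coeffs\<close>). For \<open>n > 0\<close> the operator \<open>x \<cdot> \<partial> + n\<close> is bijective on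
  smooth functions; for \<open>n = 0\<close> its kernel consists of the constants and its image of the functions
  vanishing at the origin. So every cochain splits into a part in the kernel of \<open>L\<^sub>s\<close> and a part in
  its image (\<open>radial_decomposition\<close>), and the kernel carries the cohomology
  (\<open>cocycle_radial_kernel\<close>). The kernel consists of the cochains
  \<open>(X\<^sub>1, \<dots>, X\<^sub>u) \<mapsto> \<omega> (D X\<^sub>1, \<dots>, D X\<^sub>u)\<close> with an alternating form \<open>\<omega>\<close> on the matrices
  (\<open>radial_kernel_gl_lift\<close>); in particular it is the same for both choices of \<open>W\<close>. Restriction to
  linear fields, followed by \<open>A \<mapsto> A(1)(0)\<close>, is a chain map, and on the kernel it inverts
  \<open>\<omega> \<mapsto> \<omega> (D X\<^sub>1, \<dots>, D X\<^sub>u)\<close>, so what remains is the cohomology of the matrices with trivial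
  coefficients.

  There, \<open>ad A\<close> and \<open>ad A\<^sup>T\<close> are adjoint for the Frobenius inner product. So any space of forms
  that is stable under the Lie derivatives \<open>L\<^sub>A\<close> is the orthogonal sum of its invariant elements
  and of the images of the \<open>L\<^sub>A\<close> (\<open>invariant_decomposition\<close>). Invariant forms are closed, and \<open>L\<^sub>A\<close>
  maps cocycles to coboundaries; hence every cocycle is cohomologous to exactly one invariant form.

  Altogether, for either \<open>W\<close>, every class contains \<open>\<omega> (D X\<^sub>1, \<dots>, D X\<^sub>u)\<close> for exactly one invariant
  form \<open>\<omega>\<close> (\<open>representatives\<close>). This is the first isomorphism, and since the representatives are
  the same for both modules, the inclusion of the modules induces an isomorphism.
\<close>

section \<open>Smooth functions, Hadamard quotients and the Euler operator\<close>

lemma has_derivative_partials: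
  fixes f :: "real^'m::finite \<Rightarrow> real"
  assumes "f differentiable_on UNIV"
  shows "(f has_derivative (\<lambda>v. \<Sum>k\<in>UNIV. v $ k * partial_deriv k f x)) (at x)"
proof -
  let ?f' = "frechet_derivative f (at x)"
  have d: "(f has_derivative ?f') (at x)" by (rule has_frechet_derivative[OF assms])
  then interpret bounded_linear ?f' by (rule has_derivative_bounded_linear)
  have "?f' v = (\<Sum>k\<in>UNIV. v $ k * partial_deriv k f x)" for v
  proof -
    have "?f' v = ?f' (\<Sum>k\<in>UNIV. v $ k *\<^sub>R axis k 1)"
      by (simp add: basis_expansion[of v, simplified scalar_mult_eq_scaleR])
    then show ?thesis by (simp add: sum scaleR partial_deriv_def)
  qed
  then have "?f' = (\<lambda>v. \<Sum>k\<in>UNIV. v $ k * partial_deriv k f x)" by (rule ext)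
  with d show ?thesis by simp
qed

text \<open>
  Averages over the segment from \<open>z\<close> to \<open>x\<close>. With \<open>n = 0\<close>, applied to the partial derivatives of a
  function, they are its Hadamard quotients at \<open>z\<close>; with \<open>z = 0\<close> they invert \<open>x \<cdot> \<partial> + n + 1\<close>.
\<close>

definition radial_mean :: "real^'m::finite \<Rightarrow> nat \<Rightarrow> (real^'m \<Rightarrow> real) \<Rightarrow> real^'m \<Rightarrow> real" where
  "radial_mean z n f = (\<lambda>x. integral {0..1} (\<lambda>t. t ^ n * f (z + t *\<^sub>R (x - z))))"

text \<open>
  Differentiation under the integral sign; the inner derivative contributes one more factor \<open>t\<close>,
  which is why the exponent increases.
\<close>

lemma has_derivative_radial_mean:
  fixes f :: "real^'m::finite \<Rightarrow> real"
  assumes df: "f differentiable_on UNIV" and cf: "\<And>k. continuous_on UNIV (partial_deriv k f)"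
  shows "(radial_mean z n f has_derivative
           (\<lambda>v. \<Sum>k\<in>UNIV. v $ k * radial_mean z (Suc n) (partial_deriv k f) x)) (at x)"
proof -
  define D :: "real^'m \<Rightarrow> ((real^'m) \<Rightarrow>\<^sub>L real)" where "D y
      = (\<Sum>k\<in>UNIV. partial_deriv k f y *\<^sub>R blinfun_inner_right (axis k 1))"
    for y
  have D: "blinfun_apply (D y) v = (\<Sum>k\<in>UNIV. v $ k * partial_deriv k f y)" for y v
    by (simp add: D_def blinfun.sum_left blinfun.scaleR_left inner_axis' mult.commute)
  have fD: "(f has_derivative blinfun_apply (D y)) (at y)" for y
    using has_derivative_partials[OF df, of y] by (simp add: D[abs_def] eta_contract_eq)
  define fx where "fx x t = (t ^ Suc n) *\<^sub>R D (z + t *\<^sub>R (x - z))" for x t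
  have cp: "continuous_on S g \<Longrightarrow> continuous_on S (\<lambda>u. partial_deriv k f (g u))"
    for S :: "((real^'m) \<times> real) set" and g k
    by (rule continuous_on_compose2[OF cf]) auto
  have cp': "continuous_on S g \<Longrightarrow> continuous_on S (\<lambda>u. partial_deriv k f (g u))"
    for S :: "real set" and g k
    by (rule continuous_on_compose2[OF cf]) auto
  have cf': "continuous_on S g \<Longrightarrow> continuous_on S (\<lambda>u. f (g u))" for S :: "real set" and g
    by (rule continuous_on_compose2[OF differentiable_imp_continuous_on[OF df]]) auto
  have der: "((\<lambda>x. integral (cbox 0 1) (\<lambda>t. t ^ n * f (z + t *\<^sub>R (x - z)))) has_derivative
      blinfun_apply (integral (cbox 0 1) (fx x))) (at x within UNIV)"
  proof (rule leibniz_rule)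
    fix x and t :: real
    have "((\<lambda>x. z + t *\<^sub>R (x - z)) has_derivative (\<lambda>v. t *\<^sub>R v)) (at x)"
      by (auto intro!: derivative_eq_intros)
    from has_derivative_compose[OF this fD]
    have "((\<lambda>x. f (z + t *\<^sub>R (x - z))) has_derivative
        (\<lambda>v. blinfun_apply (D (z + t *\<^sub>R (x - z))) (t *\<^sub>R v))) (at x)" .
    then have "((\<lambda>x. t ^ n * f (z + t *\<^sub>R (x - z))) has_derivative
        (\<lambda>v. t ^ n * blinfun_apply (D (z + t *\<^sub>R (x - z))) (t *\<^sub>R v))) (at x)"
      by (rule has_derivative_mult_right)
    also have "(\<lambda>v. t ^ n * blinfun_apply (D (z + t *\<^sub>R (x - z))) (t *\<^sub>R v)) = blinfun_apply (fx x t)"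
      by (auto simp: fx_def blinfun.scaleR_left blinfun.scaleR_right)
    finally show "((\<lambda>x. t ^ n * f (z + t *\<^sub>R (x
        - z))) has_derivative blinfun_apply (fx x t)) (at x within UNIV)"
      by simp
  next
    fix x
    show "(\<lambda>t. t ^ n * f (z + t *\<^sub>R (x - z))) integrable_on cbox 0 1"
      by (intro integrable_continuous continuous_intros cf')
  next
    show "continuous_on (UNIV \<times> cbox 0 1) (\<lambda>(x, t). fx x t)"
      unfolding fx_def D_def by (auto simp: split_beta intro!: continuous_intros cp)
  qed auto
  have int: "fx x integrable_on cbox 0 1"
    unfolding fx_def D_def by (intro integrable_continuous continuous_intros cp')
  have "blinfun_apply (integral (cbox 0 1) (fx x)) v
      = (\<Sum>k\<in>UNIV. v $ k * radial_mean z (Suc n) (partial_deriv k f) x)" for v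
  proof -
    have "blinfun_apply (integral (cbox 0 1) (fx x)) v = integral (cbox 0 1) (\<lambda>t. blinfun_apply (fx x t) v)"
      by (rule blinfun_apply_integral[OF int])
    also have "\<dots> = integral {0..1} (\<lambda>t. \<Sum>k\<in>UNIV. v $ k * (t ^ Suc n * partial_deriv k f (z + t *\<^sub>R (x - z))))"
      by (simp add: fx_def blinfun.scaleR_left D sum_distrib_left algebra_simps)
    also have "\<dots> = (\<Sum>k\<in>UNIV. integral {0..1} (\<lambda>t. v $ k * (t ^ Suc n * partial_deriv k f (z + t *\<^sub>R (x - z)))))"
      by (intro integral_sum integrable_continuous_real continuous_intros cp') auto
    finally show ?thesis by (simp add: radial_mean_def)
  qed
  then have "blinfun_apply (integral (cbox 0 1) (fx x))
      = (\<lambda>v. \<Sum>k\<in>UNIV. v $ k * radial_mean z (Suc n) (partial_deriv k f) x)" by (rule ext)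
  with der show ?thesis
    by (simp only: radial_mean_def[of z n, abs_def] cbox_interval)
qed

lemma partial_deriv_radial_mean:
  fixes f :: "real^'m::finite \<Rightarrow> real"
  assumes "f differentiable_on UNIV" and "\<And>k. continuous_on UNIV (partial_deriv k f)"
  shows "partial_deriv i (radial_mean z n f) = radial_mean z (Suc n) (partial_deriv i f)"
  by (subst partial_deriv_eqI[OF has_derivative_radial_mean[OF assms]])
     (auto simp: axis_def if_distrib[where f="\<lambda>x. x * _"] cong: if_cong)

text \<open>
  By induction on the order of smoothness: the partial derivatives are again radial means.
\<close>

lemma C_k_radial_mean:
  assumes "\<forall>k. C_k k f"
  shows "C_k k (radial_mean z n f)"
  using assms
proof (induction k arbitrary: f n)
  case 0
  then have "f differentiable_on UNIV" "\<And>k. continuous_on UNIV (partial_deriv k f)"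
    using C_k.simps(2)[of 0 f] by auto
  from has_derivative_radial_mean[OF this] show ?case
    by (auto simp: continuous_on_eq_continuous_at intro: has_derivative_continuous)
next
  case (Suc k)
  then have *: "f differentiable_on UNIV" "\<And>k. continuous_on UNIV (partial_deriv k f)"
    using C_k.simps(2)[of 0 f] by auto
  have "radial_mean z n f differentiable_on UNIV"
    using has_derivative_radial_mean[OF *] by (auto simp: differentiable_on_def differentiable_def)
  moreover have "\<forall>k. C_k k (partial_deriv i f)" for i
    using Suc.prems by (meson C_k.simps(2))
  ultimately show ?case
    using Suc.IH by (simp add: partial_deriv_radial_mean[OF *])
qed

lift_definition rmean :: "real^'m::finite \<Rightarrow> nat \<Rightarrow> 'm smooth_fun \<Rightarrow> 'm smooth_fun"
  is radial_mean by (intro allI C_k_radial_mean)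

lemma sf_differentiable: "sf_apply f differentiable_on UNIV"
  using sf_apply[of f] C_k.simps(2)[of 0 "sf_apply f"] by auto

lemma sf_continuous: "continuous_on UNIV (sf_apply f)"
  by (rule differentiable_imp_continuous_on[OF sf_differentiable])

lemma sf_has_derivative:
  "(sf_apply f has_derivative (\<lambda>v. \<Sum>k\<in>UNIV. v $ k * sf_apply (pd k f) x)) (at x)"
  using has_derivative_partials[OF sf_differentiable] by (simp add: pd.rep_eq)

lemma sf_eqI: "(\<And>x. sf_apply f x = sf_apply g x) \<Longrightarrow> f = g"
  by (simp add: sf_apply_inject[symmetric] fun_eq_iff)

lemma sf_simps [simp]:
  "sf_apply 0 x = 0" "sf_apply 1 x = 1" "sf_apply (f + g) x = sf_apply f x + sf_apply g x"
  "sf_apply (f * g) x = sf_apply f x * sf_apply g x" "sf_apply (- f) x = - sf_apply f x"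
  "sf_apply (f - g) x = sf_apply f x - sf_apply g x" "sf_apply (r *\<^sub>R f) x = r * sf_apply f x"
  "sf_apply (coord i) x = x $ i"
  by (simp_all only: zero_smooth_fun.rep_eq one_smooth_fun.rep_eq plus_smooth_fun.rep_eq
      times_smooth_fun.rep_eq uminus_smooth_fun.rep_eq scaleR_smooth_fun.rep_eq
      minus_smooth_fun_def[of f g] coord.rep_eq diff_conv_add_uminus[of _ "sf_apply g x"])

lemma sf_sum [simp]: "sf_apply (sum F A) x = (\<Sum>a\<in>A. sf_apply (F a) x)"
  by (induction A rule: infinite_finite_induct) auto

lemma sf_of_real [simp]: "sf_apply (of_real r) x = r"
  by (simp add: of_real_def)

lemma pd_add [simp]: "pd i (f + g) = pd i f + pd i g"
  by (rule sf_eqI) (simp add: pd.rep_eq plus_smooth_fun.rep_eq partial_deriv_add sf_differentiable)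

lemma pd_mult: "pd i (f * g) = f * pd i g + pd i f * g"
  by (rule sf_eqI) (simp add: pd.rep_eq times_smooth_fun.rep_eq partial_deriv_mult sf_differentiable)

lemma pd_one [simp]: "pd i 1 = 0"
  by (rule sf_eqI) (simp add: pd.rep_eq one_smooth_fun.rep_eq partial_deriv_const)

lemma pd_zero [simp]: "pd i 0 = 0"
  using pd_add[of i 0 0] by simp

lemma pd_of_real [simp]: "pd i (of_real r) = 0"
proof (rule sf_eqI)
  have "sf_apply (of_real r) = (\<lambda>x. r)" by (rule ext) simp
  then show "sf_apply (pd i (of_real r)) x = sf_apply 0 x" for x
    unfolding pd.rep_eq \<open>sf_apply (of_real r) = (\<lambda>x. r)\<close> partial_deriv_const by simp
qed

lemma pd_scaleR [simp]: "pd i (r *\<^sub>R f) = r *\<^sub>R pd i f"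
  using pd_mult[of i "of_real r" f] by (simp add: scaleR_conv_of_real)

lemma pd_minus [simp]: "pd i (- f) = - pd i f"
  using pd_scaleR[of i "-1" f] by simp

lemma pd_diff [simp]: "pd i (f - g) = pd i f - pd i g"
  by (simp only: diff_conv_add_uminus pd_add pd_minus)

lemma pd_sum [simp]: "pd i (sum F A) = (\<Sum>a\<in>A. pd i (F a))"
  by (induction A rule: infinite_finite_induct) auto

lemma pd_coord [simp]: "pd i (coord j) = (if i = j then 1 else 0)"
  by (rule sf_eqI) (auto simp: pd.rep_eq coord.rep_eq[abs_def] partial_deriv_coord axis_def)

lemma pd_rmean: "pd i (rmean z n f) = rmean z (Suc n) (pd i f)"
proof (rule sf_eqI)
  have "continuous_on UNIV (partial_deriv k (sf_apply f))" for k
    using sf_continuous[of "pd k f"] by (simp add: pd.rep_eq)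
  from partial_deriv_radial_mean[OF sf_differentiable this]
  show "sf_apply (pd i (rmean z n f)) x = sf_apply (rmean z (Suc n) (pd i f)) x" for x
    by (simp add: pd.rep_eq rmean.rep_eq)
qed

lemma sf_ray_deriv:
  "((\<lambda>t. sf_apply f (z + t *\<^sub>R (x - z))) has_vector_derivative
     (\<Sum>k\<in>UNIV. (x $ k - z $ k) * sf_apply (pd k f) (z + t *\<^sub>R (x - z)))) (at t within S)"
proof -
  have "((\<lambda>t. z + t *\<^sub>R (x - z)) has_derivative (\<lambda>s. s *\<^sub>R (x - z))) (at t within S)"
    by (auto intro!: derivative_eq_intros)
  from has_derivative_compose[OF this sf_has_derivative]
  show ?thesis by (simp add: has_vector_derivative_def sum_distrib_left mult.assoc)
qed

lemma sf_ray_cont: "continuous_on S (\<lambda>t. sf_apply f (z + t *\<^sub>R (x - z)))"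
  by (rule continuous_on_compose2[OF sf_continuous]) (auto intro!: continuous_intros)

text \<open>
  The fundamental theorem of calculus on the segment from \<open>z\<close> to \<open>x\<close>.
\<close>

lemma hadamard:
  "f = of_real (sf_apply f z) + (\<Sum>k\<in>UNIV. (coord k - of_real (z $ k)) * rmean z 0 (pd k f))"
proof (rule sf_eqI)
  fix x
  have "((\<lambda>t. \<Sum>k\<in>UNIV. (x $ k - z $ k) * sf_apply (pd k f) (z + t *\<^sub>R (x - z))) has_integral
      sf_apply f (z + 1 *\<^sub>R (x - z)) - sf_apply f (z + 0 *\<^sub>R (x - z))) {0..1}"
    by (rule fundamental_theorem_of_calculus) (auto intro!: sf_ray_deriv)
  then have "sf_apply f x - sf_apply f z
      = integral {0..1} (\<lambda>t. \<Sum>k\<in>UNIV. (x $ k - z $ k) * sf_apply (pd k f) (z + t *\<^sub>R (x - z)))"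
    by (simp add: integral_unique)
  also have "\<dots> = (\<Sum>k\<in>UNIV. integral {0..1} (\<lambda>t. (x $ k - z $ k) * sf_apply (pd k f) (z + t *\<^sub>R (x - z))))"
    by (intro integral_sum integrable_continuous_real continuous_intros sf_ray_cont) auto
  finally show "sf_apply f x = sf_apply (of_real (sf_apply f z)
      + (\<Sum>k\<in>UNIV. (coord k - of_real (z $ k)) * rmean z 0 (pd k f))) x"
    by (simp add: rmean.rep_eq radial_mean_def)
qed

definition euler :: "'m::finite smooth_fun \<Rightarrow> 'm smooth_fun" where
  "euler f = (\<Sum>k\<in>UNIV. coord k * pd k f)"

text \<open>
  The derivative of \<open>t\<^bsup>n+1\<^esup> f(t x)\<close> with respect to \<open>t\<close> is \<open>t\<^sup>n\<close> times the value of
  \<open>x \<cdot> \<partial> f + (n + 1) f\<close> at \<open>t x\<close>.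
\<close>

lemma euler_rmean: "euler (rmean 0 n f) + real (Suc n) *\<^sub>R rmean 0 n f = f"
proof (rule sf_eqI)
  fix x :: "real^'a"
  let ?g = "\<lambda>f t. sf_apply f (0 + t *\<^sub>R (x - 0))"
  have pow: "((\<lambda>t::real. t ^ Suc n) has_vector_derivative (real (Suc n) * t ^ n)) (at t within S)" for t S
    using DERIV_pow[of "Suc n" t S] by (simp add: has_real_derivative_iff_has_vector_derivative)
  have "((\<lambda>t. t ^ Suc n * (\<Sum>k\<in>UNIV. (x $ k - 0 $ k) * ?g (pd k f) t) + (real (Suc n) * t ^ n) * ?g f t)
      has_integral (1 ^ Suc n * ?g f 1 - 0 ^ Suc n * ?g f 0)) {0..1}"
    by (rule fundamental_theorem_of_calculus[OF zero_le_one])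
       (rule has_vector_derivative_mult[OF pow sf_ray_deriv])
  moreover have "t ^ Suc n * (\<Sum>k\<in>UNIV. (x $ k - 0 $ k) * ?g (pd k f) t) + (real (Suc n) * t ^ n) * ?g f t
      = (\<Sum>k\<in>UNIV. x $ k * (t ^ Suc n * ?g (pd k f) t)) + real (Suc n) * (t ^ n * ?g f t)" for t
    by (simp add: sum_distrib_left mult_ac del: of_nat_Suc)
  ultimately have "((\<lambda>t. (\<Sum>k\<in>UNIV. x $ k * (t ^ Suc n * ?g (pd k f) t))
      + real (Suc n) * (t ^ n * ?g f t)) has_integral (1 ^ Suc n * ?g f 1 - 0 ^ Suc n * ?g f 0)) {0..1}"
    by (simp only:)
  then have "1 ^ Suc n * ?g f 1 - 0 ^ Suc n * ?g f 0
      = integral {0..1} (\<lambda>t. (\<Sum>k\<in>UNIV. x $ k * (t ^ Suc n * ?g (pd k f) t))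
      + real (Suc n) * (t ^ n * ?g f t))"
    by (rule integral_unique[symmetric])
  also have "\<dots> = integral {0..1} (\<lambda>t. \<Sum>k\<in>UNIV. x $ k * (t ^ Suc n * ?g (pd k f) t))
      + integral {0..1} (\<lambda>t. real (Suc n) * (t ^ n * ?g f t))"
    by (intro Henstock_Kurzweil_Integration.integral_add integrable_continuous_real continuous_intros
      sf_ray_cont)
  also have "integral {0..1} (\<lambda>t. \<Sum>k\<in>UNIV. x $ k * (t ^ Suc n * ?g (pd k f) t))
      = (\<Sum>k\<in>UNIV. integral {0..1} (\<lambda>t. x $ k * (t ^ Suc n * ?g (pd k f) t)))"
    by (intro integral_sum integrable_continuous_real continuous_intros sf_ray_cont) auto
  finally show "sf_apply (euler (rmean 0 n f) + real (Suc n) *\<^sub>R rmean 0 n f) x = sf_apply f x"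
    by (simp add: euler_def pd_rmean rmean.rep_eq radial_mean_def del: of_nat_Suc power_Suc)
qed

lemma pd_euler_const: "euler (of_real r) = 0" by (simp add: euler_def)

lemma euler_mult: "euler (f * g) = euler f * g + f * euler g"
  by (simp add: euler_def pd_mult sum.distrib sum_distrib_left sum_distrib_right algebra_simps)

lemma euler_coord: "euler (coord k) = coord k"
  by (simp add: euler_def if_distrib cong: if_cong)

lemma euler_add [simp]: "euler (f + g) = euler f + euler g"
  by (simp add: euler_def sum.distrib algebra_simps)

lemma euler_sum: "euler (sum F A) = (\<Sum>a\<in>A. euler (F a))"
  by (induction A rule: infinite_finite_induct) (auto simp: euler_def algebra_simps sum.distrib)

text \<open>
  For \<open>n = 0\<close>, Hadamard's lemma writes \<open>f - f(0)\<close> as \<open>\<Sum>\<^sub>k x\<^sup>k g\<^sub>k\<close>; since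
  \<open>x \<cdot> \<partial> (x\<^sup>k h) = x\<^sup>k (x \<cdot> \<partial> h + h)\<close>, it suffices to invert \<open>x \<cdot> \<partial> + 1\<close> on each \<open>g\<^sub>k\<close>.
\<close>

lemma euler_solve: "\<exists>g. euler g + real n *\<^sub>R g = (if n = 0 then f - of_real (sf_apply f 0) else f)"
proof (cases n)
  case (Suc m)
  then show ?thesis using euler_rmean[of m f] by auto
next
  case 0
  \<comment> \<open>the inner mean is the Hadamard quotient, the outer one inverts \<open>x \<cdot> \<partial> + 1\<close>\<close>
  define h where "h k = rmean 0 0 (rmean 0 0 (pd k f))" for k
  have "euler (\<Sum>k\<in>UNIV. coord k * h k) = (\<Sum>k\<in>UNIV. coord k * (euler (h k) + real (Suc 0) *\<^sub>R h k))"
    by (simp add: euler_sum euler_mult euler_coord algebra_simps)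
  also have "\<dots> = (\<Sum>k\<in>UNIV. coord k * rmean 0 0 (pd k f))"
    by (simp only: h_def euler_rmean)
  also have "\<dots> = f - of_real (sf_apply f 0)"
    using hadamard[of f 0] by (simp add: algebra_simps)
  finally show ?thesis using 0 by auto
qed

text \<open>
  The function \<open>t \<mapsto> t\<^sup>n f(t x)\<close> is constant on the unit interval.
\<close>

lemma euler_kernel:
  assumes "euler f + real n *\<^sub>R f = 0"
  shows "f = (if n = 0 then of_real (sf_apply f 0) else 0)"
proof (rule sf_eqI)
  fix x :: "real^'a"
  let ?g = "\<lambda>f t. sf_apply f (0 + t *\<^sub>R (x - 0))"
  have ev: "(\<Sum>k\<in>UNIV. y $ k * sf_apply (pd k f) y) + real n * sf_apply f y = 0" for y
    using arg_cong[OF assms, of "\<lambda>f. sf_apply f y"] by (simp add: euler_def)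
  have d: "((\<lambda>t. t ^ n * ?g f t) has_vector_derivative
      (t ^ n * (\<Sum>k\<in>UNIV. (x $ k - 0 $ k) * ?g (pd k f) t) + (real n * t ^ (n - 1)) * ?g f t)) (at t)" for t
    by (rule has_vector_derivative_mult[OF _ sf_ray_deriv])
       (use DERIV_pow[of n t] in \<open>simp add: has_real_derivative_iff_has_vector_derivative\<close>)
  have z: "t ^ n * (\<Sum>k\<in>UNIV. (x $ k - 0 $ k) * ?g (pd k f) t) + (real n * t ^ (n - 1)) * ?g f t = 0" (is "?d
      = 0")
    if "t > 0" for t
  proof -
    have "real n * t ^ n = t * (t ^ (n - 1) * real n)" by (cases n) auto
    then have "t * ?d = t ^ n * ((\<Sum>k\<in>UNIV. (t *\<^sub>R x) $ k * sf_apply (pd k f) (t *\<^sub>R x))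
        + real n * sf_apply f (t *\<^sub>R x))"
      by (auto simp: sum_distrib_left algebra_simps)
    with that show ?thesis by (simp only: ev) auto
  qed
  have "(\<lambda>t. t ^ n * ?g f t) 1 = (\<lambda>t. t ^ n * ?g f t) 0"
  proof (rule DERIV_isconst_end[where f = "\<lambda>t. t ^ n * ?g f t" and a = 0 and b = 1])
    show "continuous_on {0..1} (\<lambda>t. t ^ n * ?g f t)"
      by (intro continuous_intros sf_ray_cont)
    show "((\<lambda>t. t ^ n * ?g f t) has_real_derivative 0) (at t)" if "0 < t" "t < 1" for t
      using d[of t] z[OF that(1)] by (simp add: has_real_derivative_iff_has_vector_derivative)
  qed simp
  then show "sf_apply f x = sf_apply (if n = 0 then of_real (sf_apply f 0) else 0) x"
    by (cases "n = 0") auto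
qed

text \<open>
  At a given point \<open>x\<close>, Hadamard's lemma expresses \<open>f\<close> through a constant and products in which one
  factor is a coordinate function minus its value at \<open>x\<close>; so \<open>D f\<close> at \<open>x\<close> only involves the values
  of \<open>D\<close> on coordinates.
\<close>

lemma derivation_eq_0:
  assumes add: "\<And>f g. D (f + g) = D f + (D g :: 'm::finite smooth_fun)"
    and mult: "\<And>f g. D (f * g) = f * D g + D f * g"
    and const: "\<And>r. D (of_real r) = 0"
    and coord: "\<And>k. D (coord k) = 0"
  shows "D f = 0"
proof (rule sf_eqI)
  fix x
  let ?h = "\<lambda>k. rmean x 0 (pd k f)"
  have sum: "D (sum F A) = (\<Sum>a\<in>A. D (F a))" for F and A :: "'m set"
    by (induction A rule: infinite_finite_induct) (use const[of 0] in \<open>auto simp: add\<close>)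
  have "D (coord k - of_real r) = 0" for k r
    using add[of "coord k" "of_real (- r)"] by (simp add: const coord del: of_real_minus) (simp add: )
  then have "D f = (\<Sum>k\<in>UNIV. (coord k - of_real (x $ k)) * D (?h k))"
    by (subst hadamard[of f x]) (simp add: add sum mult const)
  then show "sf_apply (D f) x = sf_apply 0 x" by simp
qed

text \<open>
  The commutator of two derivations is a derivation.
\<close>

lemma pd_commute: "pd i (pd j f) = pd j (pd i f)"
proof -
  have "pd i (pd j f) - pd j (pd i f) = 0"
    by (rule derivation_eq_0) (auto simp: pd_mult algebra_simps if_distrib[of "pd _"])
  then show ?thesis by simp
qed

text \<open>
  Hadamard's lemma once more: modulo functions that vanish at the given point, \<open>f\<close> is a constant.
\<close>

lemma commutes_with_coords_imp_mult:
  fixes A :: "'m::finite smooth_fun \<Rightarrow> 'm smooth_fun"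
  assumes add: "\<And>f g. A (f + g) = A f + A g" and scale: "\<And>r f. A (r *\<^sub>R f) = r *\<^sub>R A f"
    and coord: "\<And>k f. A (coord k * f) = coord k * A f"
  shows "A f = A 1 * f"
proof (rule sf_eqI)
  fix x
  let ?h = "\<lambda>k. rmean x 0 (pd k f)"
  have sum: "A (sum F S) = (\<Sum>a\<in>S. A (F a))" for F and S :: "'m set"
    by (induction S rule: infinite_finite_induct) (use scale[of 0 0] in \<open>auto simp: add\<close>)
  have c: "A (of_real r * f) = of_real r * A f" for r f
    using scale[of r f] by (simp add: scaleR_conv_of_real)
  have diff: "A (f - g) = A f - A g" for f g
    using add[of "f - g" g] by simp
  have "A f = of_real (sf_apply f x) * A 1 + (\<Sum>k\<in>UNIV. (coord k - of_real (x $ k)) * A (?h k))"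
    by (subst hadamard[of f x]) (use c[of _ 1] in \<open>simp add: add sum diff c coord left_diff_distrib\<close>)
  then show "sf_apply (A f) x = sf_apply (A 1 * f) x" by simp
qed

section \<open>Chevalley--Eilenberg calculus by recursion on the argument list\<close>

text \<open>
  The second equation is \<open>[L\<^sub>x, i\<^sub>y] = i\<^bsub>[x,y]\<^esub>\<close>, read as a recursion for the Lie derivative.
\<close>

fun cochain_lie :: "('g \<Rightarrow> 'g \<Rightarrow> 'g) \<Rightarrow> ('g \<Rightarrow> 'w \<Rightarrow> 'w) \<Rightarrow> 'g \<Rightarrow> ('g list \<Rightarrow> 'w) \<Rightarrow> 'g list \<Rightarrow> 'w::real_vector" where
  "cochain_lie br act x c [] = act x (c [])"
| "cochain_lie br act x c (y # ys) = cochain_lie br act x (\<lambda>zs. c (y # zs)) ys - c (br x y # ys)"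

text \<open>
  Cartan's formula \<open>L\<^sub>x = d i\<^sub>x + i\<^sub>x d\<close>, read as a recursion for the differential. In this form
  the identities of the calculus are inductions on the argument list that involve no signs, and
  most of them hold for multilinear maps that need not be alternating.
\<close>

fun cochain_d :: "('g \<Rightarrow> 'g \<Rightarrow> 'g) \<Rightarrow> ('g \<Rightarrow> 'w \<Rightarrow> 'w) \<Rightarrow> ('g list \<Rightarrow> 'w) \<Rightarrow> 'g list \<Rightarrow> 'w::real_vector" where
  "cochain_d br act c [] = 0"
| "cochain_d br act c (x # xs) = cochain_lie br act x c xs - cochain_d br act (\<lambda>zs. c (x # zs)) xs"

text \<open>
  Lists of every length are allowed as arguments; \<open>of_degree\<close> below selects one length.
\<close>

definition multilinear :: "'w::real_vector set \<Rightarrow> ('g::real_vector list \<Rightarrow> 'w) \<Rightarrow> bool" where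
  "multilinear W c \<longleftrightarrow> (\<forall>xs. c xs \<in> W)
     \<and> (\<forall>ps qs x y. c (ps @ (x + y) # qs) = c (ps @ x # qs) + c (ps @ y # qs))
     \<and> (\<forall>ps qs x r. c (ps @ (r *\<^sub>R x) # qs) = r *\<^sub>R c (ps @ x # qs))"

text \<open>
  Only neighbouring arguments are exchanged, since this is what the list recursions preserve
  visibly.
\<close>

definition skew :: "('g list \<Rightarrow> 'w::real_vector) \<Rightarrow> bool" where
  "skew c \<longleftrightarrow> (\<forall>ps qs x y. c (ps @ x # y # qs) = - c (ps @ y # x # qs))"

definition of_degree :: "nat \<Rightarrow> ('g list \<Rightarrow> 'w::real_vector) \<Rightarrow> bool" where
  "of_degree u c \<longleftrightarrow> (\<forall>xs. length xs \<noteq> u \<longrightarrow> c xs = 0)"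

lemma multilinear_in: "multilinear W c \<Longrightarrow> c xs \<in> W"
  and multilinear_add: "multilinear W c \<Longrightarrow> c (ps @ (x + y) # qs) = c (ps @ x # qs) + c (ps @ y # qs)"
  and multilinear_scale: "multilinear W c \<Longrightarrow> c (ps @ (r *\<^sub>R x) # qs) = r *\<^sub>R c (ps @ x # qs)"
  by (auto simp: multilinear_def)

lemma multilinear_Cons: "multilinear W c \<Longrightarrow> multilinear W (\<lambda>zs. c (x # zs))"
  using multilinear_add[of W c "x # _"] multilinear_scale[of W c "x # _"]
  by (simp add: multilinear_def)

lemma multilinear_hd:
  assumes "multilinear W c"
  shows "c ((x + y) # zs) = c (x # zs) + c (y # zs)"
    and "c ((r *\<^sub>R x) # zs) = r *\<^sub>R c (x # zs)"
    and "c ((- x) # zs) = - c (x # zs)"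
    and "c ((x - y) # zs) = c (x # zs) - c (y # zs)"
    and "c (0 # zs) = 0"
proof -
  note a = multilinear_add[OF assms, of "[]", simplified] multilinear_scale[OF assms, of "[]", simplified]
  show "c ((x + y) # zs) = c (x # zs) + c (y # zs)"
    and "c ((r *\<^sub>R x) # zs) = r *\<^sub>R c (x # zs)" by (simp_all add: a)
  show m: "c ((- x) # zs) = - c (x # zs)" for x using a(2)[of "-1" x zs] by simp
  show "c (0 # zs) = 0" using a(2)[of 0 0 zs] by simp
  show "c ((x - y) # zs) = c (x # zs) - c (y # zs)"
    using a(1)[of x "-y" zs] by (simp add: m)
qed

lemma skew_swap: "skew c \<Longrightarrow> c (ps @ x # y # qs) = - c (ps @ y # x # qs)"
  unfolding skew_def by blast

lemma skew_hd: "skew c \<Longrightarrow> c (x # y # qs) = - c (y # x # qs)"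
  using skew_swap[of c "[]" x y qs] by simp

lemma skew_Cons: assumes "skew c" shows "skew (\<lambda>zs. c (x # zs))"
  unfolding skew_def
proof (intro allI)
  show "c (x # ps @ y # z # qs) = - c (x # ps @ z # y # qs)" for ps qs y z
    using skew_swap[OF assms, of "x # ps" y z qs] by simp
qed

lemma multilinear_lincomb:
  assumes "subspace W" "multilinear W c" "multilinear W c'"
  shows "multilinear W (\<lambda>xs. c xs + c' xs)" "multilinear W (\<lambda>xs. c xs - c' xs)"
    "multilinear W (\<lambda>xs. r *\<^sub>R c xs)" "multilinear W (\<lambda>xs. - c xs)"
  using assms unfolding multilinear_def
  by (auto simp: subspace_add subspace_diff subspace_scale subspace_neg algebra_simps)

lemma multilinear_zero: "subspace W \<Longrightarrow> multilinear W (\<lambda>xs. 0)"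
  by (simp add: multilinear_def subspace_0)

lemma skew_lincomb:
  assumes "skew c" "skew c'"
  shows "skew (\<lambda>xs. c xs + c' xs)" "skew (\<lambda>xs. c xs - c' xs)" "skew (\<lambda>xs. r *\<^sub>R c xs)"
proof -
  have "c (ps @ x # y # qs) = - c (ps @ y # x # qs) \<and> c' (ps @ x # y # qs) = - c' (ps @ y # x # qs)"
    for ps x y qs using assms by (auto intro: skew_swap)
  then show "skew (\<lambda>xs. c xs + c' xs)" "skew (\<lambda>xs. c xs - c' xs)" "skew (\<lambda>xs. r *\<^sub>R c xs)"
    unfolding skew_def by (metis add.commute minus_add_distrib, metis minus_diff_eq minus_diff_minus,
      metis scaleR_minus_right)
qed

lemma of_degree_Cons: "of_degree (Suc u) c \<Longrightarrow> of_degree u (\<lambda>zs. c (x # zs))"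
  by (simp add: of_degree_def)

lemma skew_move:
  assumes "skew c"
  shows "c (ps @ ms @ x # qs) = (-1) ^ length ms *\<^sub>R c (ps @ x # ms @ qs)"
proof (induction ms arbitrary: ps)
  case (Cons m ms)
  have "c (ps @ (m # ms) @ x # qs) = (-1) ^ length ms *\<^sub>R c ((ps @ [m]) @ x # ms @ qs)"
    using Cons.IH[of "ps @ [m]"] by simp
  also have "\<dots> = (-1) ^ length (m # ms) *\<^sub>R c (ps @ x # (m # ms) @ qs)"
    using skew_swap[OF assms, of ps m x] by simp
  finally show ?case .
qed simp

text \<open>
  If two arguments are equal, one of them can be moved next to the other.
\<close>

lemma alt_maps_UNIV_iff:
  assumes "subspace W"
  shows "c \<in> alt_maps UNIV W u \<longleftrightarrow> multilinear W c \<and> skew c \<and> of_degree u c"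
proof
  assume c: "c \<in> alt_maps UNIV W u"
  have W: "c xs \<in> W" if "length xs = u" for xs using c that by (auto simp: alt_maps_def)
  have deg: "c xs = 0" if "length xs \<noteq> u" for xs using c that by (auto simp: alt_maps_def)
  have add: "c (ps @ (x + y) # qs) = c (ps @ x # qs) + c (ps @ y # qs)" for ps qs x y
  proof (cases "length ps + length qs + 1 = u")
    case True
    then have "c ((ps @ x # qs)[length ps := x + y])
        = c ((ps @ x # qs)[length ps := x]) + c ((ps @ x # qs)[length ps := y])"
      using c unfolding alt_maps_def by (auto simp del: list_update_length)
    then show ?thesis by simp
  qed (auto simp: deg)
  have scale: "c (ps @ (r *\<^sub>R x) # qs) = r *\<^sub>R c (ps @ x # qs)" for ps qs x r
  proof (cases "length ps + length qs + 1 = u")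
    case True
    then have "c ((ps @ x # qs)[length ps := r *\<^sub>R x]) = r *\<^sub>R c ((ps @ x # qs)[length ps := x])"
      using c unfolding alt_maps_def by (auto simp del: list_update_length)
    then show ?thesis by simp
  qed (auto simp: deg)
  have eq: "c (ps @ x # x # qs) = 0" for ps qs x
  proof (cases "length ps + length qs + 2 = u")
    case True
    then have "(ps @ x # x # qs) ! length ps = (ps @ x # x # qs) ! Suc (length ps)"
      by (simp add: nth_append)
    moreover have "length (ps @ x # x # qs) = u" "length ps < Suc (length ps)" "Suc (length ps) < u"
      using True by auto
    ultimately show ?thesis using c unfolding alt_maps_def by blast
  qed (auto simp: deg)
  have "skew c"
    unfolding skew_def
  proof (intro allI)
    fix ps qs x y
    have "0 = c (ps @ (x + y) # (x + y) # qs)" by (simp add: eq)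
    also have "\<dots> = c (ps @ x # (x + y) # qs) + c (ps @ y # (x + y) # qs)" by (rule add)
    also have "c (ps @ x # (x + y) # qs) = c (ps @ x # x # qs) + c (ps @ x # y # qs)"
      using add[of "ps @ [x]"] by simp
    also have "c (ps @ y # (x + y) # qs) = c (ps @ y # x # qs) + c (ps @ y # y # qs)"
      using add[of "ps @ [y]"] by simp
    finally show "c (ps @ x # y # qs) = - c (ps @ y # x # qs)" by (simp add: eq eq_neg_iff_add_eq_0)
  qed
  moreover have "c xs \<in> W" for xs by (cases "length xs = u") (auto simp: W deg subspace_0[OF assms])
  ultimately show "multilinear W c \<and> skew c \<and> of_degree u c"
    by (simp add: multilinear_def of_degree_def add scale deg)
next
  assume "multilinear W c \<and> skew c \<and> of_degree u c"
  then have c: "multilinear W c" "skew c" "of_degree u c" by auto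
  have "c xs = 0" if ij: "i < j" "j < length xs" "xs ! i = xs ! j" for xs i j
  proof -
    define ms where "ms = take (j - Suc i) (drop (Suc i) xs)"
    have "drop (Suc i) xs = ms @ drop j xs"
      unfolding ms_def using ij by (metis Suc_leI append_take_drop_id drop_drop le_add_diff_inverse2)
    also have "drop j xs = xs ! i # drop (Suc j) xs" using ij by (simp add: Cons_nth_drop_Suc)
    finally have xs: "xs = take i xs @ xs ! i # ms @ xs ! i # drop (Suc j) xs"
      using ij id_take_nth_drop[of i xs] by simp
    define x where "x = xs ! i"
    have "c (take i xs @ x # x # ms @ drop (Suc j) xs) = - c (take i xs @ x # x # ms @ drop (Suc j) xs)"
      by (rule skew_swap[OF c(2)])
    then have "2 *\<^sub>R c (take i xs @ x # x # ms @ drop (Suc j) xs) = 0"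
      by (simp only: scaleR_2 eq_neg_iff_add_eq_0)
    then have "c (take i xs @ x # x # ms @ drop (Suc j) xs) = 0" by simp
    moreover have "c ((take i xs @ [x]) @ ms @ x # drop (Suc j) xs)
        = (-1) ^ length ms *\<^sub>R c ((take i xs @ [x]) @ x # ms @ drop (Suc j) xs)"
      by (rule skew_move[OF c(2)])
    ultimately show "c xs = 0" using xs by (simp add: x_def)
  qed
  then show "c \<in> alt_maps UNIV W u"
    using c unfolding alt_maps_def
    by (auto simp: upd_conv_take_nth_drop multilinear_add multilinear_scale multilinear_in of_degree_def)
qed

text \<open>
  The formula for the differential without the condition on the support.
\<close>

definition ce_sum :: "('g \<Rightarrow> 'g \<Rightarrow> 'g) \<Rightarrow> ('g \<Rightarrow> 'w \<Rightarrow> 'w) \<Rightarrow> ('g list \<Rightarrow> 'w) \<Rightarrow> 'g list \<Rightarrow> 'w::real_vector" where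
  "ce_sum br act c xs =
     (\<Sum>i<length xs. (-1) ^ i *\<^sub>R act (xs ! i) (c (nths xs (- {i})))) +
     (\<Sum>j<length xs. \<Sum>i<j. (-1) ^ (i + j) *\<^sub>R c (br (xs ! i) (xs ! j) # nths xs (- {i, j})))"

lemma ce_diff_eq_ce_sum:
  "ce_diff G br act u c = (\<lambda>xs. if length xs = Suc u \<and> set xs \<subseteq> G then ce_sum br act c xs else 0)"
  by (rule ext) (auto simp: ce_diff_def ce_sum_def lessThan_Suc_atMost)

lemma nths_Cons_Compl: "nths (x # xs) (- {0}) = xs" "nths (x # xs) (- {Suc i}) = x # nths xs (- {i})"
  "nths (x # xs) (- {0, Suc i}) = nths xs (- {i})"
  "nths (x # xs) (- {Suc i, Suc j}) = x # nths xs (- {i, j})"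
proof -
  have "{j. Suc j \<in> - {0}} = UNIV" "{j. Suc j \<in> - {Suc i}} = - {i}" "{j. Suc j \<in> - {0, Suc i}} = - {i}"
    "{k. Suc k \<in> - {Suc i, Suc j}} = - {i, j}" by auto
  then show "nths (x # xs) (- {0}) = xs" "nths (x # xs) (- {Suc i}) = x # nths xs (- {i})"
    "nths (x # xs) (- {0, Suc i}) = nths xs (- {i})"
    "nths (x # xs) (- {Suc i, Suc j}) = x # nths xs (- {i, j})"
    by (simp_all add: nths_Cons nths_all)
qed

text \<open>
  Skew symmetry moves every bracket to the front, which produces the sign.
\<close>

lemma cochain_lie_eq_sum:
  assumes "skew c"
  shows "cochain_lie br act x c xs = act x (c xs)
    + (\<Sum>j<length xs. (-1) ^ Suc j *\<^sub>R c (br x (xs ! j) # nths xs (- {j})))"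
  using assms
proof (induction xs arbitrary: c)
  case (Cons y ys)
  have "(\<Sum>j<length ys. (-1) ^ Suc j *\<^sub>R c (y # br x (ys ! j) # nths ys (- {j})))
      = (\<Sum>j<length ys. (-1) ^ Suc (Suc j) *\<^sub>R c (br x (ys ! j) # y # nths ys (- {j})))"
    by (rule sum.cong) (simp_all add: skew_hd[OF Cons.prems, of y])
  then show ?case
    using Cons.IH[OF skew_Cons[OF Cons.prems]]
    by (simp add: nths_Cons_Compl sum.lessThan_Suc_shift del: power_Suc sum.lessThan_Suc)
qed simp

text \<open>
  The terms that act with the first argument or bracket it with another one make up the Lie
  derivative; the others form the same sum for the contracted cochain.
\<close>

lemma ce_sum_eq_cochain_d:
  assumes "skew c" and "\<And>x w. act x (- w) = - act x w"
  shows "ce_sum br act c xs = cochain_d br act c xs"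
  using assms(1)
proof (induction xs arbitrary: c)
  case (Cons x xs)
  have 1: "(\<Sum>i<length (x # xs). (-1) ^ i *\<^sub>R act ((x # xs) ! i) (c (nths (x # xs) (- {i}))))
      = act x (c xs) - (\<Sum>i<length xs. (-1) ^ i *\<^sub>R act (xs ! i) (c (x # nths xs (- {i}))))"
    by (simp add: sum.lessThan_Suc_shift nths_Cons_Compl sum_negf del: sum.lessThan_Suc)
  have 2: "(\<Sum>j<length (x # xs). \<Sum>i<j. (-1) ^ (i
      + j) *\<^sub>R c (br ((x # xs) ! i) ((x # xs) ! j) # nths (x # xs) (- {i, j})))
     = (\<Sum>j<length xs. (-1) ^ Suc j *\<^sub>R c (br x (xs ! j) # nths xs (- {j})))
     - (\<Sum>j<length xs. \<Sum>i<j. (-1) ^ (i + j) *\<^sub>R c (x # br (xs ! i) (xs ! j) # nths xs (- {i, j})))"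
    by (simp add: sum.lessThan_Suc_shift nths_Cons_Compl sum.distrib skew_hd[OF Cons.prems, of _ x] sum_negf
      sum_subtractf del: sum.lessThan_Suc)
  show ?case
    using Cons.IH[OF skew_Cons[OF Cons.prems], of x, symmetric]
    by (simp only: ce_sum_def[of br act c] 1 2 cochain_d.simps cochain_lie_eq_sum[OF Cons.prems])
       (simp add: ce_sum_def)
qed (simp add: ce_sum_def)

text \<open>
  The representation is only required on the subspace \<open>W\<close>: the modules in question consist of
  operators, and \<open>act_br\<close> can fail for operators that are not additive.
\<close>

locale lie_rep =
  fixes br :: "'g::real_vector \<Rightarrow> 'g \<Rightarrow> 'g" and W :: "'w::real_vector set" and act :: "'g \<Rightarrow> 'w \<Rightarrow> 'w"
  assumes br_add: "br x (y + z) = br x y + br x z"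
    and br_scale: "br x (r *\<^sub>R y) = r *\<^sub>R br x y"
    and br_anti: "br x y = - br y x"
    and jacobi: "br x (br y z) = br (br x y) z + br y (br x z)"
    and W: "subspace W"
    and act_closed: "w \<in> W \<Longrightarrow> act x w \<in> W"
    and act_add: "v \<in> W \<Longrightarrow> w \<in> W \<Longrightarrow> act x (v + w) = act x v + act x w"
    and act_scale: "w \<in> W \<Longrightarrow> act x (r *\<^sub>R w) = r *\<^sub>R act x w"
    and act_add_left: "w \<in> W \<Longrightarrow> act (x + y) w = act x w + act y w"
    and act_scale_left: "w \<in> W \<Longrightarrow> act (r *\<^sub>R x) w = r *\<^sub>R act x w"
    and act_br: "w \<in> W \<Longrightarrow> act (br x y) w = act x (act y w) - act y (act x w)"
begin

abbreviation "Lie \<equiv> cochain_lie br act"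
abbreviation "d \<equiv> cochain_d br act"
abbreviation "ml \<equiv> multilinear W"

lemma br_add_left: "br (x + y) z = br x z + br y z"
  using br_add[of z x y] by (simp add: br_anti[of _ z])

lemma br_scale_left: "br (r *\<^sub>R x) z = r *\<^sub>R br x z"
  using br_scale[of z r x] by (simp add: br_anti[of _ z])

lemma Lie_in: "ml c \<Longrightarrow> Lie x c xs \<in> W"
  by (induction xs arbitrary: c)
     (auto intro!: act_closed subspace_diff[OF W] multilinear_Cons dest: multilinear_in)

lemma d_in: "ml c \<Longrightarrow> d c xs \<in> W"
  by (induction xs arbitrary: c) (auto intro!: subspace_diff[OF W] Lie_in multilinear_Cons subspace_0[OF W])

lemma Lie_add: "ml c \<Longrightarrow> ml c' \<Longrightarrow> Lie x (\<lambda>zs. c zs + c' zs) xs = Lie x c xs + Lie x c' xs"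
  by (induction xs arbitrary: c c') (auto simp: act_add multilinear_in multilinear_Cons)

lemma Lie_scale: "ml c \<Longrightarrow> Lie x (\<lambda>zs. r *\<^sub>R c zs) xs = r *\<^sub>R Lie x c xs"
  by (induction xs arbitrary: c) (auto simp: act_scale multilinear_in multilinear_Cons algebra_simps)

lemma Lie_minus: "ml c \<Longrightarrow> Lie x (\<lambda>zs. - c zs) xs = - Lie x c xs"
  using Lie_scale[of c x "-1"] by simp

lemma Lie_diff: "ml c \<Longrightarrow> ml c' \<Longrightarrow> Lie x (\<lambda>zs. c zs - c' zs) xs = Lie x c xs - Lie x c' xs"
  using Lie_add[of c "\<lambda>zs. - c' zs"] by (simp add: Lie_minus multilinear_lincomb[OF W])

lemma Lie_add_left: "ml c \<Longrightarrow> Lie (x + y) c xs = Lie x c xs + Lie y c xs"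
  by (induction xs arbitrary: c)
     (auto simp: act_add_left multilinear_in multilinear_Cons br_add_left multilinear_hd algebra_simps)

lemma Lie_scale_left: "ml c \<Longrightarrow> Lie (r *\<^sub>R x) c xs = r *\<^sub>R Lie x c xs"
  by (induction xs arbitrary: c)
     (auto simp: act_scale_left multilinear_in multilinear_Cons br_scale_left multilinear_hd algebra_simps)

lemma d_add: "ml c \<Longrightarrow> ml c' \<Longrightarrow> d (\<lambda>zs. c zs + c' zs) xs = d c xs + d c' xs"
  by (induction xs arbitrary: c c') (auto simp: Lie_add multilinear_Cons)

lemma d_scale: "ml c \<Longrightarrow> d (\<lambda>zs. r *\<^sub>R c zs) xs = r *\<^sub>R d c xs"
  by (induction xs arbitrary: c) (auto simp: Lie_scale multilinear_Cons algebra_simps)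

lemma d_minus: "ml c \<Longrightarrow> d (\<lambda>zs. - c zs) xs = - d c xs"
  using d_scale[of c "-1"] by simp

lemma d_diff: "ml c \<Longrightarrow> ml c' \<Longrightarrow> d (\<lambda>zs. c zs - c' zs) xs = d c xs - d c' xs"
  using d_add[of c "\<lambda>zs. - c' zs"] by (simp add: d_minus multilinear_lincomb[OF W])

lemma multilinear_Lie: assumes "ml c" shows "ml (Lie x c)"
proof -
  have "Lie x c (ps @ (y + z) # qs) = Lie x c (ps @ y # qs) + Lie x c (ps @ z # qs)" for y z ps qs
    using assms
  proof (induction ps arbitrary: c)
    case Nil
    have "(\<lambda>zs. c ((y + z) # zs)) = (\<lambda>zs. c (y # zs) + c (z # zs))"
      using Nil by (simp add: multilinear_hd)
    then show ?case using Nil by (simp add: Lie_add multilinear_Cons br_add multilinear_hd)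
  next
    case (Cons p ps)
    then show ?case
      using multilinear_add[of W c "br x p # ps"] by (simp add: multilinear_Cons)
  qed
  moreover have "Lie x c (ps @ (r *\<^sub>R y) # qs) = r *\<^sub>R Lie x c (ps @ y # qs)" for y r ps qs
    using assms
  proof (induction ps arbitrary: c)
    case Nil
    have "(\<lambda>zs. c ((r *\<^sub>R y) # zs)) = (\<lambda>zs. r *\<^sub>R c (y # zs))"
      using Nil by (simp add: multilinear_hd)
    then show ?case using Nil by (simp add: Lie_scale multilinear_Cons br_scale multilinear_hd algebra_simps)
  next
    case (Cons p ps)
    then show ?case
      using multilinear_scale[of W c "br x p # ps"] by (simp add: multilinear_Cons algebra_simps)
  qed
  ultimately show ?thesis using Lie_in[OF assms] by (simp add: multilinear_def)
qed

lemma multilinear_d: assumes "ml c" shows "ml (d c)"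
proof -
  have "d c (ps @ (y + z) # qs) = d c (ps @ y # qs) + d c (ps @ z # qs)" for y z ps qs
    using assms
  proof (induction ps arbitrary: c)
    case Nil
    have "(\<lambda>zs. c ((y + z) # zs)) = (\<lambda>zs. c (y # zs) + c (z # zs))"
      using Nil by (simp add: multilinear_hd)
    then show ?case using Nil by (simp add: Lie_add_left d_add multilinear_Cons)
  next
    case (Cons p ps)
    then show ?case
      using multilinear_add[OF multilinear_Lie[OF Cons.prems]] by (simp add: multilinear_Cons)
  qed
  moreover have "d c (ps @ (r *\<^sub>R y) # qs) = r *\<^sub>R d c (ps @ y # qs)" for y r ps qs
    using assms
  proof (induction ps arbitrary: c)
    case Nil
    have "(\<lambda>zs. c ((r *\<^sub>R y) # zs)) = (\<lambda>zs. r *\<^sub>R c (y # zs))"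
      using Nil by (simp add: multilinear_hd)
    then show ?case using Nil by (simp add: Lie_scale_left d_scale multilinear_Cons algebra_simps)
  next
    case (Cons p ps)
    then show ?case
      using multilinear_scale[OF multilinear_Lie[OF Cons.prems]] by (simp add: multilinear_Cons algebra_simps)
  qed
  ultimately show ?thesis using d_in[OF assms] by (simp add: multilinear_def)
qed

lemma skew_Lie: assumes "ml c" "skew c" shows "skew (Lie x c)"
proof -
  have "Lie x c (ps @ y # z # qs) = - Lie x c (ps @ z # y # qs)" for y z ps qs
    using assms
  proof (induction ps arbitrary: c)
    case Nil
    have "(\<lambda>zs. c (y # z # zs)) = (\<lambda>zs. - c (z # y # zs))"
      using skew_hd[OF Nil(2)] by blast
    then have "Lie x (\<lambda>zs. c (y # z # zs)) qs = - Lie x (\<lambda>zs. c (z # y # zs)) qs"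
      by (simp only: Lie_minus[OF multilinear_Cons[OF multilinear_Cons[OF Nil(1)]]])
    moreover have "c (y # br x z # qs) = - c (br x z # y # qs)" "c (br x y # z # qs) = - c (z # br x y # qs)"
      by (rule skew_hd[OF Nil(2)])+
    ultimately show ?case by simp
  next
    case (Cons p ps)
    then show ?case
      using skew_swap[OF Cons.prems(2), of "br x p # ps" y z qs] by (simp add: multilinear_Cons skew_Cons)
  qed
  then show ?thesis unfolding skew_def by blast
qed

lemma skew_d: assumes "ml c" "skew c" shows "skew (d c)"
proof -
  have "d c (ps @ y # z # qs) = - d c (ps @ z # y # qs)" for y z ps qs
    using assms
  proof (induction ps arbitrary: c)
    case Nil
    have "(\<lambda>zs. c (y # z # zs)) = (\<lambda>zs. - c (z # y # zs))"
      using skew_hd[OF Nil(2)] by blast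
    then have "d (\<lambda>zs. c (y # z # zs)) qs = - d (\<lambda>zs. c (z # y # zs)) qs"
      by (simp only: d_minus[OF multilinear_Cons[OF multilinear_Cons[OF Nil(1)]]])
    then show ?case
      using Nil by (simp add: br_anti[of z y] multilinear_hd)
  next
    case (Cons p ps)
    then show ?case
      using skew_swap[OF skew_Lie[OF Cons.prems], of p ps y z qs] by (simp add: multilinear_Cons skew_Cons)
  qed
  then show ?thesis unfolding skew_def by blast
qed

text \<open>
  A Lie derivative at a list only depends on the values at lists of the same length.
\<close>

lemma Lie_eq_0: "(\<And>zs. length zs = length xs \<Longrightarrow> c zs = 0) \<Longrightarrow> Lie x c xs = 0"
proof (induction xs arbitrary: c)
  case Nil
  then show ?case using act_scale[of 0 x 0] by (simp add: subspace_0[OF W])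
qed auto

lemma of_degree_Lie: "of_degree u c \<Longrightarrow> of_degree u (Lie x c)"
  by (simp add: of_degree_def Lie_eq_0)

lemma d_eq_0: "(\<And>zs. Suc (length zs) = length xs \<Longrightarrow> c zs = 0) \<Longrightarrow> d c xs = 0"
  by (induction xs arbitrary: c) (auto simp: Lie_eq_0)

lemma of_degree_d: "of_degree u c \<Longrightarrow> of_degree (Suc u) (d c)"
  by (auto simp: of_degree_def intro!: d_eq_0)

lemma Lie_Lie:
  "ml c \<Longrightarrow> Lie x (Lie y c) xs - Lie y (Lie x c) xs = Lie (br x y) c xs"
proof (induction xs arbitrary: c)
  case Nil
  then show ?case by (simp add: act_br multilinear_in)
next
  case (Cons z zs)
  note m = multilinear_Cons[OF Cons.prems] multilinear_Lie
  have "Lie u (Lie v c) (z # zs) = Lie u (Lie v (\<lambda>ws. c (z # ws))) zs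
      - Lie u (\<lambda>ws. c (br v z # ws)) zs - Lie v (\<lambda>ws. c (br u z # ws)) zs + c (br v (br u z) # zs)" for u v
    using Cons.prems by (simp add: Lie_diff m)
  then show ?case
    using Cons.IH[OF m(1), of z] jacobi[of x y z] multilinear_hd(1)[OF Cons.prems, of "br (br x y) z" "br y
      (br x z)" zs]
    by simp
qed

lemma d_Lie: "ml c \<Longrightarrow> d (Lie x c) xs = Lie x (d c) xs"
proof (induction xs arbitrary: c)
  case Nil
  then show ?case using act_scale[of 0 x 0] by (simp add: subspace_0[OF W])
next
  case (Cons y ys)
  note m = multilinear_Cons[OF Cons.prems] multilinear_Lie multilinear_d
  show ?case
    using Cons.IH[OF m(1), of y] Lie_Lie[OF Cons.prems, of x y ys, symmetric] Cons.prems
    by (simp add: d_diff Lie_diff m)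
qed

lemma d_d: "ml c \<Longrightarrow> d (d c) xs = 0"
proof (induction xs arbitrary: c)
  case (Cons y ys)
  note m = multilinear_Cons[OF Cons.prems] multilinear_Lie multilinear_d
  show ?case
    using Cons.IH[OF m(1), of y] Cons.prems by (simp add: d_diff m d_Lie)
qed simp

end

section \<open>Trivial coefficients for a Lie algebra closed under adjoints\<close>

text \<open>
  The sum of \<open>(-1)\<^sup>i M x\<^sub>i\<close> over the positions \<open>i\<close>, evaluated at the list without its \<open>i\<close>-th entry.
\<close>

fun alternating_sum :: "('g \<Rightarrow> 'g list \<Rightarrow> 'w) \<Rightarrow> 'g list \<Rightarrow> 'w::real_vector" where
  "alternating_sum M [] = 0"
| "alternating_sum M (x # xs) = M x xs - alternating_sum (\<lambda>y zs. M y (x # zs)) xs"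

lemma sum_fun_apply: "(\<Sum>a\<in>A. f a) x = (\<Sum>a\<in>A. f a x)"
  by (induction A rule: infinite_finite_induct) auto

lemma alternating_sum_diff:
  "alternating_sum (\<lambda>x zs. M x zs - N x zs) xs = alternating_sum M xs - alternating_sum N xs"
  by (induction xs arbitrary: M N) auto

lemma alternating_sum_minus: "alternating_sum (\<lambda>x zs. - M x zs) xs = - alternating_sum M xs"
  by (induction xs arbitrary: M) auto

lemma alternating_sum_zero: "alternating_sum (\<lambda>x zs. 0) xs = 0"
  by (induction xs) auto

lemma alternating_sum_bracket:
  assumes "skew c" "\<And>x y. br x y = - br y x" "multilinear UNIV c" "act x = (\<lambda>w. 0)"
  shows "alternating_sum (\<lambda>y zs. c (br y x # zs)) xs = cochain_lie br act x c xs"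
  using assms(1,3)
proof (induction xs arbitrary: c)
  case (Cons z zs)
  have "alternating_sum (\<lambda>y ws. c (br y x # z # ws)) zs = alternating_sum (\<lambda>y ws. - c (z # br y x # ws)) zs"
    by (intro arg_cong2[where f = alternating_sum] ext refl) (rule skew_hd[OF Cons.prems(1)])
  moreover have "c (br z x # zs) = - c (br x z # zs)"
    by (subst assms(2)) (rule multilinear_hd[OF Cons.prems(2)])
  ultimately show ?case
    using Cons.IH[OF skew_Cons[OF Cons.prems(1)] multilinear_Cons[OF Cons.prems(2)], of z]
    by (simp add: alternating_sum_minus)
qed (simp add: assms(4))

text \<open>
  With trivial coefficients, the bracket of two arguments occurs in the Lie derivatives along both
  of them, so the sum counts the differential twice.
\<close>

lemma alternating_sum_Lie:
  assumes "skew c" "multilinear UNIV c" "\<And>x y. br x y = - br y x" "act = (\<lambda>x w. 0)"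
  shows "alternating_sum (\<lambda>x. cochain_lie br act x c) xs = 2 *\<^sub>R cochain_d br act c xs"
  using assms(1,2)
proof (induction xs arbitrary: c)
  case (Cons x xs)
  have "alternating_sum (\<lambda>y zs. c (br y x # zs)) xs = cochain_lie br act x c xs"
    by (rule alternating_sum_bracket[OF Cons.prems(1) assms(3) Cons.prems(2)]) (simp add: assms(4))
  then show ?case
    using Cons.IH[OF skew_Cons[OF Cons.prems(1)] multilinear_Cons[OF Cons.prems(2)], of x]
    by (simp add: alternating_sum_diff scaleR_2 algebra_simps)
qed simp

lemma cochain_d_invariant:
  assumes "skew c" "multilinear UNIV c" "\<And>x y. br x y = - br y x"
    and "\<And>x xs. cochain_lie br (\<lambda>x w. 0) x c xs = 0"
  shows "cochain_d br (\<lambda>x w. 0) c xs = 0"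
proof -
  have "(\<lambda>x. cochain_lie br (\<lambda>x w. 0) x c) = (\<lambda>x zs. 0)" using assms(4) by (intro ext)
  then show ?thesis
    using alternating_sum_Lie[where br = br and xs = xs, OF assms(1-3) refl]
    by (simp add: alternating_sum_zero)
qed

text \<open>
  Only semidefinite: the pairing of forms below ignores all values at lists of the wrong length.
\<close>

locale semi_inner =
  fixes P :: "'v::real_vector \<Rightarrow> 'v \<Rightarrow> real"
  assumes P_add: "P (x + y) z = P x z + P y z" and P_scale: "P (r *\<^sub>R x) z = r * P x z"
    and P_sym: "P x y = P y x" and P_nonneg: "P x x \<ge> 0"
begin

lemma P_add2: "P z (x + y) = P z x + P z y"
  using P_add[of x y z] by (simp add: P_sym[of z])

lemma P_scale2: "P z (r *\<^sub>R x) = r * P z x"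
  using P_scale[of r x z] by (simp add: P_sym[of z])

lemma P_diff: "P (x - y) z = P x z - P y z"
  using P_add[of "x - y" y z] by simp

lemma P_zero2: "P z 0 = 0" using P_scale2[of z 0 0] by simp

text \<open>
  The degenerate case of the Cauchy--Schwarz inequality.
\<close>

lemma P_null:
  assumes "P s s = 0" shows "P y s = 0"
proof (rule ccontr)
  assume ne: "P y s \<noteq> 0"
  \<comment> \<open>chosen so that the square of \<open>y + t s\<close> is \<open>-1\<close>\<close>
  define t where "t = - (P y y + 1) / (2 * P y s)"
  have "P (y + t *\<^sub>R s) (y + t *\<^sub>R s) = P y y + 2 * t * P y s"
    using assms by (simp add: P_add P_add2 P_scale P_scale2 P_sym[of s y])
  also have "\<dots> = -1" using ne by (simp add: t_def field_simps)
  finally show False using P_nonneg[of "y + t *\<^sub>R s"] by simp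
qed

lemma orthogonal_span:
  assumes "\<And>b. b \<in> B \<Longrightarrow> P z b = 0" "v \<in> span B" shows "P z v = 0"
  using assms(2) by (induction rule: span_induct_alt) (auto simp: P_zero2 P_add2 P_scale2 assms(1))

text \<open>
  The Gram--Schmidt process; a vector of norm \<open>0\<close> is orthogonal to everything and can be skipped.
\<close>

lemma orthogonal_projection:
  assumes "finite B"
  shows "\<exists>q\<in>span B. \<forall>b\<in>B. P (z - q) b = 0"
  using assms
proof (induction B arbitrary: z)
  case (insert s B)
  obtain s0 where s0: "s0 \<in> span B" "\<forall>b\<in>B. P (s - s0) b = 0" using insert.IH by blast
  obtain q0 where q0: "q0 \<in> span B" "\<forall>b\<in>B. P (z - q0) b = 0" using insert.IH by blast
  define s' where "s' = s - s0"
  define t where "t = (if P s' s' = 0 then 0 else P (z - q0) s' / P s' s')"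
  have sub: "span B \<subseteq> span (insert s B)" by (rule span_mono) auto
  have "q0 + t *\<^sub>R s' \<in> span (insert s B)"
    unfolding s'_def using q0(1) s0(1) sub
    by (intro span_add span_scale span_diff) (auto intro: span_base)
  moreover have *: "P (z - (q0 + t *\<^sub>R s')) v = P (z - q0) v - t * P s' v" for v
    using P_diff[of "z - q0" "t *\<^sub>R s'" v] by (simp add: P_scale algebra_simps)
  have B: "P (z - (q0 + t *\<^sub>R s')) b = 0" if "b \<in> B" for b
    using that q0(2) s0(2) unfolding * by (simp add: s'_def)
  have "P (z - (q0 + t *\<^sub>R s')) s' = 0"
    unfolding * by (cases "P s' s' = 0") (simp_all add: t_def P_null)
  then have "P (z - (q0 + t *\<^sub>R s')) s = 0"
    using orthogonal_span[OF B s0(1)] P_add2[of "z - (q0 + t *\<^sub>R s')" s' s0] by (simp add: s'_def)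
  with B have "\<forall>b\<in>insert s B. P (z - (q0 + t *\<^sub>R s')) b = 0" by blast
  ultimately show ?case by blast
qed (auto intro: span_zero)

end

text \<open>
  The sum of \<open>c(b\<^sub>1, \<dots>, b\<^sub>u) c'(b\<^sub>1, \<dots>, b\<^sub>u)\<close> over all words in an orthonormal basis.
\<close>

primrec form_inner :: "nat \<Rightarrow> ('g::euclidean_space list \<Rightarrow> real) \<Rightarrow> ('g list \<Rightarrow> real) \<Rightarrow> real" where
  "form_inner 0 c c' = c [] * c' []"
| "form_inner (Suc u) c c' = (\<Sum>b\<in>Basis. form_inner u (\<lambda>xs. c (b # xs)) (\<lambda>xs. c' (b # xs)))"

lemma form_inner_semi_inner: "semi_inner (form_inner u)"
proof
  fix r :: real and x y z :: "'a list \<Rightarrow> real"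
  show "form_inner u (x + y) z = form_inner u x z + form_inner u y z"
    by (induction u arbitrary: x y z) (auto simp: plus_fun_def algebra_simps sum.distrib)
  show "form_inner u (r *\<^sub>R x) z = r * form_inner u x z"
    by (induction u arbitrary: x z) (auto simp: scaleR_fun_def sum_distrib_left)
  show "form_inner u x y = form_inner u y x"
    by (induction u arbitrary: x y) auto
  show "form_inner u x x \<ge> 0"
    by (induction u arbitrary: x) (auto intro: sum_nonneg)
qed

lemma form_inner_lin:
  "form_inner u (\<lambda>xs. c xs + c' xs) e = form_inner u c e + form_inner u c' e"
  "form_inner u e (\<lambda>xs. c xs + c' xs) = form_inner u e c + form_inner u e c'"
  "form_inner u (\<lambda>xs. r * c xs) e = r * form_inner u c e"
  "form_inner u e (\<lambda>xs. r * c xs) = r * form_inner u e c"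
  "form_inner u (\<lambda>xs. c xs - c' xs) e = form_inner u c e - form_inner u c' e"
  "form_inner u e (\<lambda>xs. c xs - c' xs) = form_inner u e c - form_inner u e c'"
  "form_inner u (\<lambda>xs. 0) e = 0" "form_inner u e (\<lambda>xs. 0) = 0"
proof (induction u arbitrary: c c' e)
  case 0
  case 1 show ?case by (simp add: algebra_simps)
  case 2 show ?case by (simp add: algebra_simps)
  case 5 show ?case by (simp add: algebra_simps)
  case 6 show ?case by (simp add: algebra_simps)
qed (simp_all add: sum.distrib sum_distrib_left sum_subtractf)

lemma form_inner_sum_left:
  "form_inner u (\<lambda>xs. \<Sum>a\<in>A. k a * f a xs) e = (\<Sum>a\<in>A. k a * form_inner u (f a) e)"
  by (induction A rule: infinite_finite_induct) (auto simp: form_inner_lin)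

lemma form_inner_sum_right:
  "form_inner u e (\<lambda>xs. \<Sum>a\<in>A. k a * f a xs) = (\<Sum>a\<in>A. k a * form_inner u e (f a))"
  by (induction A rule: infinite_finite_induct) (auto simp: form_inner_lin)

lemma multilinear_expand_hd:
  fixes c :: "'g::euclidean_space list \<Rightarrow> real"
  assumes "multilinear UNIV c"
  shows "c (x # xs) = (\<Sum>b\<in>Basis. (x \<bullet> b) * c (b # xs))"
proof -
  have sum: "c ((\<Sum>b\<in>A. (x \<bullet> b) *\<^sub>R b) # xs) = (\<Sum>b\<in>A. (x \<bullet> b) * c (b # xs))" for A :: "'g set"
    by (induction A rule: infinite_finite_induct) (auto simp: multilinear_hd[OF assms])
  from sum[of Basis] show ?thesis by (simp add: euclidean_representation)
qed

lemma form_inner_eq_0: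
  assumes "multilinear UNIV c" "form_inner u c c = 0" "length xs = u"
  shows "c xs = 0"
  using assms
proof (induction u arbitrary: c xs)
  case (Suc u)
  obtain y ys where xs: "xs = y # ys" "length ys = u" using Suc.prems(3) by (cases xs) auto
  have "form_inner u (\<lambda>xs. c (b # xs)) (\<lambda>xs. c (b # xs)) = 0" if "b \<in> Basis" for b
    using Suc.prems(2) that
    by (simp add: sum_nonneg_eq_0_iff semi_inner.P_nonneg[OF form_inner_semi_inner])
  then have "c (b # ys) = 0" if "b \<in> Basis" for b
    using Suc.IH[OF multilinear_Cons[OF Suc.prems(1)] _ xs(2)] that by blast
  then show ?case unfolding xs multilinear_expand_hd[OF Suc.prems(1), of y] by simp
qed simp

text \<open>
  Finite dimension is what makes orthogonal projection onto a span of forms available.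
\<close>

lemma forms_finite_span:
  "\<exists>T :: ('g::euclidean_space list \<Rightarrow> real) set. finite T \<and>
     (\<forall>c. multilinear UNIV c \<and> of_degree u c \<longrightarrow> c \<in> span T)"
proof (induction u)
  case 0
  let ?t = "\<lambda>xs :: 'g list. if xs = [] then 1 else 0 :: real"
  have "c \<in> span {?t}" if "of_degree 0 c" for c :: "'g list \<Rightarrow> real"
  proof -
    have "c = c [] *\<^sub>R ?t" using that by (auto simp: of_degree_def fun_eq_iff)
    then show ?thesis by (metis span_base span_scale singletonI)
  qed
  then show ?case by (intro exI[of _ "{?t}"]) auto
next
  case (Suc u)
  then obtain T :: "('g list \<Rightarrow> real) set" where T: "finite T"
    "\<And>c. multilinear UNIV c \<Longrightarrow> of_degree u c \<Longrightarrow> c \<in> span T" by blast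
  define ext where "ext b t = (\<lambda>xs. case xs of [] \<Rightarrow> 0 | x # ys \<Rightarrow> (x \<bullet> b) * t ys)"
    for b :: 'g and t :: "'g list \<Rightarrow> real"
  let ?T = "\<Union>b\<in>Basis. ext b ` T"
  have ext: "linear (ext b)" for b
    by (rule linearI) (auto simp: ext_def fun_eq_iff algebra_simps split: list.split)
  have "c \<in> span ?T" if c: "multilinear UNIV c" "of_degree (Suc u) c" for c
  proof -
    have "c = (\<Sum>b\<in>Basis. ext b (\<lambda>zs. c (b # zs)))"
    proof
      fix xs show "c xs = (\<Sum>b\<in>Basis. ext b (\<lambda>zs. c (b # zs))) xs"
      proof (cases xs)
        case Nil
        then show ?thesis using c(2) by (simp add: ext_def of_degree_def sum_fun_apply)
      next
        case (Cons y ys)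
        show ?thesis
          unfolding Cons multilinear_expand_hd[OF c(1), of y] by (simp add: ext_def sum_fun_apply)
      qed
    qed
    moreover have "ext b (\<lambda>zs. c (b # zs)) \<in> span ?T" if "b \<in> Basis" for b
    proof -
      have "ext b (\<lambda>zs. c (b # zs)) \<in> ext b ` span T"
        using T(2)[OF multilinear_Cons[OF c(1)] of_degree_Cons[OF c(2)]] by blast
      also have "\<dots> = span (ext b ` T)" by (rule linear_span_image[OF ext, symmetric])
      also have "\<dots> \<subseteq> span ?T" using that by (intro span_mono) auto
      finally show ?thesis .
    qed
    ultimately show ?thesis by (metis (no_types, lifting) span_sum)
  qed
  then show ?case using T(1) by (intro exI[of _ ?T]) auto
qed

definition alt_forms :: "nat \<Rightarrow> ('g::real_vector list \<Rightarrow> real) set" where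
  "alt_forms u = {c. multilinear UNIV c \<and> skew c \<and> of_degree u c}"

lemma subspace_alt_forms: "subspace (alt_forms u)"
proof (rule subspaceI)
  show "0 \<in> alt_forms u" by (auto simp: alt_forms_def zero_fun_def multilinear_zero skew_def of_degree_def)
  show "x + y \<in> alt_forms u" if "x \<in> alt_forms u" "y \<in> alt_forms u" for x y :: "'a list \<Rightarrow> real"
    using that multilinear_lincomb(1)[of UNIV x y] skew_lincomb(1)[of x y]
    by (auto simp: alt_forms_def plus_fun_def of_degree_def)
  show "r *\<^sub>R x \<in> alt_forms u" if "x \<in> alt_forms u" for r and x :: "'a list \<Rightarrow> real"
    using that multilinear_lincomb(3)[of UNIV x x r] skew_lincomb(3)[of x x r]
    by (auto simp: alt_forms_def scaleR_fun_def of_degree_def)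
qed

text \<open>
  The adjoint of \<open>ad x\<close> is \<open>ad (adj x)\<close>; for matrices with the Frobenius inner product \<open>adj\<close> is
  transposition.
\<close>

locale self_adjoint_lie =
  lie_rep br "UNIV :: real set" "\<lambda>x w. 0" for br :: "'g::euclidean_space \<Rightarrow> 'g \<Rightarrow> 'g" +
  fixes adj :: "'g \<Rightarrow> 'g"
  assumes adj: "br x y \<bullet> z = y \<bullet> br (adj x) z"
begin

lemma Lie_adjoint:
  "ml c \<Longrightarrow> ml c' \<Longrightarrow> form_inner u (Lie x c) c' = form_inner u c (Lie (adj x) c')"
proof (induction u arbitrary: c c')
  case (Suc u)
  note ex = multilinear_expand_hd[OF Suc.prems(1)] multilinear_expand_hd[OF Suc.prems(2)]
  let ?f = "\<lambda>b e. form_inner u (\<lambda>zs. c (b # zs)) (\<lambda>zs. c' (e # zs))"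
  have "(\<Sum>b\<in>Basis. form_inner u (\<lambda>zs. c (br x b # zs)) (\<lambda>zs. c' (b # zs)))
      = (\<Sum>b\<in>Basis. \<Sum>e\<in>Basis. (br x b \<bullet> e) * ?f e b)"
    by (subst ex(1)) (simp add: form_inner_sum_left)
  also have "\<dots> = (\<Sum>e\<in>Basis. \<Sum>b\<in>Basis. (br (adj x) e \<bullet> b) * ?f e b)"
    by (subst sum.swap) (intro sum.cong refl arg_cong2[where f = "(*)"], subst adj, rule inner_commute)
  also have "\<dots> = (\<Sum>e\<in>Basis. form_inner u (\<lambda>zs. c (e # zs)) (\<lambda>zs. c' (br (adj x) e # zs)))"
    by (subst ex(2)[of "br _ _"]) (simp add: form_inner_sum_right)
  finally show ?case
    using Suc.IH[OF multilinear_Cons[OF Suc.prems(1)] multilinear_Cons[OF Suc.prems(2)]]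
    by (simp add: form_inner_lin sum_subtractf)
qed simp

text \<open>
  Let \<open>p = z - q\<close> with \<open>q\<close> the orthogonal projection of \<open>z\<close> onto the span of the images. The square
  of \<open>L\<^sub>x p\<close> is the pairing of \<open>p\<close> with \<open>L\<^bsub>adj x\<^esub> L\<^sub>x p\<close>, which lies in that span.
\<close>

lemma invariant_decomposition:
  assumes Z: "subspace Z" "Z \<subseteq> alt_forms u" "\<And>x z. z \<in> Z \<Longrightarrow> Lie x z \<in> Z" and z: "z \<in> Z"
  shows "\<exists>p q. z = p + q \<and> p \<in> Z \<and> (\<forall>x xs. Lie x p xs = 0) \<and> q \<in> span {Lie x y | x y. y \<in> Z}"
proof -
  let ?V = "{Lie x y | x y. y \<in> Z}"
  interpret semi_inner "form_inner u :: ('g list \<Rightarrow> real) \<Rightarrow> _" by (rule form_inner_semi_inner)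
  obtain T :: "('g list \<Rightarrow> real) set" where T: "finite T"
    "\<And>c. multilinear UNIV c \<Longrightarrow> of_degree u c \<Longrightarrow> c \<in> span T"
    using forms_finite_span by blast
  obtain B where B: "B \<subseteq> ?V" "independent B" "?V \<subseteq> span B" by (rule maximal_independent_subset)
  have "B \<subseteq> span T" using B(1) Z(2,3) T(2) by (fastforce simp: alt_forms_def)
  then have "finite B" using independent_span_bound[OF T(1) B(2)] by blast
  then obtain q where q: "q \<in> span B" "\<forall>b\<in>B. form_inner u (z - q) b = 0"
    using orthogonal_projection by blast
  have qV: "q \<in> span ?V" using q(1) span_mono[OF B(1)] by blast
  have "span ?V \<subseteq> Z" by (rule span_minimal[OF _ Z(1)]) (use Z(3) in auto)
  then have p: "z - q \<in> Z" using z qV subspace_diff[OF Z(1)] by blast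
  have orth: "form_inner u (z - q) v = 0" if "v \<in> ?V" for v
    by (rule orthogonal_span[where B = B]) (use q(2) that B(3) in auto)
  have "Lie x (z - q) xs = 0" for x xs
  proof (cases "length xs = u")
    case True
    have mp: "ml (z - q)" using p Z(2) by (auto simp: alt_forms_def)
    have "form_inner u (Lie x (z - q)) (Lie x (z - q)) = form_inner u (z - q) (Lie (adj x) (Lie x (z - q)))"
      by (rule Lie_adjoint[OF mp multilinear_Lie[OF mp]])
    also have "\<dots> = 0" by (rule orth) (use p Z(3) in blast)
    finally show ?thesis using form_inner_eq_0[OF multilinear_Lie[OF mp] _ True] by blast
  next
    case False
    have "Lie x (z - q) \<in> alt_forms u" using p Z by blast
    then show ?thesis using False by (simp add: alt_forms_def of_degree_def)
  qed
  then show ?thesis using p qV by (intro exI[of _ "z - q"] exI[of _ q]) auto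
qed

lemma Lie_alt_forms: "c \<in> alt_forms u \<Longrightarrow> Lie x c \<in> alt_forms u"
  by (simp add: alt_forms_def multilinear_Lie skew_Lie of_degree_Lie)

lemma d_invariant:
  assumes "c \<in> alt_forms u" "\<And>x xs. Lie x c xs = 0" shows "d c xs = 0"
  by (rule cochain_d_invariant[OF _ _ br_anti assms(2)]) (use assms(1) in \<open>simp_all add: alt_forms_def\<close>)

lemma linear_on_d: "c \<in> alt_forms u \<Longrightarrow> c' \<in> alt_forms u \<Longrightarrow> d (c + c') = d c + d c'"
  "c \<in> alt_forms u \<Longrightarrow> d (r *\<^sub>R c) = r *\<^sub>R d c"
  using d_add[of c c'] d_scale[of c r]
  by (auto simp: alt_forms_def plus_fun_def scaleR_fun_def fun_eq_iff)

text \<open>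
  On cocycles, Cartan's formula gives \<open>L\<^sub>x y = d (i\<^sub>x y)\<close>.
\<close>

lemma cocycle_decomposition:
  assumes c: "c \<in> alt_forms u" and dc: "\<And>xs. d c xs = 0"
  shows "\<exists>p b. p \<in> alt_forms u \<and> (\<forall>x xs. Lie x p xs = 0) \<and> b \<in> alt_forms (u - 1)
     \<and> c = p + (if u = 0 then 0 else d b)"
proof -
  let ?Z = "{c \<in> alt_forms u. \<forall>xs. d c xs = 0}"
  let ?B = "if u = 0 then {0} else d ` alt_forms (u - 1)"
  have 0: "d 0 xs = 0" for xs using d_scale[of 0 0 xs] by (simp add: zero_fun_def multilinear_zero)
  have sZ: "subspace ?Z"
    by (rule subspaceI) (auto simp: 0 subspace_0 subspace_add subspace_scale subspace_alt_forms linear_on_d)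
  have Lz: "Lie x z \<in> ?Z" if "z \<in> ?Z" for x z
  proof -
    have "d z = (\<lambda>xs. 0)" using that by auto
    then have "Lie x (d z) xs = 0" for xs by (simp add: Lie_eq_0)
    moreover have "ml z" using that by (simp add: alt_forms_def)
    ultimately show ?thesis using that by (simp add: Lie_alt_forms d_Lie)
  qed
  have "\<exists>p q. c = p + q \<and> p \<in> ?Z \<and> (\<forall>x xs. Lie x p xs = 0) \<and> q \<in> span {Lie x y | x y. y \<in> ?Z}"
    by (rule invariant_decomposition[OF sZ _ Lz]) (use c dc in auto)
  then obtain p q where pq: "c = p + q" "p \<in> ?Z" "\<forall>x xs. Lie x p xs = 0" "q \<in> span {Lie x y | x y. y \<in> ?Z}"
    by blast
  have "subspace ?B"
  proof (cases u)
    case (Suc v)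
    have "subspace (d ` alt_forms v)"
    proof (rule subspaceI)
      show "0 \<in> d ` alt_forms v"
        by (rule image_eqI[of _ _ 0]) (auto simp: 0 fun_eq_iff subspace_0 subspace_alt_forms)
      show "x + y \<in> d ` alt_forms v" if "x \<in> d ` alt_forms v" "y \<in> d ` alt_forms v" for x y
        using that by (auto simp flip: linear_on_d simp: subspace_add[OF subspace_alt_forms])
      show "r *\<^sub>R x \<in> d ` alt_forms v" if "x \<in> d ` alt_forms v" for r x
        using that by (auto simp flip: linear_on_d simp: subspace_scale[OF subspace_alt_forms])
    qed
    then show ?thesis using Suc by simp
  qed auto
  moreover have "Lie x y \<in> ?B" if y: "y \<in> ?Z" for x y
  proof (cases u)
    case 0
    have "Lie x y zs = 0" for zs
      using Lie_alt_forms[of y u x] y 0 by (cases zs) (auto simp: alt_forms_def of_degree_def)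
    then show ?thesis using 0 by auto
  next
    case (Suc v)
    have "Lie x y = d (\<lambda>zs. y (x # zs))"
    proof
      fix xs
      have "d y (x # xs) = 0" using y by blast
      then show "Lie x y xs = d (\<lambda>zs. y (x # zs)) xs" by simp
    qed
    moreover have "(\<lambda>zs. y (x # zs)) \<in> alt_forms v"
      using y Suc by (simp add: alt_forms_def multilinear_Cons skew_Cons of_degree_Cons)
    ultimately show ?thesis using Suc by auto
  qed
  ultimately have "span {Lie x y | x y. y \<in> ?Z} \<subseteq> ?B" by (intro span_minimal) auto
  with pq(4) have "q \<in> ?B" by blast
  then obtain b where "b \<in> alt_forms (u - 1)" "q = (if u = 0 then 0 else d b)"
    using subspace_0[OF subspace_alt_forms] by (cases "u = 0") auto
  with pq show ?thesis by blast
qed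

text \<open>
  In \<open>p = d b\<close>, the invariant part of \<open>b\<close> is closed and the rest contributes elements \<open>L\<^sub>x (d y)\<close>,
  which are orthogonal to invariant forms. So \<open>p\<close> is orthogonal to itself.
\<close>

lemma invariant_exact_imp_0:
  assumes p: "p \<in> alt_forms (Suc v)" "\<And>x xs. Lie x p xs = 0" and b: "b \<in> alt_forms v" "p = d b"
  shows "p = 0"
proof -
  interpret semi_inner "form_inner (Suc v) :: ('g list \<Rightarrow> real) \<Rightarrow> _" by (rule form_inner_semi_inner)
  obtain e q where eq: "b = e + q" "e \<in> alt_forms v" "\<forall>x xs. Lie x e xs = 0"
     "q \<in> span {Lie x y | x y. y \<in> alt_forms v}"
    using invariant_decomposition[OF subspace_alt_forms order_refl Lie_alt_forms b(1)] by blast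
  have mp: "ml p" using p(1) by (simp add: alt_forms_def)
  have "Lie x p = (\<lambda>xs. 0)" for x using p(2) by auto
  then have orth: "form_inner (Suc v) p (Lie x y) = 0" if "ml y" for x y
    using Lie_adjoint[OF that mp, of "Suc v" x]
    by (subst P_sym) (simp add: form_inner_lin del: form_inner.simps)
  have "q \<in> alt_forms v \<and> form_inner (Suc v) p (d q) = 0"
    using eq(4)
  proof (induction rule: span_induct_alt)
    case base
    have "d 0 = 0" using d_scale[of 0 0] by (auto simp: zero_fun_def multilinear_zero)
    then have "form_inner (Suc v) p (d 0) = 0" by (simp only: P_zero2)
    then show ?case using subspace_0[OF subspace_alt_forms] by blast
  next
    case (step r x q)
    then obtain A y where x: "x = Lie A y" and y: "y \<in> alt_forms v" by blast
    have xf: "x \<in> alt_forms v" by (simp add: x y Lie_alt_forms)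
    have "d x = Lie A (d y)" unfolding x using y by (auto simp: d_Lie alt_forms_def)
    then have "form_inner (Suc v) p (d x) = 0"
      using orth[of "d y" A] y by (simp add: multilinear_d alt_forms_def)
    moreover have rx: "r *\<^sub>R x \<in> alt_forms v" by (rule subspace_scale[OF subspace_alt_forms xf])
    have "d (r *\<^sub>R x + q) = r *\<^sub>R d x + d q"
      using step.IH by (simp only: linear_on_d(1)[OF rx] linear_on_d(2)[OF xf])
    ultimately have "form_inner (Suc v) p (d (r *\<^sub>R x + q)) = 0"
      using step.IH by (simp only: P_add2 P_scale2)
    then show ?case using step.IH subspace_add[OF subspace_alt_forms rx] by blast
  qed
  moreover have "d e = 0" using d_invariant[OF eq(2)] eq(3) by auto
  moreover have "d b = d e + d q"
    unfolding eq(1) by (rule linear_on_d(1)[OF eq(2)]) (use calculation in blast)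
  ultimately have "form_inner (Suc v) p p = 0"
    using b(2) by (simp only: add_0)
  then have "p xs = 0" for xs
    using form_inner_eq_0[OF mp, of "Suc v" xs] p(1)
    by (cases "length xs = Suc v") (auto simp: alt_forms_def of_degree_def)
  then show ?thesis by auto
qed

end

section \<open>The projective algebra in coordinates\<close>

lemma vf_apply_eval: "sf_apply (vf_apply X f) x = (\<Sum>k\<in>UNIV. sf_apply (X $ k) x * sf_apply (pd k f) x)"
  by (simp add: vf_apply_def)

lemma vf_apply_simps [simp]:
  "vf_apply X (f + g) = vf_apply X f + vf_apply X g" "vf_apply X (f - g) = vf_apply X f - vf_apply X g"
  "vf_apply X (- f) = - vf_apply X f"
  "vf_apply X (r *\<^sub>R f) = r *\<^sub>R vf_apply X f" "vf_apply X (of_real r) = 0" "vf_apply X (coord k) = X $ k"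
  "vf_apply X 0 = 0" "vf_apply X 1 = 0"
  by (simp_all add: vf_apply_def algebra_simps sum.distrib sum_subtractf sum_negf scaleR_sum_right
      if_distrib[where f = "\<lambda>x. _ * x"] cong: if_cong)

lemma vf_apply_left [simp]:
  "vf_apply (X + Y) f = vf_apply X f + vf_apply Y f" "vf_apply (X - Y) f = vf_apply X f - vf_apply Y f"
  "vf_apply (- X) f = - vf_apply X f" "vf_apply (r *\<^sub>R X) f = r *\<^sub>R vf_apply X f"
  by (simp_all add: vf_apply_def algebra_simps sum.distrib sum_subtractf sum_negf scaleR_sum_right)

lemma vf_apply_mult: "vf_apply X (f * g) = vf_apply X f * g + f * vf_apply X g"
  by (simp add: vf_apply_def pd_mult sum.distrib sum_distrib_left sum_distrib_right algebra_simps)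

lemma vf_apply_sum [simp]: "vf_apply X (sum F A) = (\<Sum>a\<in>A. vf_apply X (F a))"
  by (induction A rule: infinite_finite_induct) auto

lemma vf_bracket_nth: "vf_bracket X Y $ i = vf_apply X (Y $ i) - vf_apply Y (X $ i)"
  by (simp add: vf_bracket_def)

text \<open>
  The difference of both sides is a derivation that vanishes on the coordinates.
\<close>

lemma vf_apply_bracket: "vf_apply (vf_bracket X Y) f = vf_apply X (vf_apply Y f) - vf_apply Y (vf_apply X f)"
proof -
  have "vf_apply X (vf_apply Y f) - vf_apply Y (vf_apply X f) - vf_apply (vf_bracket X Y) f = 0"
    by (rule derivation_eq_0) (simp_all add: vf_apply_mult vf_bracket_nth algebra_simps)
  then show ?thesis by simp
qed

lemma vf_bracket_add: "vf_bracket X (Y + Z) = vf_bracket X Y + vf_bracket X Z"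
  and vf_bracket_scale: "vf_bracket X (r *\<^sub>R Y) = r *\<^sub>R vf_bracket X Y"
  and vf_bracket_anti: "vf_bracket X Y = - vf_bracket Y X"
  by (simp_all add: vec_eq_iff vf_bracket_nth algebra_simps)

lemma vf_bracket_jacobi:
  "vf_bracket X (vf_bracket Y Z) = vf_bracket (vf_bracket X Y) Z + vf_bracket Y (vf_bracket X Z)"
  by (simp add: vec_eq_iff vf_bracket_nth vf_apply_bracket)

text \<open>
  The index set of the basis \<open>\<partial>\<^sub>i\<close>, \<open>x\<^sup>j \<partial>\<^sub>i\<close>, \<open>x\<^sup>j E\<close>.
\<close>

type_synonym 'm sl_index = "'m + ('m \<times> 'm) + 'm"

type_synonym 'm sl_vec = "real ^ ('m sl_index)"

abbreviation (input) Trans :: "'m \<Rightarrow> 'm sl_index" where "Trans \<equiv> Inl"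
abbreviation (input) Lin :: "'m \<Rightarrow> 'm \<Rightarrow> 'm sl_index" where "Lin i j \<equiv> Inr (Inl (i, j))"
abbreviation (input) Quad :: "'m \<Rightarrow> 'm sl_index" where "Quad j \<equiv> Inr (Inr j)"

lemma sl_index_cases: obtains i where "b = Trans i" | i j where "b = Lin i j" | j where "b = Quad j"
  by (metis old.prod.exhaust sumE)

lemma sum_sl_index:
  fixes f :: "'m::finite sl_index \<Rightarrow> 'a::comm_monoid_add"
  shows "(\<Sum>b\<in>UNIV. f b) = (\<Sum>i\<in>UNIV. f (Trans i)) + (\<Sum>i\<in>UNIV. \<Sum>j\<in>UNIV. f (Lin i j)) + (\<Sum>j\<in>UNIV. f (Quad j))"
  by (simp add: UNIV_Plus_UNIV[symmetric] sum.Plus sum.cartesian_product UNIV_Times_UNIV[symmetric]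
    case_prod_unfold add.assoc
      del: UNIV_Plus_UNIV UNIV_Times_UNIV)

fun basis_field :: "'m::finite sl_index \<Rightarrow> 'm vector_field" where
  "basis_field (Inl i) = axis i 1"
| "basis_field (Inr (Inl (i, j))) = axis i (coord j)"
| "basis_field (Inr (Inr j)) = (\<chi> i. coord j * euler_field $ i)"

definition proj_field :: "'m::finite sl_vec \<Rightarrow> 'm vector_field" where
  "proj_field p = (\<Sum>b\<in>UNIV. (p $ b) *\<^sub>R basis_field b)"

lemma proj_field_lin: "proj_field (p + q) = proj_field p + proj_field q" "proj_field (r *\<^sub>R p)
    = r *\<^sub>R proj_field p"
  by (simp_all add: proj_field_def sum.distrib scaleR_sum_right algebra_simps)

lemma linear_proj_field: "linear proj_field" by (rule linearI) (rule proj_field_lin)+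

lemma axis_nth_if: "axis i x $ j = (if j = i then x else 0)" by (simp add: axis_def)

lemma proj_field_nth: "proj_field p $ i = of_real (p $ Trans i) + (\<Sum>j\<in>UNIV. (p $ Lin i j) *\<^sub>R coord j)
    + (\<Sum>j\<in>UNIV. (p $ Quad j) *\<^sub>R coord j) * coord i"
proof -
  have "(\<Sum>k\<in>UNIV. \<Sum>j\<in>UNIV. (p $ Lin k j) *\<^sub>R (if i = k then coord j else 0))
      = (\<Sum>j\<in>UNIV. (p $ Lin i j) *\<^sub>R coord j)"
    by (subst sum.swap) (simp add: if_distrib[where f = "\<lambda>x. _ *\<^sub>R x"] cong: if_cong)
  then show ?thesis
    by (simp add: proj_field_def sum_sl_index axis_nth_if euler_field_def of_real_def
        if_distrib[where f = "\<lambda>x. _ *\<^sub>R x"] sum_distrib_right cong: if_cong)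
qed

definition trans_part :: "'m::finite sl_vec \<Rightarrow> real ^ 'm" where "trans_part p = (\<chi> i. p $ Trans i)"
definition lin_part :: "'m::finite sl_vec \<Rightarrow> real ^ 'm ^ 'm" where "lin_part p = (\<chi> i j. p $ Lin i j)"
definition quad_part :: "'m::finite sl_vec \<Rightarrow> real ^ 'm" where "quad_part p = (\<chi> j. p $ Quad j)"

definition eval_field :: "'m::finite vector_field \<Rightarrow> real ^ 'm \<Rightarrow> real ^ 'm" where
  "eval_field X x = (\<chi> i. sf_apply (X $ i) x)"

lemma vf_eqI: "(\<And>x. eval_field X x = eval_field Y x) \<Longrightarrow> X = Y"
  by (auto simp: eval_field_def vec_eq_iff intro: sf_eqI)

lemma eval_field: "eval_field (proj_field p) x = trans_part p + lin_part p *v x + (quad_part p \<bullet> x) *\<^sub>R x"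
  by (simp add: vec_eq_iff eval_field_def proj_field_nth trans_part_def lin_part_def quad_part_def
      matrix_vector_mult_def inner_vec_def)

lemma pd_field_nth: "sf_apply (pd j (proj_field p $ i)) x
    = lin_part p $ i $ j + quad_part p $ j * x $ i + (quad_part p \<bullet> x) * (if i = j then 1 else 0)"
  by (simp add: proj_field_nth pd_mult lin_part_def quad_part_def inner_vec_def
      if_distrib[where f = "\<lambda>x. _ *\<^sub>R x"] algebra_simps cong: if_cong)

lemma derivative_field:
  "(\<Sum>j\<in>UNIV. v $ j * sf_apply (pd j (proj_field p $ i)) x)
    = (lin_part p *v v + (quad_part p \<bullet> v) *\<^sub>R x + (quad_part p \<bullet> x) *\<^sub>R v) $ i"
proof -
  define s where "s = quad_part p \<bullet> x"
  show ?thesis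
    unfolding pd_field_nth s_def[symmetric]
    by (simp add: algebra_simps sum.distrib matrix_vector_mult_def inner_vec_def sum_distrib_left
      sum_distrib_right if_distrib[where f = "\<lambda>x. _ * x"] cong: if_cong)
qed

lemma proj_field_eqI:
  assumes "trans_part p = trans_part q" "lin_part p = lin_part q" "quad_part p = quad_part q"
  shows "p = q"
proof -
  have "p $ b = q $ b" for b
    by (cases b rule: sl_index_cases)
       (use assms in \<open>auto simp: trans_part_def lin_part_def quad_part_def vec_eq_iff\<close>)
  then show ?thesis by (simp add: vec_eq_iff)
qed

definition mk_param :: "real ^ 'm \<Rightarrow> real ^ 'm ^ 'm \<Rightarrow> real ^ 'm \<Rightarrow> 'm::finite sl_vec" where
  "mk_param a A b = (\<chi> k. case k of Inl i \<Rightarrow> a $ i | Inr (Inl (i, j)) \<Rightarrow> A $ i $ j | Inr (Inr j) \<Rightarrow> b $ j)"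

lemma mk_param_parts [simp]: "trans_part (mk_param a A b) = a" "lin_part (mk_param a A b) = A"
  "quad_part (mk_param a A b) = b"
  by (simp_all add: trans_part_def lin_part_def quad_part_def mk_param_def vec_eq_iff)

lemma eval_vf_bracket:
  "eval_field (vf_bracket X Y) x = (\<chi> i. (\<Sum>j\<in>UNIV. eval_field X x $ j * sf_apply (pd j (Y $ i)) x)
     - (\<Sum>j\<in>UNIV. eval_field Y x $ j * sf_apply (pd j (X $ i)) x))"
  by (simp add: vec_eq_iff eval_field_def vf_bracket_nth vf_apply_eval)

text \<open>
  At the point \<open>x\<close> the bracket is \<open>D Y(x) X(x) - D X(x) Y(x)\<close>. The cubic terms cancel, and the
  expression \<open>f\<close> collects the linear terms.
\<close>

lemma proj_field_bracket_closed: "\<exists>r. proj_field r = vf_bracket (proj_field p) (proj_field q)"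
proof -
  define a A b where p: "a = trans_part p" "A = lin_part p" "b = quad_part p"
  define a' A' b' where q: "a' = trans_part q" "A' = lin_part q" "b' = quad_part q"
  define f where "f x = A' *v (A *v x) - A *v (A' *v x) + (b' \<bullet> a - b \<bullet> a') *\<^sub>R x + (b' \<bullet> x) *\<^sub>R a
      - (b \<bullet> x) *\<^sub>R a'" for x
  have "linear f"
    by (rule linearI) (simp_all add: f_def matrix_vector_right_distrib matrix_vector_mult_scaleR
      inner_add_right algebra_simps)
  then have f: "matrix f *v x = f x" for x
    by (simp add: matrix_works linear_matrix_vector_mul_eq)
  have "eval_field (proj_field (mk_param (A' *v a - A *v a') (matrix f) (b' v* A - b v* A'))) x
      = eval_field (vf_bracket (proj_field p) (proj_field q)) x" for x
  proof -
    define X Y where XY: "X = a + A *v x + (b \<bullet> x) *\<^sub>R x" "Y = a' + A' *v x + (b' \<bullet> x) *\<^sub>R x"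
    have "eval_field (vf_bracket (proj_field p) (proj_field q)) x
      = (A' *v X + (b' \<bullet> X) *\<^sub>R x + (b' \<bullet> x) *\<^sub>R X) - (A *v Y + (b \<bullet> Y) *\<^sub>R x + (b \<bullet> x) *\<^sub>R Y)"
      unfolding eval_vf_bracket derivative_field eval_field p[symmetric] q[symmetric] XY[symmetric]
      by (simp add: vec_eq_iff)
    then show ?thesis
      by (simp add: eval_field f) (simp add: f_def XY matrix_vector_right_distrib matrix_vector_mult_scaleR
          inner_add_right inner_diff_left dot_lmul_matrix algebra_simps)
  qed
  then show ?thesis by (metis vf_eqI)
qed

lemma inj_proj_field: "inj proj_field"
  unfolding linear_injective_0[OF linear_proj_field]
proof (intro allI impI)
  fix p :: "'m::finite sl_vec" assume 0: "proj_field p = 0"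
  have ev: "trans_part p + lin_part p *v x + (quad_part p \<bullet> x) *\<^sub>R x = 0" for x
    using arg_cong[OF 0, of "\<lambda>X. eval_field X x"]
      by (simp add: eval_field) (simp add: eval_field_def vec_eq_iff)
  have t: "trans_part p = 0" using ev[of 0] by simp
  have pd: "lin_part p $ i $ j + quad_part p $ j * x $ i + (quad_part p \<bullet> x) * (if i = j then 1 else 0) = 0"
      for i j x
    using arg_cong[OF 0, of "\<lambda>X. sf_apply (pd j (X $ i)) x"] by (simp add: pd_field_nth)
  have l: "lin_part p = 0" using pd[of _ _ 0] by (simp add: vec_eq_iff)
  have q: "quad_part p = 0" using ev[of "quad_part p"] t l by simp
  show "p = 0" by (rule proj_field_eqI) (use t l q in \<open>simp_all add: trans_part_def lin_part_def
      quad_part_def vec_eq_iff\<close>)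
qed

lemma sl_fields_eq: "sl_fields = range proj_field"
proof
  have "axis i 1 \<in> range proj_field" "axis i (coord j) \<in> range proj_field" "(\<chi> i. coord j * euler_field $ i)
      \<in> range proj_field"
    for i j :: 'a
  proof -
    have *: "basis_field b \<in> range proj_field" for b :: "'a sl_index"
      by (rule image_eqI[of _ _ "axis b 1"])
         (simp_all add: proj_field_def axis_nth_if if_distrib[where f = "\<lambda>x. x *\<^sub>R _"] cong: if_cong)
    from *[of "Inl i"] *[of "Inr (Inl (i, j))"] *[of "Inr (Inr j)"]
    show "axis i 1 \<in> range proj_field" "axis i (coord j) \<in> range proj_field" "(\<chi> i. coord j * euler_field $
        i) \<in> range proj_field"
      by simp_all
  qed
  then show "sl_fields \<subseteq> range (proj_field :: _ \<Rightarrow> 'a vector_field)"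
    unfolding sl_fields_def by (intro span_minimal linear_subspace_image[OF linear_proj_field]) auto
  have "basis_field b \<in> sl_fields" for b :: "'a sl_index"
    unfolding sl_fields_def by (cases b rule: sl_index_cases) (auto intro!: span_base)
  then show "range proj_field \<subseteq> (sl_fields :: 'a vector_field set)"
    by (auto simp: proj_field_def sl_fields_def intro!: span_sum span_scale)
qed

abbreviation sl_coords :: "'m::finite vector_field \<Rightarrow> 'm sl_vec" where
  "sl_coords \<equiv> inv_into UNIV proj_field"

text \<open>
  The bracket is transported to the coordinate space, so that cochains are maps on all lists of
  vectors and no membership conditions arise.
\<close>

definition sl_br :: "'m::finite sl_vec \<Rightarrow> 'm sl_vec \<Rightarrow> 'm sl_vec" where
  "sl_br p q = sl_coords (vf_bracket (proj_field p) (proj_field q))"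

lemma proj_field_sl_br: "proj_field (sl_br p q) = vf_bracket (proj_field p) (proj_field q)"
  unfolding sl_br_def using proj_field_bracket_closed[of p q] by (metis f_inv_into_f rangeI)

lemma sl_br_eqI: "proj_field r = vf_bracket (proj_field p) (proj_field q) \<Longrightarrow> sl_br p q = r"
  using proj_field_sl_br[of p q] inj_proj_field by (metis injD)

lemma sl_br_add: "sl_br p (q + r) = sl_br p q + sl_br p r"
  and sl_br_scale: "sl_br p (s *\<^sub>R q) = s *\<^sub>R sl_br p q"
  and sl_br_anti: "sl_br p q = - sl_br q p"
  and sl_br_jacobi: "sl_br p (sl_br q r) = sl_br (sl_br p q) r + sl_br q (sl_br p r)"
  by (rule sl_br_eqI, simp add: proj_field_lin linear_neg[OF linear_proj_field] proj_field_sl_br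
    vf_bracket_add vf_bracket_scale
      vf_bracket_jacobi[of "proj_field p" "proj_field q"] vf_bracket_anti[of "proj_field p" "proj_field q"])+

definition trans_vec :: "'m \<Rightarrow> 'm::finite sl_vec" where "trans_vec k = axis (Trans k) 1"
definition gl_incl :: "real ^ 'm ^ 'm \<Rightarrow> 'm::finite sl_vec" where "gl_incl A = mk_param 0 A 0"
definition euler_vec :: "'m::finite sl_vec" where "euler_vec = gl_incl (mat 1)"

lemma proj_field_trans_vec: "proj_field (trans_vec k) = axis k 1"
  by (simp add: proj_field_def trans_vec_def axis_nth_if if_distrib[where f = "\<lambda>x. x *\<^sub>R _"] cong: if_cong)

lemma field_gl_incl: "proj_field (gl_incl A) $ i = (\<Sum>j\<in>UNIV. (A $ i $ j) *\<^sub>R coord j)"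
  by (simp add: proj_field_nth gl_incl_def mk_param_def)

lemma proj_field_euler_vec: "proj_field euler_vec = (\<chi> i. coord i)"
  by (simp add: vec_eq_iff euler_vec_def field_gl_incl mat_def if_distrib[where f
    = "\<lambda>x. x *\<^sub>R _"] cong: if_cong)

lemma vf_apply_trans_vec: "vf_apply (proj_field (trans_vec k)) f = pd k f"
  by (simp add: vf_apply_def proj_field_trans_vec axis_nth_if if_distrib[where f = "\<lambda>x. x * _"] cong: if_cong)

lemma vf_apply_euler_vec: "vf_apply (proj_field euler_vec) f = euler f"
  by (simp add: vf_apply_def proj_field_euler_vec euler_def)

lemma bracket_trans_vec: "proj_field (sl_br (trans_vec k) p) $ i = pd k (proj_field p $ i)"
  by (simp add: proj_field_sl_br vf_bracket_nth vf_apply_trans_vec)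
     (simp add: proj_field_trans_vec axis_nth_if)

lemma bracket_euler_vec: "proj_field (sl_br euler_vec p) $ i = euler (proj_field p $ i) - proj_field p $ i"
  by (simp add: proj_field_sl_br vf_bracket_nth vf_apply_euler_vec)
     (simp add: proj_field_euler_vec)

text \<open>
  The order is reversed because linear vector fields represent matrices by an antihomomorphism.
\<close>

lemma gl_incl_bracket: "sl_br (gl_incl A) (gl_incl B) = gl_incl (gl_bracket B A)"
proof (rule sl_br_eqI, rule vf_eqI)
  fix x :: "real ^ 'a"
  have p: "eval_field (proj_field (gl_incl C)) x = C *v x" for C by (simp add: eval_field gl_incl_def)
  have "eval_field (vf_bracket (proj_field (gl_incl A)) (proj_field (gl_incl B))) x
      = B *v (A *v x) - A *v (B *v x)"
    unfolding eval_vf_bracket derivative_field p by (simp add: vec_eq_iff gl_incl_def)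
  then show "eval_field (proj_field (gl_incl (gl_bracket B A))) x
      = eval_field (vf_bracket (proj_field (gl_incl A)) (proj_field (gl_incl B))) x"
    unfolding p gl_bracket_def by (simp add: matrix_vector_mul_assoc matrix_vector_mult_diff_rdistrib)
qed

lemma gl_incl_lin: "gl_incl (A + B) = gl_incl A + gl_incl B" "gl_incl (r *\<^sub>R A) = r *\<^sub>R gl_incl A"
  by (auto simp: gl_incl_def mk_param_def vec_eq_iff split: sum.split)

lemma euler_pd: "pd j (euler f) = pd j f + euler (pd j f)"
  by (simp add: euler_def pd_mult sum.distrib if_distrib[where f = "\<lambda>x. x * _"] pd_commute[of j] cong: if_cong)

text \<open>
  The quadratic field \<open>(b \<cdot> x) x\<close> has divergence \<open>(m + 1) (b \<cdot> x)\<close>, so the quadratic coefficients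
  can be read off from second derivatives.
\<close>

lemma pd_divergence: "pd j (\<Sum>i\<in>UNIV. pd i (proj_field p $ i)) = of_real ((real CARD('m) + 1) * p $ Quad j)"
  for p :: "'m::finite sl_vec"
proof -
  have "pd i (proj_field p $ i) = of_real (p $ Lin i i) + p $ Quad i *\<^sub>R coord i
      + (\<Sum>j\<in>UNIV. (p $ Quad j) *\<^sub>R coord j)" for i
    by (rule sf_eqI) (simp add: pd_field_nth lin_part_def quad_part_def inner_vec_def)
  moreover have "pd j (of_nat n) = (0 :: 'm smooth_fun)" for n
    using pd_of_real[of j "real n"] by simp
  ultimately show ?thesis
    by (simp add: sum.distrib if_distrib[where f = "\<lambda>x. _ *\<^sub>R x"] pd_mult cong: if_cong)
       (simp add: of_real_def algebra_simps)
qed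

text \<open>
  The Taylor coefficients at a moving point: value, first derivative, and the quadratic
  coefficients, which are constant.
\<close>

fun frame :: "'m::finite sl_index \<Rightarrow> 'm sl_vec \<Rightarrow> 'm smooth_fun" where
  "frame (Inl i) p = proj_field p $ i"
| "frame (Inr (Inl (i, j))) p = pd j (proj_field p $ i)"
| "frame (Inr (Inr j)) p = of_real (p $ Quad j)"

fun weight :: "'m::finite sl_index \<Rightarrow> nat" where
  "weight (Inl i) = 1" | "weight (Inr (Inl ij)) = 0" | "weight (Inr (Inr j)) = 1"

lemma frame_lin: "frame b (p + q) = frame b p + frame b q" "frame b (r *\<^sub>R p) = r *\<^sub>R frame b p"
  by (cases b rule: sl_index_cases; simp add: proj_field_lin of_real_def algebra_simps)+

lemma quad_trans_bracket: "sl_br (trans_vec k) p $ Quad j = 0"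
  and quad_euler_bracket: "sl_br euler_vec p $ Quad j = p $ Quad j"
proof -
  have "of_real ((real CARD('a) + 1) * sl_br (trans_vec k) p $ Quad j)
      = pd k (pd j (\<Sum>i\<in>UNIV. pd i (proj_field p $ i)))"
    unfolding pd_divergence[symmetric] by (simp add: bracket_trans_vec pd_commute[of k])
  then have "of_real ((real CARD('a) + 1) * sl_br (trans_vec k) p $ Quad j) = (0 :: 'a smooth_fun)"
    by (simp only: pd_divergence pd_of_real)
  then show "sl_br (trans_vec k) p $ Quad j = 0" by (simp add: add_nonneg_eq_0_iff del: of_real_mult)
  have "pd j (\<Sum>i\<in>UNIV. pd i (proj_field (sl_br euler_vec p) $ i))
      = pd j (euler (\<Sum>i\<in>UNIV. pd i (proj_field p $ i)))"
    by (simp add: bracket_euler_vec euler_pd euler_sum)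
  also have "\<dots> = pd j (\<Sum>i\<in>UNIV. pd i (proj_field p $ i))"
    unfolding euler_pd[of j "sum _ _"] unfolding pd_divergence pd_euler_const by simp
  finally show "sl_br euler_vec p $ Quad j = p $ Quad j"
    unfolding pd_divergence of_real_eq_iff by (simp add: add_nonneg_eq_0_iff)
qed

text \<open>
  The left-hand side is the Lie derivative of the linear form \<open>frame b\<close> along
  \<open>s = 2 \<Sum>\<^sub>k x\<^sup>k \<partial>\<^sub>k - E\<close>: the anchor of \<open>s\<close> is \<open>E\<close>, and the bracket of \<open>s\<close> with a constant section
  \<open>X\<close> is \<open>2 \<Sum>\<^sub>k x\<^sup>k [\<partial>\<^sub>k, X] - [E, X] - 2 \<Sum>\<^sub>k X\<^sup>k \<partial>\<^sub>k\<close>.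
\<close>

lemma frame_weight:
  "euler (frame b p) - (2 *\<^sub>R (\<Sum>k\<in>UNIV. coord k * frame b (sl_br (trans_vec k) p))
     - frame b (sl_br euler_vec p) - 2 *\<^sub>R (\<Sum>k\<in>UNIV. proj_field p $ k * frame b (trans_vec k)))
   = real (weight b) *\<^sub>R frame b p"
proof (cases b rule: sl_index_cases)
  case (1 i)
  have "(\<Sum>k\<in>UNIV. proj_field p $ k * axis k 1 $ i) = proj_field p $ i"
    by (simp add: axis_nth_if if_distrib[where f = "\<lambda>x. _ * x"] cong: if_cong)
  with 1 show ?thesis
    by (simp add: bracket_trans_vec bracket_euler_vec proj_field_trans_vec euler_def[symmetric] scaleR_2)
next
  case (2 i j)
  have "(\<Sum>k\<in>UNIV. coord k * pd j (pd k (proj_field p $ i))) = euler (pd j (proj_field p $ i))"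
    by (simp add: euler_def pd_commute[of j])
  moreover have "pd j (axis k 1 $ i) = 0" for k by (simp add: axis_nth_if)
  ultimately show ?thesis
    using 2 by (simp add: bracket_trans_vec bracket_euler_vec proj_field_trans_vec euler_pd scaleR_2)
next
  case (3 j)
  then show ?thesis
    by (simp add: quad_trans_bracket quad_euler_bracket pd_euler_const)
       (simp add: trans_vec_def axis_nth_if)
qed

lemma frame_surj: "\<exists>p. \<forall>b. sf_apply (frame b p) x = w b"
proof -
  define q :: "real ^ 'a" where "q = (\<chi> j. w (Quad j))"
  define M :: "real ^ 'a ^ 'a" where "M = (\<chi> i j. w (Lin i j) - q $ j * x $ i - (q \<bullet> x) * (if i
      = j then 1 else 0))"
  define v :: "real ^ 'a" where "v = (\<chi> i. w (Trans i))"
  let ?p = "mk_param (v - M *v x - (q \<bullet> x) *\<^sub>R x) M q"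
  have "sf_apply (frame b ?p) x = w b" for b
  proof (cases b rule: sl_index_cases)
    case (1 i)
    have "eval_field (proj_field ?p) x $ i = v $ i" by (simp add: eval_field)
    then show ?thesis using 1 by (simp add: eval_field_def v_def)
  next
    case (2 i j)
    then show ?thesis by (simp add: pd_field_nth M_def)
  next
    case (3 j)
    then show ?thesis by (simp add: mk_param_def q_def)
  qed
  then show ?thesis by blast
qed

text \<open>
  The Taylor coefficients at \<open>x\<close> determine those at \<open>0\<close>, with coefficients polynomial in \<open>x\<close>.
\<close>

lemma frame_expansion:
  obtains N :: "'m::finite sl_index \<Rightarrow> 'm sl_index \<Rightarrow> 'm smooth_fun"
  where "\<And>p b. of_real (p $ b) = (\<Sum>e\<in>UNIV. frame e p * N e b)"
proof -
  have "\<exists>N. \<forall>p. of_real (p $ b) = (\<Sum>e\<in>UNIV. frame e p * N e)" for b :: "'m sl_index"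
  proof (cases b rule: sl_index_cases)
    case (1 k)
    \<comment> \<open>\<open>X\<^sup>k(0) = X\<^sup>k - \<Sum>\<^sub>j x\<^sup>j \<partial>\<^sub>j X\<^sup>k + x\<^sup>k \<Sum>\<^sub>j x\<^sup>j q\<^sub>j\<close>\<close>
    let ?N = "\<lambda>e. case e of Inl i \<Rightarrow> if i = k then 1 else 0 | Inr (Inl (i, j)) \<Rightarrow> if i = k then - coord j else 0
      | Inr (Inr j) \<Rightarrow> coord k * coord j"
    have "of_real (p $ Trans k) = (\<Sum>e\<in>UNIV. frame e p * ?N e)" for p
    proof (rule sf_eqI)
      fix x
      have "(\<Sum>i\<in>UNIV. \<Sum>j\<in>UNIV. if i = k then - (x $ j * sf_apply (pd j (proj_field p $ i)) x) else 0)
          = - (\<Sum>j\<in>UNIV. x $ j * sf_apply (pd j (proj_field p $ k)) x)"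
        by (subst sum.swap) (simp add: sum_negf)
      moreover have "(\<Sum>j\<in>UNIV. x $ j * sf_apply (pd j (proj_field p $ k)) x)
          = (lin_part p *v x) $ k + 2 * (quad_part p \<bullet> x) * x $ k"
        unfolding derivative_field by simp
      moreover have "sf_apply (proj_field p $ k) x
          = p $ Trans k + (lin_part p *v x) $ k + (quad_part p \<bullet> x) * x $ k"
        using eval_field[of p x] by (simp add: eval_field_def vec_eq_iff trans_part_def)
      moreover have "(\<Sum>j\<in>UNIV. p $ Quad j * (x $ k * x $ j)) = (quad_part p \<bullet> x) * x $ k"
        by (simp add: inner_vec_def quad_part_def sum_distrib_left sum_distrib_right mult_ac)
      ultimately show "sf_apply (of_real (p $ Trans k)) x = sf_apply (\<Sum>e\<in>UNIV. frame e p * ?N e) x"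
        by (simp add: sum_sl_index if_distrib[where f = "\<lambda>x. _ * x"] if_distrib[where f = "\<lambda>f. sf_apply f _"]
            sum_negf mult.commute cong: if_cong)
    qed
    then show ?thesis using 1 by blast
  next
    case (2 i j)
    \<comment> \<open>\<open>\<partial>\<^sub>j X\<^sup>i(0) = \<partial>\<^sub>j X\<^sup>i - x\<^sup>i q\<^sub>j - \<delta>\<^sub>i\<^sub>j \<Sum>\<^sub>l x\<^sup>l q\<^sub>l\<close>\<close>
    let ?N = "\<lambda>e. case e of Inl i \<Rightarrow> 0 | Inr (Inl (k, l)) \<Rightarrow> if k = i \<and> l = j then 1 else 0
      | Inr (Inr l) \<Rightarrow> - (if l = j then coord i else 0) - (if i = j then coord l else 0)"
    have "of_real (p $ Lin i j) = (\<Sum>e\<in>UNIV. frame e p * ?N e)" for p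
    proof (rule sf_eqI)
      fix x
      have "(\<Sum>k\<in>UNIV. \<Sum>l\<in>UNIV. if k = i \<and> l = j then sf_apply (pd l (proj_field p $ k)) x else 0)
          = (\<Sum>k\<in>UNIV. if k = i then sf_apply (pd j (proj_field p $ k)) x else 0)"
        by (rule sum.cong) (auto cong: if_cong)
      then have "(\<Sum>k\<in>UNIV. \<Sum>l\<in>UNIV. if k = i \<and> l = j then sf_apply (pd l (proj_field p $ k)) x else 0)
          = p $ Lin i j + p $ Quad j * x $ i + (\<Sum>l\<in>UNIV. p $ Quad l * x $ l) * (if i = j then 1 else 0)"
        by (simp add: pd_field_nth lin_part_def quad_part_def inner_vec_def)
      then show "sf_apply (of_real (p $ Lin i j)) x = sf_apply (\<Sum>e\<in>UNIV. frame e p * ?N e) x"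
        by (simp add: sum_sl_index if_distrib[where f = "\<lambda>x. _ * x"] if_distrib[where f = "\<lambda>f. sf_apply f _"]
            right_diff_distrib sum_negf sum_subtractf cong: if_cong)
    qed
    then show ?thesis using 2 by blast
  next
    case (3 j)
    let ?N = "\<lambda>e. case e of Inl i \<Rightarrow> 0 | Inr (Inl (k, l)) \<Rightarrow> 0 | Inr (Inr l) \<Rightarrow> (if l = j then 1 else 0)"
    have "of_real (p $ Quad j) = (\<Sum>e\<in>UNIV. frame e p * ?N e)" for p
      by (simp add: sum_sl_index if_distrib[where f = "\<lambda>x. _ * x"] cong: if_cong)
    then show ?thesis using 3 by blast
  qed
  then have "\<forall>b :: 'm sl_index. \<exists>N. \<forall>p. of_real (p $ b) = (\<Sum>e\<in>UNIV. frame e p * N e)" by blast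
  then have "\<exists>N. \<forall>(b :: 'm sl_index) p. of_real (p $ b) = (\<Sum>e\<in>UNIV. frame e p * N b e)" by (rule choice)
  then obtain N where "\<And>(b :: 'm sl_index) p. of_real (p $ b) = (\<Sum>e\<in>UNIV. frame e p * N b e)" by blast
  then show ?thesis by (rule that[of "\<lambda>e b. N b e"])
qed

text \<open>
  It is \<open>0\<close> for the indices that do not belong to a matrix entry, so that sums may run over all
  indices.
\<close>

definition mat_unit :: "'m::finite sl_index \<Rightarrow> real ^ 'm ^ 'm" where
  "mat_unit b = (case b of Inr (Inl (i, j)) \<Rightarrow> axis i (axis j 1) | _ \<Rightarrow> 0)"

lemma mat_unit_expansion: "A = (\<Sum>b\<in>UNIV. (gl_incl A $ b) *\<^sub>R mat_unit b)"
proof -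
  have "A $ k $ l = (\<Sum>b\<in>UNIV. (gl_incl A $ b) *\<^sub>R mat_unit b) $ k $ l" for k l
  proof -
    have "(\<Sum>i\<in>UNIV. \<Sum>j\<in>UNIV. if k = i then if l = j then A $ i $ j else 0 else 0) = A $ k $ l"
      by (subst sum.swap) simp
    then show ?thesis
      by (simp add: sum_sl_index mat_unit_def gl_incl_def mk_param_def axis_nth_if
        if_distrib[where f = "\<lambda>x. _ * x"] if_distrib[where f = "\<lambda>f. f $ _"] cong: if_cong)
  qed
  then show ?thesis by (simp add: vec_eq_iff)
qed

lemma frame_gl_incl_0: "sf_apply (frame b (gl_incl A)) 0 = gl_incl A $ b"
proof (cases b rule: sl_index_cases)
  case (1 i)
  then show ?thesis by (simp add: field_gl_incl) (simp add: gl_incl_def mk_param_def)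
next
  case (2 i j)
  then show ?thesis by (simp add: pd_field_nth lin_part_def)
next
  case (3 j)
  then show ?thesis by simp
qed

section \<open>Differential operators and the radial operator\<close>

type_synonym 'm sf_op = "'m smooth_fun \<Rightarrow> 'm smooth_fun"

definition monomial_op :: "'m::finite smooth_fun \<Rightarrow> 'm list \<Rightarrow> 'm sf_op" where
  "monomial_op a w = (\<lambda>f. a * foldr pd w f)"

definition op_mult :: "'m::finite smooth_fun \<Rightarrow> 'm sf_op \<Rightarrow> 'm sf_op" where
  "op_mult f A = (\<lambda>g. f * A g)"

lemma op_mult_apply [simp]: "op_mult f A g = f * A g" by (simp add: op_mult_def)

lemma finite_words: "finite {w :: 'm::finite list. length w \<le> k}"
  using finite_lists_length_le[of "UNIV :: 'm set" k] by simp

lemma diff_ops_le_iff: "A \<in> diff_ops_le k \<longleftrightarrow> (\<exists>a. \<forall>f. A f = (\<Sum>w\<in>{w. length w \<le> k}. a w * foldr pd w f))"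
  by (auto simp: diff_ops_le_def fun_eq_iff)

lemma diff_ops_le_add: assumes "A \<in> diff_ops_le k" "B \<in> diff_ops_le k" shows "A + B \<in> diff_ops_le k"
proof -
  obtain a b where "\<And>f. A f = (\<Sum>w\<in>{w. length w \<le> k}. a w * foldr pd w f)"
    "\<And>f. B f = (\<Sum>w\<in>{w. length w \<le> k}. b w * foldr pd w f)"
    using assms unfolding diff_ops_le_iff by blast
  then show ?thesis unfolding diff_ops_le_iff
    by (intro exI[of _ "\<lambda>w. a w + b w"]) (simp add: distrib_right sum.distrib)
qed

lemma diff_ops_le_mult: assumes "A \<in> diff_ops_le k" shows "op_mult g A \<in> diff_ops_le k"
proof -
  obtain a where "\<And>f. A f = (\<Sum>w\<in>{w. length w \<le> k}. a w * foldr pd w f)"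
    using assms unfolding diff_ops_le_iff by blast
  then show ?thesis unfolding diff_ops_le_iff
    by (intro exI[of _ "\<lambda>w. g * a w"]) (simp add: sum_distrib_left mult.assoc)
qed

lemma monomial_op_in: "length w \<le> k \<Longrightarrow> monomial_op a w \<in> diff_ops_le k"
  unfolding diff_ops_le_iff
  by (intro exI[of _ "\<lambda>v. if v = w then a else 0"])
     (simp add: monomial_op_def if_distrib[where f = "\<lambda>x. x * _"] finite_words cong: if_cong)

lemma zero_eq_monomial: "0 = monomial_op 0 []" by (auto simp: monomial_op_def fun_eq_iff)

lemma subspace_diff_ops_le: "subspace (diff_ops_le k)"
proof (rule subspaceI)
  show "0 \<in> diff_ops_le k" unfolding zero_eq_monomial by (rule monomial_op_in) simp
  show "r *\<^sub>R A \<in> diff_ops_le k" if "A \<in> diff_ops_le k" for r A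
  proof -
    have "r *\<^sub>R A = op_mult (of_real r) A" by (simp add: fun_eq_iff scaleR_conv_of_real)
    then show ?thesis using diff_ops_le_mult[OF that] by simp
  qed
qed (rule diff_ops_le_add)

text \<open>
  An operator has many presentations; this rule is the way to argue on monomials without choosing
  one.
\<close>

lemma diff_ops_le_induct [consumes 1, case_names monomial add]:
  assumes "A \<in> diff_ops_le k"
    and mon: "\<And>a w. length w \<le> k \<Longrightarrow> P (monomial_op a w)"
    and add: "\<And>A B. A \<in> diff_ops_le k \<Longrightarrow> B \<in> diff_ops_le k \<Longrightarrow> P A \<Longrightarrow> P B \<Longrightarrow> P (A + B)"
  shows "P A"
proof -
  obtain a where a: "\<And>f. A f = (\<Sum>w\<in>{w. length w \<le> k}. a w * foldr pd w f)"
    using assms(1) unfolding diff_ops_le_iff by blast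
  have "(\<Sum>w\<in>S. monomial_op (a w) w) \<in> diff_ops_le k \<and> P (\<Sum>w\<in>S. monomial_op (a w) w)"
    if "finite S" "S \<subseteq> {w. length w \<le> k}" for S
    using that
  proof (induction S rule: finite_induct)
    case empty
    have "0 \<in> diff_ops_le k \<and> P 0" using mon[of "[]" 0] monomial_op_in[of "[]" k 0]
        by (simp flip: zero_eq_monomial)
    then show ?case by (simp only: sum.empty)
  next
    case (insert w S)
    then have "length w \<le> k" "(\<Sum>w\<in>S. monomial_op (a w) w) \<in> diff_ops_le k" "P (\<Sum>w\<in>S. monomial_op (a w) w)"
      by auto
    then have "monomial_op (a w) w + (\<Sum>w\<in>S. monomial_op (a w) w) \<in> diff_ops_le k
        \<and> P (monomial_op (a w) w + (\<Sum>w\<in>S. monomial_op (a w) w))"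
      by (intro conjI diff_ops_le_add add mon monomial_op_in)
    moreover have "(\<Sum>w\<in>insert w S. monomial_op (a w) w) = monomial_op (a w) w + (\<Sum>w\<in>S. monomial_op (a w) w)"
      by (rule sum.insert[OF insert.hyps(1,2)])
    ultimately show ?case by (simp only: simp_thms)
  qed
  from this[OF finite_words order_refl] have "P (\<Sum>w\<in>{w. length w \<le> k}. monomial_op (a w) w)" by blast
  also have "(\<Sum>w\<in>{w. length w \<le> k}. monomial_op (a w) w) = A"
    by (rule ext) (simp add: a sum_fun_apply monomial_op_def)
  finally show ?thesis .
qed

lemma diff_ops_le_mono: "k \<le> l \<Longrightarrow> diff_ops_le k \<subseteq> diff_ops_le l"
proof
  fix A :: "'a sf_op" assume "A \<in> diff_ops_le k" "k \<le> l"
  then show "A \<in> diff_ops_le l"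
    by (induction rule: diff_ops_le_induct) (auto intro: monomial_op_in diff_ops_le_add)
qed

lemma diff_ops_le_subset: "diff_ops_le k \<subseteq> diff_ops"
  by (auto simp: diff_ops_def)

lemma diff_ops_add: "A \<in> diff_ops \<Longrightarrow> B \<in> diff_ops \<Longrightarrow> A + B \<in> diff_ops"
proof -
  assume "A \<in> diff_ops" "B \<in> diff_ops"
  then obtain k l where "A \<in> diff_ops_le k" "B \<in> diff_ops_le l" by (auto simp: diff_ops_def)
  then have "A \<in> diff_ops_le (max k l)" "B \<in> diff_ops_le (max k l)"
    using diff_ops_le_mono[of k "max k l"] diff_ops_le_mono[of l "max k l"] by auto
  then show ?thesis using diff_ops_le_add diff_ops_le_subset by blast
qed

lemma subspace_diff_ops: "subspace diff_ops"
proof (rule subspaceI)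
  show "0 \<in> diff_ops" using subspace_0[OF subspace_diff_ops_le[of 0]] diff_ops_le_subset by blast
  show "r *\<^sub>R A \<in> diff_ops" if "A \<in> diff_ops" for r A
    using that subspace_scale[OF subspace_diff_ops_le] by (fastforce simp: diff_ops_def)
qed (rule diff_ops_add)

lemma diff_ops_induct [consumes 1, case_names monomial add]:
  assumes "A \<in> diff_ops" and "\<And>a w. P (monomial_op a w)"
    and "\<And>A B. A \<in> diff_ops \<Longrightarrow> B \<in> diff_ops \<Longrightarrow> P A \<Longrightarrow> P B \<Longrightarrow> P (A + B)"
  shows "P A"
proof -
  obtain k where "A \<in> diff_ops_le k" using assms(1) by (auto simp: diff_ops_def)
  then show ?thesis
    by (induction rule: diff_ops_le_induct) (use assms diff_ops_le_subset in blast)+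
qed

lemma diff_ops_mult: "A \<in> diff_ops \<Longrightarrow> op_mult g A \<in> diff_ops"
  using diff_ops_le_mult by (fastforce simp: diff_ops_def)

lemma monomial_op_diff_ops: "monomial_op a w \<in> diff_ops"
  using monomial_op_in[of w "length w" a] diff_ops_le_subset by blast

lemma foldr_pd_lin [simp]: "foldr pd w (f + g) = foldr pd w f + foldr pd w g"
  "foldr pd w (r *\<^sub>R f) = r *\<^sub>R foldr pd w f"
  by (induction w) auto

lemma foldr_pd_commute: "foldr pd w (pd k f) = pd k (foldr pd w f)"
  by (induction w) (auto simp: pd_commute[of k])

lemma diff_ops_linear:
  assumes "A \<in> diff_ops"
  shows "A (f + g) = A f + A g" "A (r *\<^sub>R f) = r *\<^sub>R A f" "A 0 = 0" "A (- f) = - A f" "A (f - g) = A f - A g"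
proof -
  have *: "A (f + g) = A f + A g \<and> A (r *\<^sub>R f) = r *\<^sub>R A f" for f g r
    using assms by (induction rule: diff_ops_induct) (auto simp: monomial_op_def algebra_simps)
  then show "A (f + g) = A f + A g" "A (r *\<^sub>R f) = r *\<^sub>R A f" by auto
  show "A 0 = 0" using *[of 0 0 0] by simp
  show m: "A (- f) = - A f" for f using *[of f f "-1"] by simp
  show "A (f - g) = A f - A g" using *[of f "- g"] by (simp add: m)
qed

lemma diff_ops_le_pd: "A \<in> diff_ops_le k \<Longrightarrow> pd i \<circ> A \<in> diff_ops_le (Suc k)"
proof (induction rule: diff_ops_le_induct)
  case (monomial a w)
  have "pd i \<circ> monomial_op a w = monomial_op (pd i a) w + monomial_op a (i # w)"
    by (simp add: fun_eq_iff monomial_op_def pd_mult)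
  moreover have "monomial_op (pd i a) w + monomial_op a (i # w) \<in> diff_ops_le (Suc k)"
    using monomial by (intro diff_ops_le_add monomial_op_in) auto
  ultimately show ?case by (simp only:)
next
  case (add A B)
  have "pd i \<circ> (A + B) = (pd i \<circ> A) + (pd i \<circ> B)" by (simp add: fun_eq_iff)
  then show ?case using diff_ops_le_add[OF add.IH] by (simp only:)
qed

lemma diff_ops_pd: "A \<in> diff_ops \<Longrightarrow> pd i \<circ> A \<in> diff_ops"
  using diff_ops_le_pd by (fastforce simp: diff_ops_def)

lemma diff_ops_comp: "A \<in> diff_ops \<Longrightarrow> B \<in> diff_ops \<Longrightarrow> A \<circ> B \<in> diff_ops"
proof (induction rule: diff_ops_induct)
  case (monomial a w)
  have "foldr pd w \<circ> B \<in> diff_ops"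
  proof (induction w)
    case (Cons i w)
    have "foldr pd (i # w) \<circ> B = pd i \<circ> (foldr pd w \<circ> B)" by auto
    then show ?case using diff_ops_pd[OF Cons.IH, of i] by (simp only:)
  qed (use monomial in \<open>simp add: comp_def\<close>)
  moreover have "monomial_op a w \<circ> B = op_mult a (foldr pd w \<circ> B)" by (simp add: fun_eq_iff monomial_op_def)
  ultimately show ?case using diff_ops_mult by (simp only:)
next
  case (add A A')
  have "(A + A') \<circ> B = (A \<circ> B) + (A' \<circ> B)" by (simp add: fun_eq_iff)
  then show ?case using diff_ops_add[OF add.IH(1)[OF add.prems] add.IH(2)[OF add.prems]] by (simp only:)
qed

lemma diff_ops_0_iff: "A \<in> diff_ops_le 0 \<longleftrightarrow> (\<exists>a. A = (\<lambda>f. a * f))"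
proof
  show "A \<in> diff_ops_le 0 \<Longrightarrow> \<exists>a. A = (\<lambda>f. a * f)" by (auto simp: diff_ops_le_def)
  show "\<exists>a. A = (\<lambda>f. a * f) \<Longrightarrow> A \<in> diff_ops_le 0"
    using monomial_op_in[of "[]" 0] by (auto simp: monomial_op_def)
qed

definition divergence :: "'m::finite vector_field \<Rightarrow> 'm smooth_fun" where
  "divergence X = (\<Sum>i\<in>UNIV. pd i (X $ i))"

lemma lie_deriv_eq: "lie_deriv lam X f = vf_apply X f + lam *\<^sub>R (divergence X * f)"
  by (simp add: lie_deriv_def divergence_def trace_def vf_deriv_def)

lemma divergence_lin: "divergence (X + Y) = divergence X + divergence Y" "divergence (r *\<^sub>R X)
    = r *\<^sub>R divergence X"
  by (simp_all add: divergence_def sum.distrib scaleR_sum_right)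

text \<open>
  The terms with a product of first derivatives cancel by symmetry.
\<close>

lemma divergence_bracket: "divergence (vf_bracket X Y) = vf_apply X (divergence Y) - vf_apply Y (divergence X)"
proof -
  have "(\<Sum>i\<in>UNIV. \<Sum>k\<in>UNIV. pd i (X $ k) * pd k (Y $ i)) = (\<Sum>i\<in>UNIV. \<Sum>k\<in>UNIV. pd i (Y $ k) * pd k (X $ i))"
    by (subst sum.swap) (simp add: mult.commute)
  moreover have "pd i (vf_apply X f) = (\<Sum>k\<in>UNIV. pd i (X $ k) * pd k f) + vf_apply X (pd i f)"
      for i X and f :: "'a smooth_fun"
    by (simp add: vf_apply_def pd_mult sum.distrib pd_commute[of i] add.commute)
  ultimately show ?thesis
    by (simp add: divergence_def vf_bracket_nth sum.distrib sum_subtractf)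
qed

lemma lie_deriv_bracket:
  "lie_deriv lam (vf_bracket X Y) f = lie_deriv lam X (lie_deriv lam Y f) - lie_deriv lam Y (lie_deriv lam X f)"
  by (simp add: lie_deriv_eq vf_apply_bracket divergence_bracket vf_apply_mult algebra_simps)

lemma lie_deriv_lin: "lie_deriv lam X (f + g) = lie_deriv lam X f + lie_deriv lam X g"
  "lie_deriv lam X (f - g) = lie_deriv lam X f - lie_deriv lam X g"
  "lie_deriv lam X (r *\<^sub>R f) = r *\<^sub>R lie_deriv lam X f"
  "lie_deriv lam (X + Y) f = lie_deriv lam X f + lie_deriv lam Y f"
  "lie_deriv lam (r *\<^sub>R X) f = r *\<^sub>R lie_deriv lam X f"
  by (simp_all add: lie_deriv_eq divergence_lin algebra_simps)

lemma lie_deriv_diff_ops: "lie_deriv lam X \<in> diff_ops"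
proof -
  have "lie_deriv lam X = (\<Sum>i\<in>UNIV. monomial_op (X $ i) [i]) + monomial_op (lam *\<^sub>R divergence X) []"
    by (simp add: fun_eq_iff lie_deriv_eq vf_apply_def monomial_op_def sum_fun_apply)
  then show ?thesis by (auto intro!: diff_ops_add subspace_sum[OF subspace_diff_ops] monomial_op_diff_ops)
qed

definition sl_act :: "real \<Rightarrow> 'm::finite sl_vec \<Rightarrow> 'm sf_op \<Rightarrow> 'm sf_op" where
  "sl_act lam p A = diff_op_action lam lam (proj_field p) A"

lemma sl_act_apply: "sl_act lam p A f = lie_deriv lam (proj_field p) (A f) - A (lie_deriv lam (proj_field p) f)"
  by (simp add: sl_act_def diff_op_action_def)

lemma sl_act_diff_ops: "A \<in> diff_ops \<Longrightarrow> sl_act lam p A \<in> diff_ops"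
  unfolding sl_act_def diff_op_action_def
  by (intro subspace_diff[OF subspace_diff_ops] diff_ops_comp lie_deriv_diff_ops)

lemma sl_act_diff_ops_0: "A \<in> diff_ops_le 0 \<Longrightarrow> sl_act lam p A \<in> diff_ops_le 0"
proof -
  assume "A \<in> diff_ops_le 0"
  then obtain a where "A = (\<lambda>f. a * f)" by (auto simp: diff_ops_0_iff)
  then have "sl_act lam p A = (\<lambda>f. vf_apply (proj_field p) a * f)"
    by (simp add: fun_eq_iff sl_act_apply lie_deriv_eq vf_apply_mult algebra_simps)
  then show ?thesis by (auto simp: diff_ops_0_iff)
qed

lemma sl_act_mult: "sl_act lam p (op_mult g A)
    = op_mult (vf_apply (proj_field p) g) A + op_mult g (sl_act lam p A)"
  by (simp add: fun_eq_iff sl_act_apply lie_deriv_eq vf_apply_mult algebra_simps)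

lemma sl_act_rep: "A \<in> diff_ops \<Longrightarrow> sl_act lam (sl_br p q) A
    = sl_act lam p (sl_act lam q A) - sl_act lam q (sl_act lam p A)"
  by (simp add: fun_eq_iff sl_act_apply proj_field_sl_br lie_deriv_bracket lie_deriv_lin diff_ops_linear)

locale coeff_module =
  fixes lam :: real and W :: "'m::finite sf_op set"
  assumes W_cases: "W = diff_ops_le 0 \<or> W = diff_ops"
begin

lemma W_subset: "A \<in> W \<Longrightarrow> A \<in> diff_ops" using W_cases diff_ops_le_subset by blast

lemma W_subspace: "subspace W" using W_cases subspace_diff_ops_le subspace_diff_ops by blast

lemma W_mult: "A \<in> W \<Longrightarrow> op_mult g A \<in> W" using W_cases diff_ops_le_mult diff_ops_mult by blast

end

sublocale coeff_module \<subseteq> lie_rep sl_br W "sl_act lam"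
proof
  fix x y :: "'m sl_vec" and r :: real and v w :: "'m sf_op"
  show "subspace W" by (rule W_subspace)
  show "sl_act lam x w \<in> W" if "w \<in> W" using that W_cases sl_act_diff_ops sl_act_diff_ops_0 by blast
  show "sl_act lam x (v + w) = sl_act lam x v + sl_act lam x w"
    by (simp add: fun_eq_iff sl_act_apply lie_deriv_lin)
  show "sl_act lam x (r *\<^sub>R w) = r *\<^sub>R sl_act lam x w"
    by (simp add: fun_eq_iff sl_act_apply lie_deriv_lin algebra_simps)
  show "sl_act lam (x + y) w = sl_act lam x w + sl_act lam y w" if "w \<in> W"
    using W_subset[OF that] by (simp add: fun_eq_iff sl_act_apply proj_field_lin lie_deriv_lin diff_ops_linear)
  show "sl_act lam (r *\<^sub>R x) w = r *\<^sub>R sl_act lam x w" if "w \<in> W"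
    using W_subset[OF that] by (simp add: fun_eq_iff sl_act_apply proj_field_lin lie_deriv_lin
      diff_ops_linear algebra_simps)
  show "sl_act lam (sl_br x y) w = sl_act lam x (sl_act lam y w) - sl_act lam y (sl_act lam x w)" if "w \<in> W"
    by (rule sl_act_rep[OF W_subset[OF that]])
qed (rule sl_br_add sl_br_scale sl_br_anti sl_br_jacobi)+

text \<open>
  The action of the section \<open>s\<close> on an operator, \<open>2 \<Sum>\<^sub>k x\<^sup>k [\<partial>\<^sub>k, A] - [E, A]\<close>, with the terms
  collected.
\<close>

definition radial :: "'m::finite sf_op \<Rightarrow> 'm sf_op" where
  "radial A = (\<lambda>f. euler (A f) + A (euler f) - 2 *\<^sub>R (\<Sum>k\<in>UNIV. coord k * A (pd k f)))"

lemma euler_lin: "euler (f - g) = euler f - euler g" "euler (r *\<^sub>R f) = r *\<^sub>R euler f" "euler (- f) = - euler f"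
  by (simp_all add: euler_def algebra_simps sum_subtractf sum_negf scaleR_sum_right)

lemma divergence_trans_vec: "divergence (proj_field (trans_vec k)) = 0"
  by (simp add: divergence_def proj_field_trans_vec axis_nth_if if_distrib[where f = "pd _"] cong: if_cong)

lemma divergence_gl_incl: "\<exists>r. divergence (proj_field (gl_incl A)) = of_real r"
  by (intro exI[of _ "\<Sum>i\<in>UNIV. A $ i $ i"])
     (simp add: divergence_def field_gl_incl of_real_def scaleR_sum_left
       if_distrib[where f = "\<lambda>x. _ *\<^sub>R x"] cong: if_cong)

text \<open>
  The weight of the densities drops out: \<open>\<partial>\<^sub>k\<close> has divergence \<open>0\<close> and \<open>E\<close> has constant divergence.
\<close>

lemma radial_eq_act:
  assumes "A \<in> diff_ops"
  shows "radial A = 2 *\<^sub>R (\<Sum>k\<in>UNIV. op_mult (coord k) (sl_act lam (trans_vec k) A)) - sl_act lam euler_vec A"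
proof
  fix f
  obtain r where r: "divergence (proj_field (euler_vec :: 'a sl_vec)) = of_real r"
    unfolding euler_vec_def using divergence_gl_incl by blast
  have "A (of_real r * f) = of_real r * A f"
    by (simp only: scaleR_conv_of_real[symmetric] diff_ops_linear(2)[OF assms])
  then have "sl_act lam euler_vec A f = euler (A f) - A (euler f)"
    by (simp add: sl_act_apply lie_deriv_eq vf_apply_euler_vec r diff_ops_linear[OF assms])
  moreover have "sl_act lam (trans_vec k) A f = pd k (A f) - A (pd k f)" for k
    by (simp add: sl_act_apply lie_deriv_eq vf_apply_trans_vec divergence_trans_vec)
  ultimately show "radial A f = (2 *\<^sub>R (\<Sum>k\<in>UNIV. op_mult (coord k) (sl_act lam (trans_vec k) A))
      - sl_act lam euler_vec A) f"
    by (simp add: radial_def sum_fun_apply right_diff_distrib sum_subtractf scaleR_2) (simp add: euler_def)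
qed

lemma radial_add: "radial (A + B) = radial A + radial B"
  by (simp add: radial_def fun_eq_iff algebra_simps sum.distrib)

lemma radial_scale: "radial (r *\<^sub>R A) = r *\<^sub>R radial A"
  by (simp add: radial_def fun_eq_iff algebra_simps scaleR_sum_right euler_lin)

lemma linear_radial: "linear radial" by (rule linearI) (rule radial_add radial_scale)+

lemma foldr_pd_euler: "foldr pd w (euler f) = euler (foldr pd w f) + real (length w) *\<^sub>R foldr pd w f"
  by (induction w) (simp_all add: euler_pd algebra_simps)

text \<open>
  This is where the section \<open>2 x - y\<close> pays off: from \<open>[E, \<partial>\<^sup>w] = - |w| \<partial>\<^sup>w\<close> the order of the
  monomial enters with a positive sign.
\<close>

lemma radial_monomial: "radial (monomial_op a w) = monomial_op (euler a + real (length w) *\<^sub>R a) w"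
proof
  fix f
  have "(\<Sum>k\<in>UNIV. coord k * (a * foldr pd w (pd k f))) = a * euler (foldr pd w f)"
    by (simp add: foldr_pd_commute euler_def sum_distrib_left algebra_simps)
  then show "radial (monomial_op a w) f = monomial_op (euler a + real (length w) *\<^sub>R a) w f"
    by (simp add: radial_def monomial_op_def foldr_pd_euler euler_mult scaleR_2 algebra_simps)
qed

lemma radial_mult: "radial (op_mult g A) = op_mult (euler g) A + op_mult g (radial A)"
  by (simp add: fun_eq_iff radial_def euler_mult algebra_simps scaleR_sum_right sum_distrib_left)

definition coord_commutator :: "'m::finite \<Rightarrow> 'm sf_op \<Rightarrow> 'm sf_op" where
  "coord_commutator i A = (\<lambda>f. A (coord i * f) - coord i * A f)"

text \<open>
  The commutator with a coordinate lowers the order by one and therefore shifts the eigenvalue by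
  one.
\<close>

lemma radial_coord_commutator:
  assumes "A \<in> diff_ops"
  shows "coord_commutator i (radial A) = radial (coord_commutator i A) + coord_commutator i A"
proof
  fix f
  have 1: "A (euler (coord i * f)) = A (coord i * f) + A (coord i * euler f)"
    by (simp add: euler_mult euler_coord diff_ops_linear[OF assms])
  have "(\<Sum>k\<in>UNIV. coord k * A (if k = i then f else 0)) = coord i * A f"
  proof -
    have "coord k * A (if k = i then f else 0) = (if k = i then coord k * A f else 0)" for k
      by (simp add: diff_ops_linear[OF assms])
    then show ?thesis by simp
  qed
  then have 2: "(\<Sum>k\<in>UNIV. coord k * A (pd k (coord i * f)))
      = (\<Sum>k\<in>UNIV. coord k * A (coord i * pd k f)) + coord i * A f"
    by (simp add: pd_mult diff_ops_linear[OF assms] distrib_left sum.distrib if_distrib[where f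
      = "\<lambda>x. x * f"] cong: if_cong)
  show "coord_commutator i (radial A) f = (radial (coord_commutator i A) + coord_commutator i A) f"
    unfolding coord_commutator_def radial_def 1 2 plus_fun_apply
    by (simp add: euler_lin euler_mult euler_coord algebra_simps sum_subtractf sum_distrib_left scaleR_2)
qed

lemma coord_commutator_lin: "coord_commutator i (A + B) = coord_commutator i A + coord_commutator i B"
  "coord_commutator i (r *\<^sub>R A) = r *\<^sub>R coord_commutator i A"
  by (simp_all add: coord_commutator_def fun_eq_iff algebra_simps)

lemma coord_commutator_order:
  assumes "A \<in> diff_ops_le (Suc k)" shows "coord_commutator i A \<in> diff_ops_le k"
proof -
  have w: "coord_commutator i (foldr pd w) \<in> diff_ops_le k" if "length w \<le> Suc k" for w and k
    using that
  proof (induction w arbitrary: k)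
    case Nil
    have "coord_commutator i (foldr pd []) = 0" by (simp add: coord_commutator_def fun_eq_iff)
    then show ?case using subspace_0[OF subspace_diff_ops_le] by metis
  next
    case (Cons v w)
    have eq: "coord_commutator i (foldr pd (v # w)) = (pd v \<circ> coord_commutator i (foldr pd w))
        + (if v = i then monomial_op 1 w else 0)"
      by (auto simp: coord_commutator_def fun_eq_iff pd_mult monomial_op_def)
    have m: "(if v = i then monomial_op 1 w else 0) \<in> diff_ops_le k"
      using Cons.prems monomial_op_in[of w k 1] subspace_0[OF subspace_diff_ops_le] by auto
    have "pd v \<circ> coord_commutator i (foldr pd w) \<in> diff_ops_le k"
    proof (cases k)
      case 0
      then have "w = []" using Cons.prems by simp
      then have "pd v \<circ> coord_commutator i (foldr pd w) = 0" by (auto simp: coord_commutator_def fun_eq_iff)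
      then show ?thesis using subspace_0[OF subspace_diff_ops_le] by metis
    next
      case (Suc l)
      then show ?thesis using Cons.IH[of l] Cons.prems diff_ops_le_pd by auto
    qed
    then show ?case unfolding eq using m by (rule diff_ops_le_add)
  qed
  from assms show ?thesis
  proof (induction rule: diff_ops_le_induct)
    case (monomial a w)
    have "coord_commutator i (monomial_op a w) = op_mult a (coord_commutator i (foldr pd w))"
      by (simp add: coord_commutator_def monomial_op_def fun_eq_iff algebra_simps)
    then show ?case using diff_ops_le_mult[OF w[OF monomial], of a] by (simp only:)
  next
    case (add A B)
    show ?case unfolding coord_commutator_lin by (rule diff_ops_le_add[OF add.IH])
  qed
qed

text \<open>
  The functional \<open>A \<mapsto> A(1)(0)\<close>, which is invariant under linear vector fields.
\<close>

definition op_ev :: "'m::finite sf_op \<Rightarrow> real" where "op_ev A = sf_apply (A 1) 0"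

definition op_const :: "real \<Rightarrow> 'm::finite sf_op" where "op_const r = (\<lambda>f. r *\<^sub>R f)"

lemma op_ev_simps [simp]: "op_ev (A + B) = op_ev A + op_ev B" "op_ev (A - B) = op_ev A - op_ev B"
  "op_ev (r *\<^sub>R A) = r * op_ev A" "op_ev (- A) = - op_ev A" "op_ev 0 = 0" "op_ev (op_const r) = r"
  "op_ev (op_mult g A) = sf_apply g 0 * op_ev A"
  by (simp_all add: op_ev_def op_const_def)

lemma op_const_in: "op_const r \<in> diff_ops_le 0"
  unfolding diff_ops_0_iff by (intro exI[of _ "of_real r"]) (simp add: op_const_def scaleR_conv_of_real)

lemma op_const_lin: "op_const (r + s) = op_const r + op_const s" "op_const (r * s)
    = r *\<^sub>R op_const s" "op_const 0 = 0"
  by (auto simp: op_const_def fun_eq_iff algebra_simps)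

lemma radial_op_const: "radial (op_const r :: 'm::finite sf_op) = 0"
proof -
  have "(op_const r :: 'm sf_op) = monomial_op (of_real r) []"
    by (simp add: op_const_def monomial_op_def scaleR_conv_of_real)
  then have "radial (op_const r :: 'm sf_op) = monomial_op 0 []"
      by (simp only: radial_monomial pd_euler_const) simp
  then show ?thesis by (simp only: zero_eq_monomial)
qed

lemma op_ev_radial: "A \<in> diff_ops \<Longrightarrow> op_ev (radial A) = 0"
  by (simp add: op_ev_def radial_def euler_def diff_ops_linear)

lemma radial_kernel_0:
  assumes "A \<in> diff_ops_le 0" "radial A + real n *\<^sub>R A = 0"
  shows "A = (if n = 0 then op_const (op_ev A) else 0)"
proof -
  obtain a where a: "A = (\<lambda>f. a * f)" using assms(1) by (auto simp: diff_ops_0_iff)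
  then have "A = monomial_op a []" by (simp add: monomial_op_def)
  with assms(2) have "monomial_op (euler a) [] 1 + real n *\<^sub>R monomial_op a [] 1 = 0"
    by (simp add: radial_monomial fun_eq_iff)
  then have "euler a + real n *\<^sub>R a = 0" by (simp add: monomial_op_def)
  from euler_kernel[OF this] have "a = (if n = 0 then of_real (sf_apply a 0) else 0)" .
  then show ?thesis
    unfolding a by (cases "n = 0") (auto simp: op_const_def op_ev_def fun_eq_iff scaleR_conv_of_real)
qed

text \<open>
  By induction on the order: the commutators of \<open>A\<close> with the coordinates have smaller order and lie
  in the kernel for \<open>n + 1 > 0\<close>, so they vanish. Then \<open>A\<close> is a multiplication operator, and the
  kernel of \<open>x \<cdot> \<partial> + n\<close> on functions decides.
\<close>

lemma radial_kernel:
  assumes "A \<in> diff_ops" "radial A + real n *\<^sub>R A = 0"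
  shows "A = (if n = 0 then op_const (op_ev A) else 0)"
proof -
  obtain k where "A \<in> diff_ops_le k" using assms(1) by (auto simp: diff_ops_def)
  then show ?thesis using assms(2)
  proof (induction k arbitrary: A n)
    case 0
    then show ?case by (rule radial_kernel_0)
  next
    case (Suc k)
    then have A: "A \<in> diff_ops" using diff_ops_le_subset by blast
    have "coord_commutator i A = 0" for i
    proof -
      have "coord_commutator i (radial A + real n *\<^sub>R A) = 0"
        unfolding Suc.prems(2) by (simp add: coord_commutator_def fun_eq_iff)
      then have "radial (coord_commutator i A) + real (Suc n) *\<^sub>R coord_commutator i A = 0"
        by (simp add: coord_commutator_lin radial_coord_commutator[OF A] algebra_simps)
      from Suc.IH[OF coord_commutator_order[OF Suc.prems(1)] this]
      show ?thesis by (simp only: if_False nat.simps)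
    qed
    then have "A (coord i * f) = coord i * A f" for i f
      by (metis coord_commutator_def eq_iff_diff_eq_0 zero_fun_apply)
    then have "A f = A 1 * f" for f
      by (intro commutes_with_coords_imp_mult) (simp_all add: diff_ops_linear[OF A])
    then have "A = (\<lambda>f. A 1 * f)" by (rule ext)
    then have "A \<in> diff_ops_le 0" unfolding diff_ops_0_iff by blast
    then show ?case using Suc.prems(2) by (rule radial_kernel_0)
  qed
qed

text \<open>
  A monomial of positive order takes \<open>1\<close> to \<open>0\<close>, so nothing has to be subtracted from it.
\<close>

lemma radial_solve_monomial:
  "\<exists>g. radial (monomial_op g w) + real n *\<^sub>R monomial_op g w
     = (if n = 0 then monomial_op a w - op_const (op_ev (monomial_op a w)) else monomial_op a w)"
proof -
  obtain g where g: "euler g + real (length w + n) *\<^sub>R g = (if length w + n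
      = 0 then a - of_real (sf_apply a 0) else a)"
    using euler_solve by blast
  have "foldr pd w 1 = 0" if "w \<noteq> []" using that
      by (cases w rule: rev_cases) (auto simp: foldr_pd_lin intro: foldr_pd_lin(2)[of _ 0 0, simplified])
  then have "n = 0 \<Longrightarrow> w \<noteq> [] \<Longrightarrow> op_ev (monomial_op a w) = 0" by (simp add: op_ev_def monomial_op_def)
  moreover have "radial (monomial_op g w) + real n *\<^sub>R monomial_op g w
      = monomial_op (euler g + real (length w + n) *\<^sub>R g) w"
    by (simp add: radial_monomial fun_eq_iff) (simp add: monomial_op_def algebra_simps)
  ultimately have "radial (monomial_op g w) + real n *\<^sub>R monomial_op g w
     = (if n = 0 then monomial_op a w - op_const (op_ev (monomial_op a w)) else monomial_op a w)"
    unfolding g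
    by (cases "n = 0"; cases "w = []")
       (auto simp: monomial_op_def op_const_def op_ev_def fun_eq_iff scaleR_conv_of_real algebra_simps)
  then show ?thesis by blast
qed

context coeff_module begin

lemma W_const: "op_const r \<in> W"
  using W_cases op_const_in diff_ops_le_subset by blast

lemma radial_in_W: "A \<in> W \<Longrightarrow> radial A \<in> W"
  unfolding radial_eq_act[OF W_subset, of _ lam]
  by (intro subspace_diff[OF W_subspace] subspace_scale[OF W_subspace] subspace_sum[OF W_subspace] W_mult
    act_closed)

lemma W_induct [consumes 1, case_names monomial add]:
  assumes "A \<in> W" and "\<And>a w. (\<And>b. monomial_op b w \<in> W) \<Longrightarrow> P (monomial_op a w)"
    and "\<And>A B. A \<in> W \<Longrightarrow> B \<in> W \<Longrightarrow> P A \<Longrightarrow> P B \<Longrightarrow> P (A + B)"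
  shows "P A"
  using W_cases
proof
  assume W: "W = diff_ops_le 0"
  have "A \<in> diff_ops_le 0" using assms(1) W by simp
  then show ?thesis
  proof (induction rule: diff_ops_le_induct)
    case (monomial a w)
    then have "monomial_op b w \<in> W" for b using W monomial_op_in by blast
    then show ?case by (rule assms(2))
  next
    case (add A B)
    then show ?case using W assms(3) by blast
  qed
next
  assume W: "W = diff_ops"
  have "A \<in> diff_ops" using assms(1) W by simp
  then show ?thesis
  proof (induction rule: diff_ops_induct)
    case (monomial a w)
    have "monomial_op b w \<in> W" for b using W monomial_op_diff_ops by blast
    then show ?case by (rule assms(2))
  next
    case (add A B)
    then show ?case using W assms(3) by blast
  qed
qed

lemma radial_solve:
  "A \<in> W \<Longrightarrow> \<exists>B\<in>W. radial B + real n *\<^sub>R B = (if n = 0 then A - op_const (op_ev A) else A)"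
proof (induction rule: W_induct)
  case (monomial a w)
  then show ?case using radial_solve_monomial[of w n a] by blast
next
  case (add A A')
  then obtain B B' where "B \<in> W" "B' \<in> W" "radial B + real n *\<^sub>R B = (if n
      = 0 then A - op_const (op_ev A) else A)"
    "radial B' + real n *\<^sub>R B' = (if n = 0 then A' - op_const (op_ev A') else A')" by blast
  note B = this
  have "radial (B + B') + real n *\<^sub>R (B + B') = (radial B + real n *\<^sub>R B) + (radial B' + real n *\<^sub>R B')"
    by (simp only: radial_add scaleR_add_right add_ac)
  also have "\<dots> = (if n = 0 then (A + A') - op_const (op_ev (A + A')) else A + A')"
    unfolding B(3,4) by (simp only: op_ev_simps op_const_lin split: if_split) (simp add: algebra_simps)
  finally show ?case using subspace_add[OF W_subspace B(1,2)] by blast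
qed

text \<open>
  The normalization for \<open>n = 0\<close> makes the solution unique and hence an odd function of \<open>A\<close>; this is
  why solving for each coefficient of a cochain separately preserves skew symmetry.
\<close>

definition radial_sol :: "nat \<Rightarrow> 'm sf_op \<Rightarrow> 'm sf_op" where
  "radial_sol n A = (SOME B. B \<in> W \<and> radial B + real n *\<^sub>R B = (if n = 0 then A - op_const (op_ev A) else A)
     \<and> (n = 0 \<longrightarrow> op_ev B = 0))"

lemma radial_sol:
  assumes "A \<in> W"
  shows "radial_sol n A \<in> W"
    "radial (radial_sol n A) + real n *\<^sub>R radial_sol n A = (if n = 0 then A - op_const (op_ev A) else A)"
    "n = 0 \<Longrightarrow> op_ev (radial_sol n A) = 0"
proof -
  obtain B where B: "B \<in> W" "radial B + real n *\<^sub>R B = (if n = 0 then A - op_const (op_ev A) else A)"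
    using radial_solve[OF assms] by blast
  define B' where "B' = (if n = 0 then B - op_const (op_ev B) else B)"
  have "B' \<in> W \<and> radial B' + real n *\<^sub>R B' = (if n = 0 then A - op_const (op_ev A) else A) \<and> (n
      = 0 \<longrightarrow> op_ev B' = 0)"
    using B by (cases "n = 0") (simp_all add: B'_def subspace_diff[OF W_subspace] W_const linear_diff[OF
      linear_radial] radial_op_const)
  then have "radial_sol n A \<in> W \<and> radial (radial_sol n A) + real n *\<^sub>R radial_sol n A
      = (if n = 0 then A - op_const (op_ev A) else A) \<and> (n = 0 \<longrightarrow> op_ev (radial_sol n A) = 0)"
    unfolding radial_sol_def by (rule someI[where P = "\<lambda>B. B \<in> W \<and> radial B + real n *\<^sub>R B
      = (if n = 0 then A - op_const (op_ev A) else A) \<and> (n = 0 \<longrightarrow> op_ev B = 0)"])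
  then show "radial_sol n A \<in> W"
    "radial (radial_sol n A) + real n *\<^sub>R radial_sol n A = (if n = 0 then A - op_const (op_ev A) else A)"
    "n = 0 \<Longrightarrow> op_ev (radial_sol n A) = 0" by auto
qed

lemma radial_sol_unique:
  assumes "A \<in> W" "B \<in> W" "radial B + real n *\<^sub>R B = (if n = 0 then A - op_const (op_ev A) else A)"
    "n = 0 \<Longrightarrow> op_ev B = 0"
  shows "radial_sol n A = B"
proof -
  note s = radial_sol[OF assms(1), of n]
  have "radial (radial_sol n A - B) + real n *\<^sub>R (radial_sol n A - B) = 0"
    using s(2) assms(3) by (simp add: linear_diff[OF linear_radial] algebra_simps)
  from radial_kernel[OF _ this] have "radial_sol n A - B = (if n
      = 0 then op_const (op_ev (radial_sol n A - B)) else 0)"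
    using s(1) assms(2) by (meson W_subset W_subspace subspace_diff)
  then show ?thesis using s(3) assms(4) by (auto simp: op_const_lin split: if_splits)
qed

lemma radial_sol_minus: assumes "A \<in> W" shows "radial_sol n (- A) = - radial_sol n A"
proof (rule radial_sol_unique)
  note s = radial_sol[OF assms, of n]
  show "- A \<in> W" "- radial_sol n A \<in> W" using assms s(1) by (simp_all add: subspace_neg[OF W_subspace])
  show "n = 0 \<Longrightarrow> op_ev (- radial_sol n A) = 0" using s(3) by simp
  have "op_const (- r) = - (op_const r :: 'm sf_op)" for r by (simp add: op_const_def fun_eq_iff)
  then show "radial (- radial_sol n A) + real n *\<^sub>R (- radial_sol n A)
      = (if n = 0 then - A - op_const (op_ev (- A)) else - A)"
    using arg_cong[OF s(2), of uminus] by (simp add: linear_neg[OF linear_radial])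
qed

lemma radial_sol_0: "radial_sol n 0 = 0"
  by (rule radial_sol_unique) (simp_all add: subspace_0[OF W_subspace] linear_0[OF linear_radial] op_const_lin)

text \<open>
  Kernel and image of \<open>radial + n\<close> meet only in \<open>0\<close>: for \<open>n = 0\<close> the kernel consists of constants,
  and the image is annihilated by \<open>op_ev\<close>.
\<close>

lemma radial_kernel_twice:
  assumes "A \<in> W" "radial (radial A + real n *\<^sub>R A) + real n *\<^sub>R (radial A + real n *\<^sub>R A) = 0"
  shows "radial A + real n *\<^sub>R A = 0"
proof -
  let ?B = "radial A + real n *\<^sub>R A"
  have "?B \<in> W" using assms(1) by (intro subspace_add[OF W_subspace] subspace_scale[OF W_subspace] radial_in_W)
  from radial_kernel[OF W_subset[OF this] assms(2)] show ?thesis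
    using op_ev_radial[OF W_subset[OF assms(1)]] by (cases "n = 0") (auto simp: op_const_lin)
qed

end

section \<open>The radial homotopy on cochains\<close>

lemma op_mult_lin: "op_mult (f + g) A = op_mult f A + op_mult g A" "op_mult (f - g) A
    = op_mult f A - op_mult g A"
  "op_mult (r *\<^sub>R g) A = r *\<^sub>R op_mult g A" "op_mult 0 A = 0" "op_mult (- g) A = - op_mult g A"
  "op_mult f (A + B) = op_mult f A + op_mult f B" "op_mult f (A - B) = op_mult f A - op_mult f B"
  "op_mult f (r *\<^sub>R A) = r *\<^sub>R op_mult f A" "op_mult f 0 = 0" "op_mult f (- A) = - op_mult f A"
  "op_mult f (op_mult g A) = op_mult (f * g) A" "op_mult (of_real r) A = r *\<^sub>R A" "op_mult 1 A = A"
  by (auto simp: fun_eq_iff algebra_simps scaleR_conv_of_real)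

lemma op_mult_sum_left: "op_mult (\<Sum>a\<in>S. F a) A = (\<Sum>a\<in>S. op_mult (F a) A)"
  by (induction S rule: infinite_finite_induct) (simp_all only: sum.infinite sum.empty sum.insert
    op_mult_lin simp_thms)

lemma op_mult_sum_right: "op_mult f (\<Sum>a\<in>S. A a) = (\<Sum>a\<in>S. op_mult f (A a))"
  by (induction S rule: infinite_finite_induct) (simp_all only: sum.infinite sum.empty sum.insert
    op_mult_lin simp_thms)

text \<open>
  The sum of \<open>frame I\<^sub>1 p\<^sub>1 \<cdots> frame I\<^sub>u p\<^sub>u a(I)\<close> over all words \<open>I\<close>.
\<close>

primrec of_coeffs :: "('m::finite sl_index list \<Rightarrow> 'm sf_op) \<Rightarrow> 'm sl_vec list \<Rightarrow> 'm sf_op" where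
  "of_coeffs a [] = a []"
| "of_coeffs a (p # ps) = (\<Sum>b\<in>UNIV. op_mult (frame b p) (of_coeffs (\<lambda>I. a (b # I)) ps))"

lemma of_coeffs_add: "of_coeffs (\<lambda>I. a I + a' I) ps = of_coeffs a ps + of_coeffs a' ps"
  by (induction ps arbitrary: a a') (simp_all only: of_coeffs.simps op_mult_lin sum.distrib)

lemma of_coeffs_mult: "of_coeffs (\<lambda>I. op_mult g (a I)) ps = op_mult g (of_coeffs a ps)"
proof (induction ps arbitrary: a)
  case (Cons p ps)
  then show ?case by (simp only: of_coeffs.simps op_mult_sum_right op_mult_lin mult.commute[of g])
qed (simp only: of_coeffs.simps)

lemma of_coeffs_scale: "of_coeffs (\<lambda>I. r *\<^sub>R a I) ps = r *\<^sub>R of_coeffs a ps"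
  using of_coeffs_mult[of "of_real r" a ps] by (simp only: op_mult_lin)

lemma of_coeffs_minus: "of_coeffs (\<lambda>I. - a I) ps = - of_coeffs a ps"
  using of_coeffs_scale[of "-1" a ps] by (simp only: scaleR_minus1_left)

lemma of_coeffs_zero: "of_coeffs (\<lambda>I. 0) ps = 0"
  using of_coeffs_scale[of 0 "\<lambda>I. 0" ps] by (simp only: scaleR_zero_left scaleR_zero_right)

lemma of_coeffs_sum: "of_coeffs (\<lambda>I. \<Sum>e\<in>S. f e I) ps = (\<Sum>e\<in>S. of_coeffs (f e) ps)"
  by (induction S rule: infinite_finite_induct) (simp_all only: sum.infinite sum.empty sum.insert
    of_coeffs_zero of_coeffs_add simp_thms)

lemma of_coeffs_Cons: "of_coeffs a (p # ps) = of_coeffs (\<lambda>I. \<Sum>b\<in>UNIV. op_mult (frame b p) (a (b # I))) ps"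
  by (simp only: of_coeffs.simps of_coeffs_sum of_coeffs_mult)

lemma skew_of_coeffs: assumes "skew a" shows "skew (of_coeffs a)"
proof -
  have "of_coeffs a (ps @ x # y # qs) = - of_coeffs a (ps @ y # x # qs)" for ps x y qs
    using assms
  proof (induction ps arbitrary: a)
    case Nil
    have sw: "of_coeffs (\<lambda>I. a (b # e # I)) qs = - of_coeffs (\<lambda>I. a (e # b # I)) qs" for b e
      unfolding of_coeffs_minus[symmetric] by (subst skew_hd[OF Nil]) (rule refl)
    have "of_coeffs a (x # y # qs) = (\<Sum>b\<in>UNIV. \<Sum>e\<in>UNIV. op_mult (frame b x * frame e y) (of_coeffs (\<lambda>I. a (b
        # e # I)) qs))" for x y
      by (simp only: of_coeffs.simps op_mult_sum_right op_mult_lin)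
    note ex = this
    have "of_coeffs a (x # y # qs) = (\<Sum>e\<in>UNIV. \<Sum>b\<in>UNIV. op_mult (frame b x * frame e y) (of_coeffs (\<lambda>I. a (b
        # e # I)) qs))"
      unfolding ex by (rule sum.swap)
    also have "\<dots> = (\<Sum>e\<in>UNIV. \<Sum>b\<in>UNIV. - op_mult (frame e y * frame b x) (of_coeffs (\<lambda>I. a (e # b # I)) qs))"
      by (intro sum.cong refl) (subst sw, simp only: op_mult_lin mult.commute)
    also have "\<dots> = - of_coeffs a (y # x # qs)" unfolding ex by (simp only: sum_negf)
    finally show ?case by (simp only: append_Nil)
  next
    case (Cons p ps)
    have "of_coeffs (\<lambda>I. a (b # I)) (ps @ x # y # qs) = - of_coeffs (\<lambda>I. a (b # I)) (ps @ y # x # qs)" for b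
      by (rule Cons.IH[OF skew_Cons[OF Cons.prems]])
    then show ?case by (simp only: of_coeffs.simps append_Cons op_mult_lin sum_negf)
  qed
  then show ?thesis unfolding skew_def by blast
qed

lemma of_degree_of_coeffs: "of_degree u a \<Longrightarrow> of_degree u (of_coeffs a)"
proof -
  have "of_coeffs a ps = 0" if "\<And>I. length I = length ps \<Longrightarrow> a I = 0"
      for a :: "'a sl_index list \<Rightarrow> 'a sf_op" and ps
    using that
  proof (induction ps arbitrary: a)
    case (Cons p ps)
    have "of_coeffs (\<lambda>I. a (b # I)) ps = 0" for b by (rule Cons.IH) (simp add: Cons.prems)
    then show ?case by (simp only: of_coeffs.simps op_mult_lin sum.neutral_const)
  qed (simp only: of_coeffs.simps list.size)
  then show "of_degree u a \<Longrightarrow> ?thesis" by (simp add: of_degree_def)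
qed

text \<open>
  At a point \<open>x\<close>, evaluate at vectors whose Taylor coefficients at \<open>x\<close> are those of a unit vector.
\<close>

lemma of_coeffs_unique:
  fixes a :: "'m::finite sl_index list \<Rightarrow> 'm sf_op"
  assumes "\<And>ps. of_coeffs a ps = 0" shows "a I = 0"
proof -
  have "sf_apply (a I g) x = 0" for g x
  proof -
    have "\<forall>b :: 'm sl_index. \<exists>p. \<forall>e. sf_apply (frame e p) x = (if e = b then 1 else 0)"
        by (intro allI) (rule frame_surj)
    then have "\<exists>P. \<forall>(b :: 'm sl_index) e. sf_apply (frame e (P b)) x = (if e = b then 1 else 0)"
        by (rule choice)
    then obtain P where P: "\<And>(b :: 'm sl_index) e. sf_apply (frame e (P b)) x = (if e = b then 1 else 0)"
        by blast
    have "sf_apply (of_coeffs a (map P I) g) x = sf_apply (a I g) x"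
    proof (induction I arbitrary: a)
      case (Cons b I)
      have "sf_apply (of_coeffs a (map P (b # I)) g) x
          = (\<Sum>e\<in>UNIV. if e = b then sf_apply (of_coeffs (\<lambda>I. a (e # I)) (map P I) g) x else 0)"
        by (simp add: sum_fun_apply P if_distrib[where f = "\<lambda>x. x * _"] cong: if_cong)
      then show ?case using Cons.IH[of "\<lambda>I. a (b # I)"] by simp
    qed simp
    then show ?thesis using assms by (metis sf_simps(1) zero_fun_apply)
  qed
  then have "a I g = 0" for g by (intro sf_eqI) simp
  then show ?thesis by (intro ext) (simp only: zero_fun_apply)
qed

text \<open>
  Recursion over the first argument, with a matrix \<open>N\<close> that inverts the Taylor coefficients on the
  basis vectors.
\<close>

primrec coeffs :: "('m sl_index \<Rightarrow> 'm sl_index \<Rightarrow> 'm::finite smooth_fun) \<Rightarrow>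
    ('m sl_vec list \<Rightarrow> 'm sf_op) \<Rightarrow> 'm sl_index list \<Rightarrow> 'm sf_op" where
  "coeffs N c [] = c []"
| "coeffs N c (b # I) = (\<Sum>e\<in>UNIV. op_mult (N b e) (coeffs N (\<lambda>zs. c (axis e 1 # zs)) I))"

lemma multilinear_expand_axis:
  fixes c :: "(real ^ 'n::finite) list \<Rightarrow> 'w::real_vector"
  assumes "multilinear W c"
  shows "c (p # ps) = (\<Sum>e\<in>UNIV. (p $ e) *\<^sub>R c (axis e 1 # ps))"
proof -
  have "c ((\<Sum>e\<in>S. (p $ e) *\<^sub>R axis e 1) # ps) = (\<Sum>e\<in>S. (p $ e) *\<^sub>R c (axis e 1 # ps))" for S
    by (induction S rule: infinite_finite_induct) (simp_all add: multilinear_hd[OF assms])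
  from this[of UNIV] show ?thesis
    using basis_expansion[of p] by (simp add: scalar_mult_eq_scaleR)
qed

lemma of_coeffs_coeffs:
  assumes N: "\<And>p b. of_real (p $ b) = (\<Sum>e\<in>UNIV. frame e p * N e b)" and "multilinear W c"
  shows "of_coeffs (coeffs N c) ps = c ps"
  using assms(2)
proof (induction ps arbitrary: c)
  case (Cons p ps)
  have "c (p # ps) = (\<Sum>e\<in>UNIV. op_mult (of_real (p $ e)) (c (axis e 1 # ps)))"
    by (subst multilinear_expand_axis[OF Cons.prems]) (simp only: op_mult_lin)
  also have "\<dots> = (\<Sum>e\<in>UNIV. \<Sum>b\<in>UNIV. op_mult (frame b p) (op_mult (N b e) (c (axis e 1 # ps))))"
    by (simp only: N op_mult_sum_left op_mult_lin)
  also have "\<dots> = (\<Sum>b\<in>UNIV. \<Sum>e\<in>UNIV. op_mult (frame b p) (op_mult (N b e) (c (axis e 1 # ps))))"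
    by (rule sum.swap)
  also have "\<dots> = of_coeffs (coeffs N c) (p # ps)"
    by (simp only: of_coeffs.simps coeffs.simps of_coeffs_sum of_coeffs_mult op_mult_sum_right Cons.IH[OF
      multilinear_Cons[OF Cons.prems]])
  finally show ?case by (rule sym)
qed simp

lemma coeffs_minus: "coeffs N (\<lambda>zs. - c zs) I = - coeffs N c I"
  by (induction I arbitrary: c) (simp_all only: coeffs.simps op_mult_lin sum_negf)

lemma skew_coeffs: assumes "skew c" shows "skew (coeffs N c)"
proof -
  have "coeffs N c (I @ b # e # J) = - coeffs N c (I @ e # b # J)" for I b e J
    using assms
  proof (induction I arbitrary: c)
    case Nil
    let ?c = "\<lambda>k l. coeffs N (\<lambda>zs. c (axis k 1 # axis l 1 # zs)) J"
    have sw: "?c k l = - ?c l k" for k l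
      unfolding coeffs_minus[symmetric] by (subst skew_hd[OF Nil]) (rule refl)
    have ex: "coeffs N c (b # e # J) = (\<Sum>k\<in>UNIV. \<Sum>l\<in>UNIV. op_mult (N b k * N e l) (?c k l))" for b e
      by (simp only: coeffs.simps op_mult_sum_right op_mult_lin)
    have "coeffs N c (b # e # J) = (\<Sum>l\<in>UNIV. \<Sum>k\<in>UNIV. op_mult (N b k * N e l) (?c k l))"
      unfolding ex by (rule sum.swap)
    also have "\<dots> = (\<Sum>l\<in>UNIV. \<Sum>k\<in>UNIV. - op_mult (N e l * N b k) (?c l k))"
      by (intro sum.cong refl) (subst sw, simp only: op_mult_lin mult.commute)
    also have "\<dots> = - coeffs N c (e # b # J)" unfolding ex by (simp only: sum_negf)
    finally show ?case by (simp only: append_Nil)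
  next
    case (Cons i I)
    have "coeffs N (\<lambda>zs. c (axis k 1 # zs)) (I @ b # e # J)
        = - coeffs N (\<lambda>zs. c (axis k 1 # zs)) (I @ e # b # J)" for k
      by (rule Cons.IH[OF skew_Cons[OF Cons.prems]])
    then show ?case by (simp only: coeffs.simps append_Cons op_mult_lin sum_negf)
  qed
  then show ?thesis unfolding skew_def by blast
qed

lemma of_degree_coeffs: "of_degree u c \<Longrightarrow> of_degree u (coeffs N c)"
proof -
  have "coeffs N c I = 0" if "\<And>ps. length ps = length I \<Longrightarrow> c ps = 0" for c I
    using that
  proof (induction I arbitrary: c)
    case (Cons b I)
    have "coeffs N (\<lambda>zs. c (axis e 1 # zs)) I = 0" for e by (rule Cons.IH) (simp add: Cons.prems)
    then show ?case by (simp only: coeffs.simps op_mult_lin sum.neutral_const)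
  qed (simp only: coeffs.simps list.size)
  then show "of_degree u c \<Longrightarrow> ?thesis" by (simp add: of_degree_def)
qed

abbreviation total_weight :: "'m::finite sl_index list \<Rightarrow> nat" where
  "total_weight I \<equiv> sum_list (map weight I)"

definition frame_bracket :: "'m::finite sl_index \<Rightarrow> 'm sl_vec \<Rightarrow> 'm smooth_fun" where
  "frame_bracket b p = 2 *\<^sub>R (\<Sum>k\<in>UNIV. coord k * frame b (sl_br (trans_vec k) p))
     - frame b (sl_br euler_vec p) - 2 *\<^sub>R (\<Sum>k\<in>UNIV. proj_field p $ k * frame b (trans_vec k))"

text \<open>
  The Lie derivative along the section \<open>s\<close>. The subtracted term is the value of the cochain at the
  bracket of \<open>s\<close> with \<open>p\<close>, expanded linearly over the functions.
\<close>

fun radial_lie :: "('m::finite sl_vec list \<Rightarrow> 'm sf_op) \<Rightarrow> 'm sl_vec list \<Rightarrow> 'm sf_op" where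
  "radial_lie c [] = radial (c [])"
| "radial_lie c (p # ps) = radial_lie (\<lambda>zs. c (p # zs)) ps
    - (2 *\<^sub>R (\<Sum>k\<in>UNIV. op_mult (coord k) (c (sl_br (trans_vec k) p # ps)))
       - c (sl_br euler_vec p # ps) - 2 *\<^sub>R (\<Sum>k\<in>UNIV. op_mult (proj_field p $ k) (c (trans_vec k # ps))))"

lemma radial_sum: "radial (\<Sum>a\<in>S. A a) = (\<Sum>a\<in>S. radial (A a))"
  by (rule linear_sum[OF linear_radial])

text \<open>
  The Lie derivative along \<open>s\<close> is a derivation of the products in \<open>of_coeffs\<close>, and each factor is
  an eigenvector by \<open>frame_weight\<close>.
\<close>

lemma radial_lie_of_coeffs:
  assumes "\<And>I. a I \<in> diff_ops"
  shows "radial_lie (of_coeffs a) ps = of_coeffs (\<lambda>I. radial (a I) + real (total_weight I) *\<^sub>R a I) ps"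
  using assms
proof (induction ps arbitrary: a)
  case Nil
  show ?case by simp
next
  case (Cons p ps)
  let ?a = "\<lambda>I. \<Sum>b\<in>UNIV. op_mult (frame b p) (a (b # I))"
  let ?P = "\<lambda>b. of_coeffs (\<lambda>I. a (b # I)) ps"
  have "radial_lie (\<lambda>zs. of_coeffs a (p # zs)) ps = radial_lie (of_coeffs ?a) ps" by (simp only: of_coeffs_Cons)
  also have "\<dots> = of_coeffs (\<lambda>I. radial (?a I) + real (total_weight I) *\<^sub>R ?a I) ps"
    by (rule Cons.IH) (intro subspace_sum[OF subspace_diff_ops] diff_ops_mult Cons.prems)
  also have "\<dots> = (\<Sum>b\<in>UNIV. op_mult (euler (frame b p)) (?P b)
      + op_mult (frame b p) (of_coeffs (\<lambda>I. radial (a (b # I)) + real (total_weight I) *\<^sub>R a (b # I)) ps))"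
  proof -
    have "radial (?a I) + real (total_weight I) *\<^sub>R ?a I = (\<Sum>b\<in>UNIV. op_mult (euler (frame b p)) (a (b # I))
        + op_mult (frame b p) (radial (a (b # I)) + real (total_weight I) *\<^sub>R a (b # I)))" for I
      by (simp only: radial_sum radial_mult scaleR_sum_right sum.distrib[symmetric]
          op_mult_lin(6,8) add.assoc)
    then show ?thesis by (simp only: of_coeffs_sum of_coeffs_add of_coeffs_mult)
  qed
  finally have 1: "radial_lie (\<lambda>zs. of_coeffs a (p # zs)) ps = \<dots>" .
  have 2: "2 *\<^sub>R (\<Sum>k\<in>UNIV. op_mult (coord k) (of_coeffs a (sl_br (trans_vec k) p # ps)))
       - of_coeffs a (sl_br euler_vec p # ps)
           - 2 *\<^sub>R (\<Sum>k\<in>UNIV. op_mult (proj_field p $ k) (of_coeffs a (trans_vec k # ps)))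
     = (\<Sum>b\<in>UNIV. op_mult (frame_bracket b p) (?P b))"
  proof -
    have sw: "(\<Sum>k\<in>UNIV. op_mult (g k) (of_coeffs a (q k # ps)))
        = (\<Sum>b\<in>UNIV. op_mult (\<Sum>k\<in>UNIV. g k * frame b (q k)) (?P b))" for g q
      by (simp only: of_coeffs.simps op_mult_sum_right op_mult_sum_left op_mult_lin) (rule sum.swap)
    show ?thesis
      unfolding sw by (simp only: of_coeffs.simps frame_bracket_def op_mult_lin sum_subtractf
          scaleR_sum_right[symmetric])
  qed
  have "op_mult (euler (frame b p)) (?P b)
      + op_mult (frame b p) (of_coeffs (\<lambda>I. radial (a (b # I)) + real (total_weight I) *\<^sub>R a (b # I)) ps)
      - op_mult (frame_bracket b p) (?P b)
    = op_mult (frame b p) (of_coeffs (\<lambda>I. radial (a (b # I))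
        + real (total_weight (b # I)) *\<^sub>R a (b # I)) ps)" for b
  proof -
    have "op_mult (euler (frame b p)) (?P b) - op_mult (frame_bracket b p) (?P b)
        = op_mult (euler (frame b p) - frame_bracket b p) (?P b)" by (simp only: op_mult_lin)
    also have "\<dots> = op_mult (frame b p) (of_coeffs (\<lambda>I. real (weight b) *\<^sub>R a (b # I)) ps)"
      unfolding frame_bracket_def frame_weight by (simp only: op_mult_lin of_coeffs_scale)
    finally have "op_mult (euler (frame b p)) (?P b)
      + op_mult (frame b p) (of_coeffs (\<lambda>I. radial (a (b # I)) + real (total_weight I) *\<^sub>R a (b # I)) ps)
      - op_mult (frame_bracket b p) (?P b)
      = op_mult (frame b p) (of_coeffs (\<lambda>I. radial (a (b # I)) + real (total_weight I) *\<^sub>R a (b # I)) ps)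
       + op_mult (frame b p) (of_coeffs (\<lambda>I. real (weight b) *\<^sub>R a (b # I)) ps)"
      by (simp only: algebra_simps)
    also have "\<dots> = op_mult (frame b p) (of_coeffs (\<lambda>I. (radial (a (b # I))
        + real (total_weight I) *\<^sub>R a (b # I))
        + real (weight b) *\<^sub>R a (b # I)) ps)"
      by (simp only: op_mult_lin of_coeffs_add)
    also have "(\<lambda>I. (radial (a (b # I)) + real (total_weight I) *\<^sub>R a (b # I)) + real (weight b) *\<^sub>R a (b # I))
        = (\<lambda>I. radial (a (b # I)) + real (total_weight (b # I)) *\<^sub>R a (b # I))"
      by (rule ext) (simp only: list.map sum_list.Cons of_nat_add scaleR_add_left add_ac)
    finally show ?thesis .
  qed
  then show ?case
    unfolding radial_lie.simps 1 2 by (simp only: sum_subtractf[symmetric] of_coeffs.simps)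
qed

text \<open>
  The sum over the positions \<open>i\<close> of \<open>p\<^sub>i\<^sup>k\<close>, the \<open>k\<close>-th component of the field with coordinates
  \<open>p\<^sub>i\<close>, times \<open>c\<close> with its \<open>i\<close>-th argument replaced by \<open>\<partial>\<^sub>k\<close>. For skew \<open>c\<close> this is the exterior
  product of \<open>d x\<^sup>k\<close> with the contraction of \<open>c\<close> by \<open>\<partial>\<^sub>k\<close>.
\<close>

fun euler_wedge :: "'m::finite \<Rightarrow> ('m sl_vec list \<Rightarrow> 'm sf_op) \<Rightarrow> 'm sl_vec list \<Rightarrow> 'm sf_op" where
  "euler_wedge k c [] = 0"
| "euler_wedge k c (p # ps) = op_mult (proj_field p $ k) (c (trans_vec k # ps))
    + euler_wedge k (\<lambda>zs. c (p # zs)) ps"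

text \<open>
  The exterior product of \<open>d g\<close> with \<open>c\<close>.
\<close>

fun wedge :: "'m::finite smooth_fun \<Rightarrow> ('m sl_vec list \<Rightarrow> 'm sf_op) \<Rightarrow> 'm sl_vec list \<Rightarrow> 'm sf_op" where
  "wedge g c [] = 0"
| "wedge g c (p # ps) = op_mult (vf_apply (proj_field p) g) (c ps) - wedge g (\<lambda>zs. c (p # zs)) ps"

lemma wedge_minus: "wedge g (\<lambda>zs. - c zs) ps = - wedge g c ps"
  by (induction ps arbitrary: c) (simp_all only: wedge.simps op_mult_lin minus_zero, simp)

lemma wedge_coord:
  assumes "skew c" shows "wedge (coord k) (\<lambda>zs. c (trans_vec k # zs)) ps = euler_wedge k c ps"
  using assms
proof (induction ps arbitrary: c)
  case (Cons p ps)
  have "wedge (coord k) (\<lambda>zs. c (trans_vec k # p # zs)) ps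
      = - wedge (coord k) (\<lambda>zs. c (p # trans_vec k # zs)) ps"
    unfolding wedge_minus[symmetric] by (subst skew_hd[OF Cons.prems]) (rule refl)
  then show ?case
    using Cons.IH[OF skew_Cons[OF Cons.prems], of p]
      by (simp only: wedge.simps euler_wedge.simps vf_apply_simps) simp
qed simp

text \<open>
  The contraction with the section \<open>s\<close>.
\<close>

definition radial_insert :: "('m::finite sl_vec list \<Rightarrow> 'm sf_op) \<Rightarrow> 'm sl_vec list \<Rightarrow> 'm sf_op" where
  "radial_insert c ps = 2 *\<^sub>R (\<Sum>k\<in>UNIV. op_mult (coord k) (c (trans_vec k # ps))) - c (euler_vec # ps)"

lemma multilinear_scaled: "subspace W \<Longrightarrow> multilinear W c \<Longrightarrow> multilinear W (\<lambda>xs. r *\<^sub>R c xs)"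
  by (rule multilinear_lincomb(3))

lemma skew_scaled: "skew c \<Longrightarrow> skew (\<lambda>xs. r *\<^sub>R c xs)"
  by (rule skew_lincomb(3))

lemma skew_sum: "(\<And>k. skew (f k)) \<Longrightarrow> skew (\<lambda>zs. \<Sum>k\<in>S. f k zs)"
proof (induction S rule: infinite_finite_induct)
  case (insert x F)
  then show ?case using skew_lincomb(1)[of "f x" "\<lambda>zs. \<Sum>k\<in>F. f k zs"]
    by (simp only: sum.insert simp_thms)
qed (simp_all add: skew_def)

lemma skew_op_mult: "skew c \<Longrightarrow> skew (\<lambda>zs. op_mult g (c zs))"
  unfolding skew_def by (metis op_mult_lin(10))

lemma skew_radial_insert: "skew c \<Longrightarrow> skew (radial_insert c)"
  unfolding radial_insert_def[abs_def]
  by (intro skew_lincomb(2) skew_scaled skew_sum skew_op_mult skew_Cons)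

lemma of_degree_radial_insert: "of_degree (Suc u) c \<Longrightarrow> of_degree u (radial_insert c)"
  by (simp add: of_degree_def radial_insert_def op_mult_lin)

lemma of_degree_radial_insert_0: "of_degree 0 c \<Longrightarrow> radial_insert c ps = 0"
  by (simp add: of_degree_def radial_insert_def op_mult_lin)

context coeff_module begin

lemma multilinear_sum: "(\<And>k. ml (f k)) \<Longrightarrow> ml (\<lambda>zs. \<Sum>k\<in>S. f k zs)"
proof (induction S rule: infinite_finite_induct)
  case (insert x F)
  then show ?case using multilinear_lincomb(1)[OF W, of "f x" "\<lambda>zs. \<Sum>k\<in>F. f k zs"]
    by (simp only: sum.insert simp_thms)
qed (simp_all only: multilinear_zero[OF W] sum.infinite sum.empty simp_thms)

lemma d_zero: "d (\<lambda>zs. 0) ps = 0"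
  by (rule d_eq_0) simp

lemma d_sum: "(\<And>k. ml (f k)) \<Longrightarrow> d (\<lambda>zs. \<Sum>k\<in>S. f k zs) ps = (\<Sum>k\<in>S. d (f k) ps)"
proof (induction S rule: infinite_finite_induct)
  case (insert x F)
  then show ?case using d_add[of "f x" "\<lambda>zs. \<Sum>k\<in>F. f k zs" ps]
    by (simp only: sum.insert simp_thms multilinear_sum)
qed (simp_all only: d_zero sum.infinite sum.empty simp_thms)

lemma multilinear_op_mult: "ml c \<Longrightarrow> ml (\<lambda>zs. op_mult g (c zs))"
  unfolding multilinear_def by (auto simp: op_mult_lin W_mult)

lemma multilinear_radial_insert: assumes "ml c" shows "ml (radial_insert c)"
  unfolding radial_insert_def[abs_def]
  by (intro multilinear_lincomb(2)[OF W] multilinear_scaled[OF W] multilinear_sum multilinear_op_mult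
      multilinear_Cons assms)

lemma multilinear_of_coeffs: assumes "\<And>I. a I \<in> W" shows "ml (of_coeffs a)"
proof -
  have "of_coeffs a ps \<in> W" for ps
    using assms
  proof (induction ps arbitrary: a)
    case (Cons p ps)
    have "of_coeffs (\<lambda>I. a (b # I)) ps \<in> W" for b by (rule Cons.IH[OF Cons.prems])
    then show ?case unfolding of_coeffs.simps by (intro subspace_sum[OF W] W_mult)
  qed (simp only: of_coeffs.simps)
  moreover have "of_coeffs a (ps @ (x + y) # qs) = of_coeffs a (ps @ x # qs) + of_coeffs a (ps @ y # qs)"
      for ps x y qs
    by (induction ps arbitrary: a) (simp_all only: append_Nil append_Cons of_coeffs.simps frame_lin
      op_mult_lin sum.distrib)
  moreover have "of_coeffs a (ps @ (r *\<^sub>R x) # qs) = r *\<^sub>R of_coeffs a (ps @ x # qs)" for ps r x qs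
    by (induction ps arbitrary: a) (simp_all only: append_Nil append_Cons of_coeffs.simps frame_lin
      op_mult_lin scaleR_sum_right)
  ultimately show ?thesis by (simp add: multilinear_def)
qed

lemma coeffs_in: "ml c \<Longrightarrow> coeffs N c I \<in> W"
proof (induction I arbitrary: c)
  case (Cons b I)
  have "coeffs N (\<lambda>zs. c (axis e 1 # zs)) I \<in> W" for e
    by (rule Cons.IH[OF multilinear_Cons[OF Cons.prems]])
  then show ?case unfolding coeffs.simps by (intro subspace_sum[OF W] W_mult)
qed (simp add: multilinear_in)

lemma coefficients:
  assumes "ml c"
  obtains a where "\<And>I. a I \<in> W" "c = of_coeffs a" "skew c \<Longrightarrow> skew a" "\<And>u. of_degree u c \<Longrightarrow> of_degree u a"
proof -
  obtain N :: "'m sl_index \<Rightarrow> 'm sl_index \<Rightarrow> 'm smooth_fun"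
    where N: "\<And>p b. of_real (p $ b) = (\<Sum>e\<in>UNIV. frame e p * N e b)"
    by (rule frame_expansion, rule that)
  have "c = of_coeffs (coeffs N c)" by (rule ext) (rule of_coeffs_coeffs[OF N assms, symmetric])
  then show ?thesis
    using that[of "coeffs N c"] coeffs_in[OF assms] skew_coeffs of_degree_coeffs by blast
qed

lemma Lie_op_mult:
  "ml c \<Longrightarrow> Lie p (\<lambda>zs. op_mult g (c zs)) ps = op_mult (vf_apply (proj_field p) g) (c ps)
      + op_mult g (Lie p c ps)"
proof (induction ps arbitrary: c)
  case (Cons q qs)
  show ?case
    using Cons.IH[OF multilinear_Cons[OF Cons.prems], of q]
      by (simp only: cochain_lie.simps op_mult_lin add_diff_eq)
qed (simp only: cochain_lie.simps sl_act_mult)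

lemma d_op_mult: "ml c \<Longrightarrow> d (\<lambda>zs. op_mult g (c zs)) ps = op_mult g (d c ps) + wedge g c ps"
proof (induction ps arbitrary: c)
  case (Cons p ps)
  show ?case
    using Cons.IH[OF multilinear_Cons[OF Cons.prems], of p]
    by (simp only: cochain_d.simps wedge.simps Lie_op_mult[OF Cons.prems] op_mult_lin)
       (simp only: algebra_simps)
qed (simp only: cochain_d.simps wedge.simps op_mult_lin add_0)

lemma radial_lie_eq:
  "ml c \<Longrightarrow> radial_lie c ps = 2 *\<^sub>R (\<Sum>k\<in>UNIV. op_mult (coord k) (Lie (trans_vec k) c ps)) - Lie euler_vec c ps
     + 2 *\<^sub>R (\<Sum>k\<in>UNIV. euler_wedge k c ps)"
proof (induction ps arbitrary: c)
  case Nil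
  show ?case
    by (simp only: radial_lie.simps cochain_lie.simps euler_wedge.simps sum.neutral_const scaleR_zero_right
        add_0_right radial_eq_act[OF W_subset[OF multilinear_in[OF Nil]], where lam = lam])
next
  case (Cons p ps)
  show ?case
    using Cons.IH[OF multilinear_Cons[OF Cons.prems], of p]
    by (simp only: radial_lie.simps cochain_lie.simps euler_wedge.simps op_mult_lin sum.distrib sum_subtractf
        scaleR_add_right scaleR_diff_right) (simp only: algebra_simps)
qed

text \<open>
  Cartan's formula for the constant sections \<open>\<partial>\<^sub>k\<close> and \<open>E\<close>; the function factors \<open>x\<^sup>k\<close> contribute
  exterior products with \<open>d x\<^sup>k\<close>.
\<close>

theorem radial_homotopy:
  assumes "ml c" "skew c"
  shows "radial_lie c ps = d (radial_insert c) ps + radial_insert (d c) ps"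
proof -
  note m = multilinear_Cons[OF assms(1)]
  have "d (radial_insert c) ps = 2 *\<^sub>R (\<Sum>k\<in>UNIV. d (\<lambda>zs. op_mult (coord k) (c (trans_vec k # zs))) ps)
      - d (\<lambda>zs. c (euler_vec # zs)) ps"
    unfolding radial_insert_def[abs_def]
    by (subst d_diff, (intro multilinear_scaled[OF W] multilinear_sum multilinear_op_mult m)+,
        subst d_scale, (intro multilinear_sum multilinear_op_mult m)+, subst d_sum, (intro
            multilinear_op_mult m)+, rule refl)
  also have "\<dots> = 2 *\<^sub>R (\<Sum>k\<in>UNIV. op_mult (coord k) (d (\<lambda>zs. c (trans_vec k # zs)) ps) + euler_wedge k c ps)
      - d (\<lambda>zs. c (euler_vec # zs)) ps"
    by (simp only: d_op_mult[OF m] wedge_coord[OF assms(2)])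
  finally show ?thesis
    unfolding radial_lie_eq[OF assms(1)]
    by (simp only: radial_insert_def cochain_d.simps op_mult_lin sum.distrib sum_subtractf
        scaleR_add_right scaleR_diff_right) (simp only: algebra_simps)
qed

lemma radial_lie_alt:
  assumes "ml c" "skew c"
  shows "ml (radial_lie c)" "skew (radial_lie c)"
proof -
  have e: "radial_lie c = (\<lambda>ps. d (radial_insert c) ps + radial_insert (d c) ps)"
    by (rule ext) (rule radial_homotopy[OF assms])
  show "ml (radial_lie c)" unfolding e
    by (intro multilinear_lincomb(1)[OF W] multilinear_d multilinear_radial_insert assms)
  show "skew (radial_lie c)" unfolding e
    by (intro skew_lincomb(1) skew_d skew_radial_insert multilinear_d multilinear_radial_insert assms)
qed

lemma d_radial_lie:
  assumes "ml c" "skew c" shows "d (radial_lie c) ps = radial_lie (d c) ps"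
proof -
  have e: "radial_lie c = (\<lambda>ps. d (radial_insert c) ps + radial_insert (d c) ps)"
    by (rule ext) (rule radial_homotopy[OF assms])
  note m = multilinear_radial_insert[OF assms(1)] multilinear_d[OF assms(1)]
  have "d (radial_lie c) ps = d (radial_insert (d c)) ps"
    unfolding e using m by (simp add: d_add multilinear_d multilinear_radial_insert d_d)
  moreover have "d (d c) = (\<lambda>ps. 0)" using d_d[OF assms(1)] by blast
  then have "radial_insert (d (d c)) ps = 0" by (simp add: radial_insert_def op_mult_lin)
  ultimately show ?thesis using radial_homotopy[OF m(2) skew_d[OF assms]] by simp
qed

lemma of_degree_radial_lie: assumes "ml c" "of_degree u c" shows "of_degree u (radial_lie c)"
proof -
  obtain a where a: "\<And>I. a I \<in> W" "c = of_coeffs a" "\<And>u. of_degree u c \<Longrightarrow> of_degree u a"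
    using coefficients[OF assms(1)] by metis
  have "radial_lie c = of_coeffs (\<lambda>I. radial (a I) + real (total_weight I) *\<^sub>R a I)"
    unfolding a(2) by (rule ext) (rule radial_lie_of_coeffs[OF W_subset[OF a(1)]])
  moreover have "of_degree u (\<lambda>I. radial (a I) + real (total_weight I) *\<^sub>R a I)"
    using a(3)[OF assms(2)] by (simp add: of_degree_def linear_0[OF linear_radial])
  ultimately show ?thesis by (simp add: of_degree_of_coeffs)
qed

lemma radial_lie_kernel_twice:
  assumes "ml c" "\<And>ps. radial_lie (radial_lie c) ps = 0" shows "radial_lie c ps = 0"
proof -
  obtain a where a: "\<And>I. a I \<in> W" "c = of_coeffs a" using coefficients[OF assms(1)] by metis
  define a' where "a' I = radial (a I) + real (total_weight I) *\<^sub>R a I" for I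
  have a'W: "a' I \<in> W" for I
    unfolding a'_def by (intro subspace_add[OF W] subspace_scale[OF W] radial_in_W a(1))
  have c': "radial_lie c = of_coeffs a'"
    unfolding a(2) a'_def by (rule ext) (rule radial_lie_of_coeffs[OF W_subset[OF a(1)]])
  have "of_coeffs (\<lambda>I. radial (a' I) + real (total_weight I) *\<^sub>R a' I) ps = 0" for ps
    using assms(2)[of ps] unfolding c' radial_lie_of_coeffs[OF W_subset[OF a'W]] .
  then have "radial (a' I) + real (total_weight I) *\<^sub>R a' I = 0" for I by (rule of_coeffs_unique)
  then have "a' I = 0" for I
    unfolding a'_def by (rule radial_kernel_twice[OF a(1)])
  then have "a' = (\<lambda>I. 0)" by blast
  then show ?thesis unfolding c' by (simp only: of_coeffs_zero)
qed

lemma radial_lie_kernel: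
  assumes "ml c" "\<And>ps. radial_lie c ps = 0"
  obtains r where "c = of_coeffs (\<lambda>I. op_const (r I))" "\<And>I. total_weight I \<noteq> 0 \<Longrightarrow> r I = 0"
proof -
  obtain a where a: "\<And>I. a I \<in> W" "c = of_coeffs a" using coefficients[OF assms(1)] by metis
  have "of_coeffs (\<lambda>I. radial (a I) + real (total_weight I) *\<^sub>R a I) ps = 0" for ps
    using assms(2)[of ps] unfolding a(2) radial_lie_of_coeffs[OF W_subset[OF a(1)]] .
  then have "radial (a I) + real (total_weight I) *\<^sub>R a I = 0" for I by (rule of_coeffs_unique)
  then have k: "a I = (if total_weight I = 0 then op_const (op_ev (a I)) else 0)" for I
    by (rule radial_kernel[OF W_subset[OF a(1)]])
  have "a = (\<lambda>I. op_const (if total_weight I = 0 then op_ev (a I) else 0))"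
    by (rule ext) (subst k, simp add: op_const_lin)
  then show ?thesis using that[of "\<lambda>I. if total_weight I = 0 then op_ev (a I) else 0"] a(2) by metis
qed

text \<open>
  Solve for each coefficient separately, with the total weight of the word as eigenvalue.
\<close>

lemma radial_decomposition:
  assumes c: "ml c" "skew c" "of_degree u c"
  obtains e b where "ml e" "skew e" "of_degree u e" "\<And>ps. radial_lie e ps = 0"
    "ml b" "skew b" "of_degree u b" "\<And>ps. c ps = e ps + radial_lie b ps"
proof -
  obtain a where a: "\<And>I. a I \<in> W" "c = of_coeffs a" "skew a" "of_degree u a"
    using coefficients[OF c(1)] c(2,3) by metis
  define ea :: "'m sl_index list \<Rightarrow> 'm sf_op" where "ea I = (if total_weight I
      = 0 then op_const (op_ev (a I)) else 0)" for I
  define ba :: "'m sl_index list \<Rightarrow> 'm sf_op" where "ba I = radial_sol (total_weight I) (a I)" for I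
  have W: "ea I \<in> W" "ba I \<in> W" for I
    using a(1) radial_sol(1) by (auto simp: ea_def ba_def W_const subspace_0[OF W])
  have sw: "total_weight (I @ x # y # J) = total_weight (I @ y # x # J)" for I J and x y :: "'m sl_index"
      by simp
  have cm: "op_const (- r) = - (op_const r :: 'm sf_op)" for r by (auto simp: op_const_def)
  have "ea (I @ x # y # J) = - ea (I @ y # x # J)" for I J x y
    unfolding ea_def sw[of I x y] skew_swap[OF a(3), of I x y] 
    by (cases "total_weight (I @ y # x # J) = 0") (simp_all only: if_True if_False op_ev_simps cm minus_zero
      simp_thms)
  then have ske: "skew ea" unfolding skew_def by blast
  have "ba (I @ x # y # J) = - ba (I @ y # x # J)" for I J x y
    unfolding ba_def sw[of I x y] skew_swap[OF a(3), of I x y] by (rule radial_sol_minus[OF a(1)])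
  then have skb: "skew ba" unfolding skew_def by blast
  have deg: "of_degree u ea" "of_degree u ba"
    using a(4) by (auto simp: of_degree_def ea_def ba_def radial_sol_0 op_const_lin)
  have "radial (ea I) + real (total_weight I) *\<^sub>R ea I = 0" for I
    by (simp add: ea_def radial_op_const linear_0[OF linear_radial])
  then have ke: "radial_lie (of_coeffs ea) ps = 0" for ps
    unfolding radial_lie_of_coeffs[OF W_subset[OF W(1)]] by (simp only: of_coeffs_zero)
  have "a I = ea I + (radial (ba I) + real (total_weight I) *\<^sub>R ba I)" for I
    unfolding ba_def radial_sol(2)[OF a(1)] ea_def by simp
  then have "c ps = of_coeffs ea ps + radial_lie (of_coeffs ba) ps" for ps
    unfolding radial_lie_of_coeffs[OF W_subset[OF W(2)]] of_coeffs_add[symmetric] a(2) by presburger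
  then show ?thesis
    using that[of "of_coeffs ea" "of_coeffs ba"] ke multilinear_of_coeffs W skew_of_coeffs ske skb
      of_degree_of_coeffs deg by blast
qed

lemma radial_lie_add:
  assumes "ml c" "ml c'" shows "radial_lie (\<lambda>zs. c zs + c' zs) ps = radial_lie c ps + radial_lie c' ps"
proof -
  obtain a where a: "\<And>I. a I \<in> W" "c = of_coeffs a" using coefficients[OF assms(1)] by metis
  obtain a' where a': "\<And>I. a' I \<in> W" "c' = of_coeffs a'" using coefficients[OF assms(2)] by metis
  have "radial_lie (\<lambda>zs. c zs + c' zs) ps = radial_lie (of_coeffs (\<lambda>I. a I + a' I)) ps"
    unfolding a(2) a'(2) of_coeffs_add ..
  also have "\<dots> = of_coeffs (\<lambda>I. radial (a I + a' I) + real (total_weight I) *\<^sub>R (a I + a' I)) ps"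
    by (rule radial_lie_of_coeffs) (intro W_subset subspace_add[OF W] a(1) a'(1))
  also have "\<dots> = of_coeffs (\<lambda>I. (radial (a I) + real (total_weight I) *\<^sub>R a I)
      + (radial (a' I) + real (total_weight I) *\<^sub>R a' I)) ps"
    by (simp only: radial_add scaleR_add_right add_ac)
  finally show ?thesis
    unfolding a(2) a'(2) radial_lie_of_coeffs[OF W_subset[OF a(1)]] radial_lie_of_coeffs[OF W_subset[OF
        a'(1)]] by (simp only: of_coeffs_add)
qed

text \<open>
  Writing \<open>c = e + L\<^sub>s b\<close>, Cartan's formula would make \<open>L\<^sub>s b\<close> exact if \<open>b\<close> were closed. To achieve
  this, \<open>b\<close> is itself replaced by its component in the image of \<open>L\<^sub>s\<close>: then \<open>d b\<close> lies both in the
  kernel and in the image of \<open>L\<^sub>s\<close>, hence vanishes.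
\<close>

theorem cocycle_radial_kernel:
  assumes c: "ml c" "skew c" "of_degree u c" "\<And>ps. d c ps = 0"
  obtains e b where "ml e" "skew e" "of_degree u e" "\<And>ps. radial_lie e ps = 0" "\<And>ps. d e ps = 0"
    "ml b" "skew b" "of_degree (u - 1) b" "\<And>ps. c ps = e ps + d b ps" "u = 0 \<Longrightarrow> b = (\<lambda>ps. 0)"
proof -
  obtain e b1 where e: "ml e" "skew e" "of_degree u e" "\<And>ps. radial_lie e ps = 0"
    and b1: "ml b1" "skew b1" "of_degree u b1" and ce: "\<And>ps. c ps = e ps + radial_lie b1 ps"
    using radial_decomposition[OF c(1-3)] by metis
  obtain e' b2 where e': "ml e'" "\<And>ps. radial_lie e' ps = 0"
    and b2: "ml b2" "skew b2" "of_degree u b2" and be: "\<And>ps. b1 ps = e' ps + radial_lie b2 ps"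
    using radial_decomposition[OF b1] by metis
  \<comment> \<open>\<open>b1\<close> and \<open>b\<close> differ by an element of the kernel, so \<open>b\<close> serves as well\<close>
  define b where "b = radial_lie b2"
  have b: "ml b" "skew b" "of_degree u b"
    unfolding b_def by (rule radial_lie_alt[OF b2(1,2)] of_degree_radial_lie[OF b2(1,3)])+
  have "radial_lie b1 = radial_lie (\<lambda>zs. e' zs + b zs)"
    unfolding b_def by (subst be[symmetric]) (rule refl)
  then have "radial_lie b1 ps = radial_lie b ps" for ps
    by (simp add: radial_lie_add[OF e'(1) b(1)] e'(2))
  with ce have ce: "c ps = e ps + radial_lie b ps" for ps by simp
  have "c = (\<lambda>ps. e ps + radial_lie b ps)" using ce by blast
  then have "d c ps = d e ps + radial_lie (d b) ps" for ps
    by (simp only: d_add[OF e(1) radial_lie_alt(1)[OF b(1,2)]] d_radial_lie[OF b(1,2)])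
  with c(4) have de: "d e ps + radial_lie (d b) ps = 0" for ps by simp
  have "radial_lie (\<lambda>zs. 0) ps = 0" for ps :: "'m sl_vec list"
  proof -
    have "of_coeffs (\<lambda>I. 0) = (\<lambda>zs. 0 :: 'm sf_op)" by (rule ext) (rule of_coeffs_zero)
    then show ?thesis
      using radial_lie_of_coeffs[of "\<lambda>I. 0" ps, OF subspace_0[OF subspace_diff_ops]]
      by (simp only: linear_0[OF linear_radial] scaleR_zero_right add_0 of_coeffs_zero)
  qed
  note r0 = this
  have "radial_lie (d e) ps = 0" for ps
    using d_radial_lie[OF e(1,2), of ps] e(4) d_zero by (simp add: ext[OF e(4)] d_zero)
  moreover have "radial_lie (\<lambda>zs. d e zs + radial_lie (d b) zs) ps = 0" for ps
    unfolding de by (rule r0)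
  ultimately have "radial_lie (radial_lie (d b)) ps = 0" for ps
    by (simp add: radial_lie_add multilinear_d e(1) radial_lie_alt(1) b skew_d)
  then have rdb: "radial_lie (d b) ps = 0" for ps by (rule radial_lie_kernel_twice[OF multilinear_d[OF b(1)]])
  have db2: "d b = radial_lie (d b2)" unfolding b_def by (rule ext) (rule d_radial_lie[OF b2(1,2)])
  have "radial_lie (radial_lie (d b2)) ps = 0" for ps using rdb unfolding db2 .
  then have "radial_lie (d b2) ps = 0" for ps by (rule radial_lie_kernel_twice[OF multilinear_d[OF b2(1)]])
  then have db: "d b = (\<lambda>ps. 0)" unfolding db2 by blast
  have "radial_lie b ps = d (radial_insert b) ps" for ps
    using radial_homotopy[OF b(1,2), of ps] by (simp add: db radial_insert_def op_mult_lin)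
  with ce have "c ps = e ps + d (radial_insert b) ps" for ps by simp
  moreover have "d e ps = 0" for ps using de rdb by simp
  moreover have "of_degree (u - 1) (radial_insert b)" "u = 0 \<Longrightarrow> radial_insert b = (\<lambda>ps. 0)"
    using b(3) of_degree_radial_insert[of "u - 1" b] of_degree_radial_insert_0[of b]
    by (cases u; force simp: of_degree_def)+
  ultimately show ?thesis
    using that[OF e(1-4)] multilinear_radial_insert[OF b(1)] skew_radial_insert[OF b(2)] by blast
qed

end

section \<open>Comparison with the general linear algebra\<close>

text \<open>
  The opposite of the commutator, so that the inclusion of matrices as linear vector fields is a
  homomorphism.
\<close>

definition gl_br :: "real ^ 'm ^ 'm \<Rightarrow> real ^ 'm ^ 'm \<Rightarrow> real ^ 'm ^ 'm::finite" where
  "gl_br A B = gl_bracket B A"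

lemma inner_matrix_mult:
  fixes X Y Z :: "real ^ 'm::finite ^ 'm"
  shows "(Y ** X) \<bullet> Z = Y \<bullet> (Z ** transpose X)" "(X ** Y) \<bullet> Z = Y \<bullet> (transpose X ** Z)"
proof -
  have "(Y ** X) \<bullet> Z = (\<Sum>i\<in>UNIV. \<Sum>j\<in>UNIV. \<Sum>k\<in>UNIV. Y $ i $ k * X $ k $ j * Z $ i $ j)"
    by (simp add: inner_vec_def matrix_matrix_mult_def sum_distrib_right)
  also have "\<dots> = (\<Sum>i\<in>UNIV. \<Sum>k\<in>UNIV. \<Sum>j\<in>UNIV. Y $ i $ k * X $ k $ j * Z $ i $ j)"
    by (intro sum.cong refl sum.swap)
  also have "\<dots> = Y \<bullet> (Z ** transpose X)"
    by (simp add: inner_vec_def matrix_matrix_mult_def transpose_def sum_distrib_left mult_ac)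
  finally show "(Y ** X) \<bullet> Z = Y \<bullet> (Z ** transpose X)" .
  have "(X ** Y) \<bullet> Z = (\<Sum>i\<in>UNIV. \<Sum>j\<in>UNIV. \<Sum>k\<in>UNIV. X $ i $ k * Y $ k $ j * Z $ i $ j)"
    by (simp add: inner_vec_def matrix_matrix_mult_def sum_distrib_right)
  also have "\<dots> = (\<Sum>i\<in>UNIV. \<Sum>k\<in>UNIV. \<Sum>j\<in>UNIV. X $ i $ k * Y $ k $ j * Z $ i $ j)"
    by (intro sum.cong refl sum.swap)
  also have "\<dots> = (\<Sum>k\<in>UNIV. \<Sum>i\<in>UNIV. \<Sum>j\<in>UNIV. X $ i $ k * Y $ k $ j * Z $ i $ j)"
    by (rule sum.swap)
  also have "\<dots> = (\<Sum>k\<in>UNIV. \<Sum>j\<in>UNIV. \<Sum>i\<in>UNIV. X $ i $ k * Y $ k $ j * Z $ i $ j)"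
    by (intro sum.cong refl sum.swap)
  also have "\<dots> = Y \<bullet> (transpose X ** Z)"
    by (simp add: inner_vec_def matrix_matrix_mult_def transpose_def sum_distrib_left mult_ac)
  finally show "(X ** Y) \<bullet> Z = Y \<bullet> (transpose X ** Z)" .
qed

lemma matrix_mult_lin:
  fixes A B C :: "real ^ 'm::finite ^ 'm"
  shows "A ** (r *\<^sub>R B) = r *\<^sub>R (A ** B)" "(r *\<^sub>R A) ** B = r *\<^sub>R (A ** B)"
    "A ** (B - C) = A ** B - A ** C" "(A - B) ** C = A ** C - B ** C"
    "A ** (B + C) = A ** B + A ** C" "(A + B) ** C = A ** C + B ** C"
  by (simp_all add: vec_eq_iff matrix_matrix_mult_def sum_distrib_left sum_subtractf sum.distrib algebra_simps)

interpretation gl: self_adjoint_lie "gl_br :: real ^ 'm::finite ^ 'm \<Rightarrow> _" transpose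
proof
  fix x y z :: "real ^ 'm ^ 'm" and r :: real
  show "gl_br x (y + z) = gl_br x y + gl_br x z" by (simp add: gl_br_def gl_bracket_def matrix_mult_lin)
  show "gl_br x (r *\<^sub>R y) = r *\<^sub>R gl_br x y" by (simp add: gl_br_def gl_bracket_def matrix_mult_lin
      algebra_simps)
  show "gl_br x y = - gl_br y x" by (simp add: gl_br_def gl_bracket_def)
  show "gl_br x (gl_br y z) = gl_br (gl_br x y) z + gl_br y (gl_br x z)"
    by (simp add: gl_br_def gl_bracket_def matrix_mult_lin matrix_mul_assoc)
  show "gl_br x y \<bullet> z = y \<bullet> gl_br (transpose x) z"
    by (simp add: gl_br_def gl_bracket_def inner_diff_left inner_diff_right
        inner_matrix_mult(1)[of y x z] inner_matrix_mult(2)[of x y z])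
qed auto

text \<open>
  The cochain \<open>(X\<^sub>1, \<dots>, X\<^sub>u) \<mapsto> w (D X\<^sub>1, \<dots>, D X\<^sub>u)\<close>, with values in the multiplication operators.
\<close>

definition gl_lift :: "((real ^ 'm ^ 'm) list \<Rightarrow> real) \<Rightarrow> 'm::finite sl_vec list \<Rightarrow> 'm sf_op" where
  "gl_lift w = of_coeffs (\<lambda>I. op_const (w (map mat_unit I)))"

definition gl_restrict :: "('m::finite sl_vec list \<Rightarrow> 'm sf_op) \<Rightarrow> (real ^ 'm ^ 'm) list \<Rightarrow> real" where
  "gl_restrict c As = op_ev (c (map gl_incl As))"

lemma op_ev_sum: "op_ev (\<Sum>a\<in>S. A a) = (\<Sum>a\<in>S. op_ev (A a))"
  by (induction S rule: infinite_finite_induct) (simp_all only: sum.infinite sum.empty sum.insert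
    op_ev_simps simp_thms)

text \<open>
  A linear field vanishes at the origin and has constant divergence.
\<close>

lemma op_ev_sl_act:
  assumes "U \<in> diff_ops" shows "op_ev (sl_act lam (gl_incl A) U) = 0"
proof -
  obtain r where r: "divergence (proj_field (gl_incl A)) = of_real r" using divergence_gl_incl by blast
  have "U (lam *\<^sub>R (of_real r * 1)) = lam *\<^sub>R (r *\<^sub>R U 1)"
    by (simp only: scaleR_conv_of_real[symmetric] diff_ops_linear[OF assms])
  moreover have "sf_apply (proj_field (gl_incl A) $ i) 0 = 0" for i by (simp add: field_gl_incl)
  ultimately show ?thesis
    by (simp add: op_ev_def sl_act_apply lie_deriv_eq r vf_apply_eval del: mult_1_right)
qed

lemma gl_lift_Cons: "gl_lift w (p # ps) = (\<Sum>b\<in>UNIV. op_mult (frame b p) (gl_lift (\<lambda>Bs. w (mat_unit b # Bs))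
    ps))"
  by (simp add: gl_lift_def)

lemma gl_restrict_lift: assumes "multilinear UNIV w" shows "gl_restrict (gl_lift w) As = w As"
  using assms
proof (induction As arbitrary: w)
  case Nil
  show ?case by (simp add: gl_restrict_def gl_lift_def)
next
  case (Cons A As)
  have "w (A # As) = w ((\<Sum>b\<in>UNIV. (gl_incl A $ b) *\<^sub>R mat_unit b) # As)"
    using mat_unit_expansion[of A] by simp
  also have "\<dots> = (\<Sum>b\<in>UNIV. (gl_incl A $ b) * w (mat_unit b # As))"
  proof -
    have "w ((\<Sum>b\<in>S. (gl_incl A $ b) *\<^sub>R mat_unit b) # As) = (\<Sum>b\<in>S. (gl_incl A $ b) * w (mat_unit b # As))" for S
      by (induction S rule: infinite_finite_induct) (simp_all add: multilinear_hd[OF Cons.prems])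
    then show ?thesis .
  qed
  finally show ?case
    using Cons.IH[OF multilinear_Cons[OF Cons.prems]]
    by (simp only: gl_restrict_def list.map gl_lift_Cons op_ev_sum op_ev_simps frame_gl_incl_0)
qed

lemma mat_unit_weight: "weight b \<noteq> 0 \<Longrightarrow> mat_unit b = 0"
  by (cases b rule: sl_index_cases) (auto simp: mat_unit_def)

lemma form_mat_unit_weight: "multilinear UNIV w \<Longrightarrow> total_weight I \<noteq> 0 \<Longrightarrow> w (map mat_unit I) = (0 :: real)"
proof (induction I arbitrary: w)
  case (Cons b I)
  show ?case
  proof (cases "weight b = 0")
    case True
    then show ?thesis using Cons.IH[OF multilinear_Cons[OF Cons.prems(1)]] Cons.prems(2) by simp
  next
    case False
    then show ?thesis using multilinear_hd(5)[OF Cons.prems(1)] by (simp add: mat_unit_weight)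
  qed
qed simp

lemma frame_mat_unit_0: "sf_apply (frame e (gl_incl (mat_unit b))) 0 = (if e = b \<and> weight b = 0 then 1 else 0)"
  unfolding frame_gl_incl_0
  by (cases b rule: sl_index_cases; cases e rule: sl_index_cases)
     (auto simp: gl_incl_def mk_param_def mat_unit_def axis_nth_if)

text \<open>
  At the origin, the only nonzero Taylor coefficient of a matrix unit is the corresponding entry.
\<close>

lemma gl_restrict_of_coeffs_const:
  "gl_restrict (of_coeffs (\<lambda>I. op_const (r I))) (map mat_unit I) = (if total_weight I = 0 then r I else 0)"
proof (induction I arbitrary: r)
  case (Cons b I)
  have "gl_restrict (of_coeffs (\<lambda>I. op_const (r I))) (map mat_unit (b # I))
      = (\<Sum>e\<in>UNIV. sf_apply (frame e (gl_incl (mat_unit b))) 0 * gl_restrict (of_coeffs (\<lambda>I. op_const (r (e #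
          I)))) (map mat_unit I))"
    by (simp only: gl_restrict_def list.map of_coeffs.simps op_ev_sum op_ev_simps)
  also have "\<dots> = (\<Sum>e\<in>UNIV. if e = b then (if weight b
      = 0 then 1 else 0) * gl_restrict (of_coeffs (\<lambda>I. op_const (r (e # I)))) (map mat_unit I) else 0)"
    by (rule sum.cong) (auto simp: frame_mat_unit_0)
  also have "\<dots> = (if total_weight (b # I) = 0 then r (b # I) else 0)"
    using Cons.IH[of "\<lambda>I. r (b # I)"] by simp
  finally show ?case .
qed (simp add: gl_restrict_def)

context coeff_module begin

lemma gl_restrict_Lie:
  "ml c \<Longrightarrow> gl_restrict (Lie (gl_incl A) c) As = gl.Lie A (gl_restrict c) As"
proof (induction As arbitrary: c)
  case Nil
  then show ?case
    by (simp only: gl_restrict_def list.map cochain_lie.simps op_ev_sl_act[OF W_subset[OF multilinear_in[OF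
      Nil]]])
next
  case (Cons B As)
  show ?case
    using Cons.IH[OF multilinear_Cons[OF Cons.prems], of "gl_incl B"]
    by (simp only: gl_restrict_def list.map cochain_lie.simps op_ev_simps gl_incl_bracket gl_br_def)
qed

lemma gl_restrict_d: "ml c \<Longrightarrow> gl_restrict (d c) As = gl.d (gl_restrict c) As"
proof (induction As arbitrary: c)
  case (Cons A As)
  have "gl_restrict (d c) (A # As) = gl_restrict (Lie (gl_incl A) c) As
      - gl_restrict (d (\<lambda>zs. c (gl_incl A # zs))) As"
    by (simp only: gl_restrict_def list.map cochain_d.simps op_ev_simps)
  also have "\<dots> = gl.Lie A (gl_restrict c) As - gl.d (gl_restrict (\<lambda>zs. c (gl_incl A # zs))) As"
    by (simp only: gl_restrict_Lie[OF Cons.prems] Cons.IH[OF multilinear_Cons[OF Cons.prems]])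
  also have "gl_restrict (\<lambda>zs. c (gl_incl A # zs)) = (\<lambda>Bs. gl_restrict c (A # Bs))"
    by (simp add: gl_restrict_def fun_eq_iff)
  finally show ?case by simp
qed (simp add: gl_restrict_def)

lemma gl_restrict_alt: assumes "ml c" "skew c" "of_degree u c" shows "gl_restrict c \<in> alt_forms u"
  unfolding alt_forms_def
proof (intro CollectI conjI)
  show "multilinear UNIV (gl_restrict c)"
    by (simp add: multilinear_def gl_restrict_def gl_incl_lin multilinear_add[OF assms(1)]
      multilinear_scale[OF assms(1)])
  have "gl_restrict c (As @ X # Y # Bs) = - gl_restrict c (As @ Y # X # Bs)" for As X Y Bs
    using skew_swap[OF assms(2), of "map gl_incl As" "gl_incl X" "gl_incl Y" "map gl_incl Bs"]
    by (simp only: gl_restrict_def map_append list.map op_ev_simps)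
  then show "skew (gl_restrict c)" unfolding skew_def by blast
  show "of_degree u (gl_restrict c)" using assms(3) by (simp add: of_degree_def gl_restrict_def)
qed

lemma gl_lift_alt:
  assumes "w \<in> alt_forms u"
  shows "ml (gl_lift w)" "skew (gl_lift w)" "of_degree u (gl_lift w)" "radial_lie (gl_lift w) ps = 0"
proof -
  have w: "multilinear UNIV w" "skew w" "of_degree u w" using assms by (auto simp: alt_forms_def)
  show "ml (gl_lift w)" unfolding gl_lift_def by (rule multilinear_of_coeffs[OF W_const])
  have "op_const (- r) = - (op_const r :: 'm sf_op)" for r by (auto simp: op_const_def)
  then have "op_const (w (map mat_unit (I @ x # y # J)))
      = - (op_const (w (map mat_unit (I @ y # x # J))) :: 'm sf_op)" for I x y J
    using skew_swap[OF w(2), of "map mat_unit I" "mat_unit x" "mat_unit y" "map mat_unit J"]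
    by (simp only: map_append list.map)
  then have "skew (\<lambda>I. op_const (w (map mat_unit I)) :: 'm sf_op)" unfolding skew_def by blast
  then show "skew (gl_lift w)" unfolding gl_lift_def by (rule skew_of_coeffs)
  show "of_degree u (gl_lift w)" unfolding gl_lift_def
    by (rule of_degree_of_coeffs) (use w(3) in \<open>simp add: of_degree_def op_const_lin\<close>)
  have "radial (op_const (w (map mat_unit I))) + real (total_weight I) *\<^sub>R op_const (w (map mat_unit I))
      = (0 :: 'm sf_op)" for I
    unfolding radial_op_const
    using form_mat_unit_weight[OF w(1), of I] by (cases "total_weight I = 0") (simp_all add: op_const_lin)
  then show "radial_lie (gl_lift w) ps = 0"
    unfolding gl_lift_def radial_lie_of_coeffs[OF W_subset[OF W_const]] by (simp only: of_coeffs_zero)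
qed

text \<open>
  A kernel element has constant coefficients, supported on words of weight \<open>0\<close>, and restriction to
  matrix units recovers them.
\<close>

lemma radial_kernel_gl_lift:
  assumes "ml c" "\<And>ps. radial_lie c ps = 0"
  shows "c = gl_lift (gl_restrict c)"
proof -
  obtain r where r: "c = of_coeffs (\<lambda>I. op_const (r I))" "\<And>I. total_weight I \<noteq> 0 \<Longrightarrow> r I = 0"
    using radial_lie_kernel[OF assms] by blast
  have "gl_restrict c (map mat_unit I) = r I" for I
    unfolding r(1) gl_restrict_of_coeffs_const using r(2)[of I] by simp
  then show ?thesis by (simp add: gl_lift_def r(1))
qed

text \<open>
  The image of \<open>gl_lift\<close> is the kernel of \<open>L\<^sub>s\<close>, which is stable under \<open>d\<close>; and on it the chain map
  \<open>gl_restrict\<close> is inverse to \<open>gl_lift\<close>. So no computation with jets is needed.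
\<close>

lemma d_gl_lift:
  assumes w: "w \<in> alt_forms u" shows "d (gl_lift w) = gl_lift (gl.d w)"
proof -
  note l = gl_lift_alt[OF w]
  have "radial_lie (d (gl_lift w)) ps = 0" for ps
  proof -
    have "radial_lie (gl_lift w) = (\<lambda>ps. 0)" by (rule ext) (rule l(4))
    then show ?thesis using d_radial_lie[OF l(1,2), of ps] by (simp only: d_zero)
  qed
  from radial_kernel_gl_lift[OF multilinear_d[OF l(1)] this]
  have "d (gl_lift w) = gl_lift (gl_restrict (d (gl_lift w)))" .
  moreover have "gl_restrict (gl_lift w) = w"
      by (rule ext, rule gl_restrict_lift) (use w in \<open>simp add: alt_forms_def\<close>)
  then have "gl_restrict (d (gl_lift w)) = gl.d w" by (intro ext) (simp only: gl_restrict_d[OF l(1)])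
  ultimately show ?thesis by simp
qed

lemma gl_lift_zero: "gl_lift (\<lambda>As. 0) = (\<lambda>ps. 0)"
  unfolding gl_lift_def by (rule ext) (simp only: op_const_lin of_coeffs_zero)

lemma gl_lift_add: "gl_lift (\<lambda>As. w As + w' As) ps = gl_lift w ps + gl_lift w' ps"
  unfolding gl_lift_def by (simp only: op_const_lin of_coeffs_add)

lemma gl_lift_scale: "gl_lift (\<lambda>As. r * w As) ps = r *\<^sub>R gl_lift w ps"
  unfolding gl_lift_def by (simp only: op_const_lin of_coeffs_scale)

end

definition gl_invariants :: "nat \<Rightarrow> ((real ^ 'm::finite ^ 'm) list \<Rightarrow> real) set" where
  "gl_invariants u = {w \<in> alt_forms u. \<forall>A As. cochain_lie gl_br (\<lambda>x w. 0) A w As = 0}"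

lemma subspace_gl_invariants: "subspace (gl_invariants u)"
proof (rule subspaceI)
  have ml: "multilinear UNIV w" if "w \<in> alt_forms u" for w :: "(real ^ 'a ^ 'a) list \<Rightarrow> real"
    using that by (simp add: alt_forms_def)
  show "0 \<in> gl_invariants u"
    using subspace_0[OF subspace_alt_forms] gl.Lie_eq_0[of _ "0"] by (auto simp: gl_invariants_def)
  show "x + y \<in> gl_invariants u" if "x \<in> gl_invariants u" "y \<in> gl_invariants u"
      for x y :: "(real ^ 'a ^ 'a) list \<Rightarrow> real"
    using that subspace_add[OF subspace_alt_forms] gl.Lie_add[OF ml ml, of x y]
    by (auto simp: gl_invariants_def plus_fun_def)
  show "r *\<^sub>R x \<in> gl_invariants u" if "x \<in> gl_invariants u" for r and x :: "(real ^ 'a ^ 'a) list \<Rightarrow> real"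
    using that subspace_scale[OF subspace_alt_forms] gl.Lie_scale[OF ml, of x]
    by (auto simp: gl_invariants_def scaleR_fun_def)
qed

lemma trivial_Lie_eq_sum:
  "cochain_lie br (\<lambda>x w. 0) x c xs = - (\<Sum>i<length xs. c (xs[i := br x (xs ! i)]))"
proof (induction xs arbitrary: c)
  case (Cons y ys)
  then show ?case by (simp add: sum.lessThan_Suc_shift del: sum.lessThan_Suc)
qed simp

lemma gl_inv_forms_deg_eq: "gl_inv_forms_deg u
    = (gl_invariants u :: ((real ^ 'm::finite ^ 'm) list \<Rightarrow> real) set)"
proof -
  have eq: "(\<Sum>i<u. c (xs[i := gl_bracket A (xs ! i)])) = cochain_lie gl_br (\<lambda>x w. 0) A c xs"
    if "c \<in> alt_forms u" "length xs = u" for c :: "(real ^ 'm ^ 'm) list \<Rightarrow> real" and A xs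
  proof -
    have "multilinear UNIV c" using that by (simp add: alt_forms_def)
    note m = multilinear_scale[OF this, of _ "-1"]
    have e: "gl_br A (xs ! i) = (-1) *\<^sub>R gl_bracket A (xs ! i)" for i by (simp add: gl_br_def gl_bracket_def)
    have "c (xs[i := gl_br A (xs ! i)]) = - c (xs[i := gl_bracket A (xs ! i)])" if "i < length xs" for i
      unfolding upd_conv_take_nth_drop[OF that] e m by simp
    then show ?thesis using that(2) by (simp add: trivial_Lie_eq_sum sum_negf)
  qed
  have eq0: "cochain_lie gl_br (\<lambda>x w. 0) A c xs = 0"
    if "c \<in> alt_forms u" "length xs \<noteq> u" for c :: "(real ^ 'm ^ 'm) list \<Rightarrow> real" and A xs
    using gl.of_degree_Lie[of u c A] that by (simp add: alt_forms_def of_degree_def)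
  have alt: "alt_maps UNIV UNIV u = (alt_forms u :: ((real ^ 'm ^ 'm) list \<Rightarrow> real) set)"
    by (auto simp: alt_maps_UNIV_iff alt_forms_def)
  have "(\<forall>A xs. length xs = u \<longrightarrow> (\<Sum>i<u. c (xs[i := gl_bracket A (xs ! i)])) = 0)
      \<longleftrightarrow> (\<forall>A xs. cochain_lie gl_br (\<lambda>x w. 0) A c xs = 0)"
    if c: "c \<in> alt_forms u" for c :: "(real ^ 'm ^ 'm) list \<Rightarrow> real"
  proof (intro iffI allI impI)
    fix A and xs :: "(real ^ 'm ^ 'm) list" assume h: "\<forall>A xs. length xs
        = u \<longrightarrow> (\<Sum>i<u. c (xs[i := gl_bracket A (xs ! i)])) = 0"
    show "cochain_lie gl_br (\<lambda>x w. 0) A c xs = 0"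
    proof (cases "length xs = u")
      case True
      then show ?thesis unfolding eq[OF c True, symmetric] using h by blast
    qed (rule eq0[OF c])
  next
    fix A and xs :: "(real ^ 'm ^ 'm) list" assume "\<forall>A xs. cochain_lie gl_br (\<lambda>x w. 0) A c xs
        = 0" "length xs = u"
    then show "(\<Sum>i<u. c (xs[i := gl_bracket A (xs ! i)])) = 0" unfolding eq[OF c \<open>length xs = u\<close>] by blast
  qed
  then show ?thesis
    unfolding gl_inv_forms_deg_def gl_invariants_def alt by blast
qed

context coeff_module begin

theorem gl_lift_cocycle:
  assumes "w \<in> gl_invariants u" shows "d (gl_lift w) ps = 0"
proof -
  have w: "w \<in> alt_forms u" "\<And>A As. gl.Lie A w As = 0" using assms by (auto simp: gl_invariants_def)
  have "gl.d w = (\<lambda>As. 0)" by (rule ext) (rule gl.d_invariant[OF w])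
  then show ?thesis by (simp only: d_gl_lift[OF w(1)] gl_lift_zero)
qed

text \<open>
  Apply the chain map \<open>gl_restrict\<close>, which is defined for all coefficient modules alike.
\<close>

theorem gl_lift_exact_imp_0:
  assumes "w \<in> gl_invariants (Suc v)" "ml e" "skew e" "of_degree v e" "gl_lift w = d e"
  shows "w = 0"
proof -
  have w: "w \<in> alt_forms (Suc v)" "\<And>A As. gl.Lie A w As = 0" using assms(1) by (auto simp: gl_invariants_def)
  have "w = gl_restrict (gl_lift w)" by (rule ext, rule gl_restrict_lift[symmetric]) (use w in \<open>simp add:
      alt_forms_def\<close>)
  also have "\<dots> = gl.d (gl_restrict e)" unfolding assms(5) by (rule ext) (rule gl_restrict_d[OF assms(2)])
  finally show ?thesis
    by (rule gl.invariant_exact_imp_0[OF w gl_restrict_alt[OF assms(2-4)]])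
qed

text \<open>
  First move the cocycle into the kernel of \<open>L\<^sub>s\<close>, then move the resulting form on matrices to an
  invariant one.
\<close>

theorem cocycle_cohomologous_gl_lift:
  assumes c: "ml c" "skew c" "of_degree u c" "\<And>ps. d c ps = 0"
  obtains w b where "w \<in> gl_invariants u" "ml b" "skew b" "of_degree (u - 1) b"
    "\<And>ps. c ps = gl_lift w ps + (if u = 0 then 0 else d b ps)"
proof -
  obtain e b where e: "ml e" "skew e" "of_degree u e" "\<And>ps. radial_lie e ps = 0" "\<And>ps. d e ps = 0"
    and b: "ml b" "skew b" "of_degree (u - 1) b" and ce: "\<And>ps. c ps = e ps + d b ps" and b0: "u = 0 \<Longrightarrow> b
        = (\<lambda>ps. 0)"
    using cocycle_radial_kernel[OF c] by metis
  have el: "e = gl_lift (gl_restrict e)" by (rule radial_kernel_gl_lift[OF e(1,4)])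
  have re: "gl_restrict e \<in> alt_forms u" by (rule gl_restrict_alt[OF e(1-3)])
  have "gl.d (gl_restrict e) As = 0" for As
    using gl_restrict_d[OF e(1), of As] by (simp add: gl_restrict_def e(5))
  from gl.cocycle_decomposition[OF re this]
  obtain w f where w: "w \<in> alt_forms u" "\<forall>A As. gl.Lie A w As = 0" and f: "f \<in> alt_forms (u - 1)"
    and ef: "gl_restrict e = w + (if u = 0 then 0 else gl.d f)" by blast
  have wi: "w \<in> gl_invariants u" using w by (simp add: gl_invariants_def)
  note lf = gl_lift_alt[OF f]
  show ?thesis
  proof (cases "u = 0")
    case True
    then have "c ps = gl_lift w ps + (if u = 0 then 0 else d b ps)" for ps
      using ce[of ps] el ef b0 by (simp add: d_zero)
    then show ?thesis using that[OF wi b] by blast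
  next
    case False
    have "gl_restrict e = (\<lambda>As. w As + gl.d f As)" using ef False by (simp add: plus_fun_def)
    then have "e ps = gl_lift w ps + d (gl_lift f) ps" for ps
      by (subst el) (simp only: gl_lift_add d_gl_lift[OF f])
    then have "c ps = gl_lift w ps + d (\<lambda>ps. gl_lift f ps + b ps) ps" for ps
      using ce[of ps] by (simp only: d_add[OF lf(1) b(1)] add.assoc)
    moreover have "of_degree (u - 1) (\<lambda>ps. gl_lift f ps + b ps)"
      using lf(3) b(3) by (simp add: of_degree_def)
    ultimately show ?thesis
      using that[OF wi multilinear_lincomb(1)[OF W lf(1) b(1)] skew_lincomb(1)[OF lf(2) b(2)]] False by simp
  qed
qed

end

section \<open>Quotients with chosen representatives\<close>

definition coset :: "'a::real_vector set \<Rightarrow> 'a \<Rightarrow> 'a set" where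
  "coset B a = (\<lambda>b. b + a) ` B"

lemma subspace_module_simps [simp]: "carrier (subspace_module S) = S" "zero (subspace_module S) = 0"
  "add (subspace_module S) = (+)" "smult (subspace_module S) = (*\<^sub>R)"
  by (simp_all add: subspace_module_def)

lemma a_r_coset_eq: "B +>\<^bsub>subspace_module Z\<^esub> a = coset B a"
  by (auto simp: a_r_coset_def' coset_def)

lemma coset_eq_iff: assumes "subspace B" shows "coset B a = coset B a' \<longleftrightarrow> a - a' \<in> B"
proof
  assume "coset B a = coset B a'"
  moreover have "a \<in> coset B a" using subspace_0[OF assms] by (force simp: coset_def)
  ultimately obtain b where "b \<in> B" "a = b + a'" by (auto simp: coset_def)
  then show "a - a' \<in> B" by simp
next
  assume d: "a - a' \<in> B"
  have "b + a \<in> coset B a'" if "b \<in> B" for b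
    unfolding coset_def by (rule image_eqI[of _ _ "b + (a
        - a')"]) (use subspace_add[OF assms that d] in simp_all)
  moreover have "b + a' \<in> coset B a" if "b \<in> B" for b
    unfolding coset_def by (rule image_eqI[of _ _ "b - (a
        - a')"]) (use subspace_diff[OF assms that d] in simp_all)
  ultimately show "coset B a = coset B a'" by (auto simp: coset_def)
qed

lemma coset_0: "coset B 0 = B" by (simp add: coset_def)

lemma coset_ops:
  assumes "subspace B"
  shows "coset B a <+>\<^bsub>subspace_module Z\<^esub> coset B a' = coset B (a + a')"
    "(\<Union>c\<in>coset B a. coset B (r *\<^sub>R c)) = coset B (r *\<^sub>R a)"
proof -
  have "b + a + (b' + a') \<in> coset B (a + a')" if "b \<in> B" "b' \<in> B" for b b'
    unfolding coset_def by (rule image_eqI[of _ _ "b + b'"]) (use subspace_add[OF assms that] in simp_all)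
  moreover have "\<exists>x\<in>coset B a. \<exists>y\<in>coset B a'. b + (a + a') = x + y" if "b \<in> B" for b
    by (rule bexI[of _ "b + a"], rule bexI[of _ "0 + a'"])
       (use that subspace_0[OF assms] in \<open>auto simp: coset_def simp del: add_0_left\<close>)
  ultimately show "coset B a <+>\<^bsub>subspace_module Z\<^esub> coset B a' = coset B (a + a')"
    by (fastforce simp: set_add_def' coset_def)
  have "coset B (r *\<^sub>R c) = coset B (r *\<^sub>R a)" if c: "c \<in> coset B a" for c
  proof -
    obtain b where "b \<in> B" "c = b + a" using c by (auto simp: coset_def)
    then show ?thesis using subspace_scale[OF assms, of b r]
        by (simp add: coset_eq_iff[OF assms] scaleR_add_right)
  qed
  moreover have "a \<in> coset B a" using subspace_0[OF assms] by (force simp: coset_def)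
  ultimately show "(\<Union>c\<in>coset B a. coset B (r *\<^sub>R c)) = coset B (r *\<^sub>R a)" by blast
qed

lemma quotient_module_simps:
  assumes "subspace B"
  shows "carrier (quotient_module (subspace_module Z) B) = coset B ` Z"
    "zero (quotient_module (subspace_module Z) B) = coset B 0"
    "add (quotient_module (subspace_module Z) B) (coset B a) (coset B a') = coset B (a + a')"
    "smult (quotient_module (subspace_module Z) B) r (coset B a) = coset B (r *\<^sub>R a)"
  using coset_ops[OF assms]
  by (auto simp: quotient_module_def A_RCOSETS_def' coset_0 a_r_coset_eq)

lemma module_isoI:
  assumes "\<And>x. x \<in> carrier M \<Longrightarrow> f x \<in> carrier N"
    and "\<And>x y. x \<in> carrier M \<Longrightarrow> y \<in> carrier M \<Longrightarrow> f (x \<oplus>\<^bsub>M\<^esub> y) = f x \<oplus>\<^bsub>N\<^esub> f y"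
    and "\<And>r x. x \<in> carrier M \<Longrightarrow> f (r \<odot>\<^bsub>M\<^esub> x) = r \<odot>\<^bsub>N\<^esub> f x"
    and "bij_betw f (carrier M) (carrier N)"
  shows "f \<in> module_iso M N"
  using assms by (auto simp: module_iso_def iso_def hom_def)

lemma module_isoD:
  assumes "f \<in> module_iso M N"
  shows "\<And>x. x \<in> carrier M \<Longrightarrow> f x \<in> carrier N"
    and "\<And>x y. x \<in> carrier M \<Longrightarrow> y \<in> carrier M \<Longrightarrow> f (x \<oplus>\<^bsub>M\<^esub> y) = f x \<oplus>\<^bsub>N\<^esub> f y"
    and "\<And>r x. x \<in> carrier M \<Longrightarrow> f (r \<odot>\<^bsub>M\<^esub> x) = r \<odot>\<^bsub>N\<^esub> f x"
    and "bij_betw f (carrier M) (carrier N)"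
  using assms by (auto simp: module_iso_def iso_def hom_def)

lemma module_iso_direct_sum:
  fixes M :: "nat \<Rightarrow> (real, 'a) module" and N :: "nat \<Rightarrow> (real, 'b) module"
  assumes f: "\<And>u. f u \<in> module_iso (M u) (N u)"
    and z: "\<And>u. \<zero>\<^bsub>M u\<^esub> \<in> carrier (M u)" "\<And>u. f u \<zero>\<^bsub>M u\<^esub> = \<zero>\<^bsub>N u\<^esub>"
  shows "(\<lambda>h u. f u (h u)) \<in> module_iso (direct_sum_module M) (direct_sum_module N)"
proof (rule module_isoI)
  note D = module_isoD[OF f]
  have inj: "h = h'" if "h \<in> carrier (M u)" "h' \<in> carrier (M u)" "f u h = f u h'" for u h h'
    using D(4)[of u] that by (meson bij_betw_imp_inj_on inj_onD)
  show cl: "(\<lambda>u. f u (h u)) \<in> carrier (direct_sum_module N)" if "h \<in> carrier (direct_sum_module M)" for h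
  proof -
    have h: "\<And>u. h u \<in> carrier (M u)" "finite {u. h u \<noteq> \<zero>\<^bsub>M u\<^esub>}" using that
        by (auto simp: direct_sum_module_def)
    have "{u. f u (h u) \<noteq> \<zero>\<^bsub>N u\<^esub>} \<subseteq> {u. h u \<noteq> \<zero>\<^bsub>M u\<^esub>}" using z(2) by auto
    then show ?thesis using h D(1) finite_subset by (auto simp: direct_sum_module_def)
  qed
  show "(\<lambda>u. f u ((h \<oplus>\<^bsub>direct_sum_module M\<^esub> h') u)) = (\<lambda>u. f u (h u)) \<oplus>\<^bsub>direct_sum_module N\<^esub> (\<lambda>u. f u (h' u))"
    if "h \<in> carrier (direct_sum_module M)" "h' \<in> carrier (direct_sum_module M)" for h h'
    using that D(2) by (auto simp: direct_sum_module_def)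
  show "(\<lambda>u. f u ((r \<odot>\<^bsub>direct_sum_module M\<^esub> h) u)) = r \<odot>\<^bsub>direct_sum_module N\<^esub> (\<lambda>u. f u (h u))"
    if "h \<in> carrier (direct_sum_module M)" for r h
    using that D(3) by (auto simp: direct_sum_module_def)
  show "bij_betw (\<lambda>h u. f u (h u)) (carrier (direct_sum_module M)) (carrier (direct_sum_module N))"
    unfolding bij_betw_def
  proof
    show "inj_on (\<lambda>h u. f u (h u)) (carrier (direct_sum_module M))"
      by (rule inj_onI) (auto simp: direct_sum_module_def fun_eq_iff intro: inj)
    have "k \<in> (\<lambda>h u. f u (h u)) ` carrier (direct_sum_module M)" if "k \<in> carrier (direct_sum_module N)" for k
    proof -
      have k: "\<And>u. k u \<in> carrier (N u)" "finite {u. k u \<noteq> \<zero>\<^bsub>N u\<^esub>}" using that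
          by (auto simp: direct_sum_module_def)
      have "\<forall>u. \<exists>x. x \<in> carrier (M u) \<and> f u x = k u"
        using k(1) D(4) by (metis bij_betw_imp_surj_on imageE)
      then obtain h where h: "\<And>u. h u \<in> carrier (M u)" "\<And>u. f u (h u) = k u" by metis
      have "{u. h u \<noteq> \<zero>\<^bsub>M u\<^esub>} \<subseteq> {u. k u \<noteq> \<zero>\<^bsub>N u\<^esub>}"
      proof
        fix u assume "u \<in> {u. h u \<noteq> \<zero>\<^bsub>M u\<^esub>}"
        then have "f u (h u) \<noteq> f u \<zero>\<^bsub>M u\<^esub>" using inj[OF h(1) z(1)] by blast
        then show "u \<in> {u. k u \<noteq> \<zero>\<^bsub>N u\<^esub>}" by (simp add: h(2) z(2))
      qed
      then have "h \<in> carrier (direct_sum_module M)"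
        using h(1) k(2) finite_subset by (auto simp: direct_sum_module_def)
      moreover have "k = (\<lambda>u. f u (h u))" using h(2) by auto
      ultimately show ?thesis by blast
    qed
    then show "(\<lambda>h u. f u (h u)) ` carrier (direct_sum_module M) = carrier (direct_sum_module N)"
      using cl by blast
  qed
qed

text \<open>
  The quotient of \<open>Z\<close> by \<open>B\<close> is described by a linear map \<open>J\<close> that picks exactly one element in
  each class.
\<close>

locale cocycle_representatives =
  fixes Z B :: "'c::real_vector set" and I :: "'i::real_vector set" and J :: "'i \<Rightarrow> 'c"
  assumes Z: "subspace Z" and B: "subspace B" and BZ: "B \<subseteq> Z" and I: "subspace I"
    and J_in: "w \<in> I \<Longrightarrow> J w \<in> Z"
    and J_add: "w \<in> I \<Longrightarrow> w' \<in> I \<Longrightarrow> J (w + w') = J w + J w'"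
    and J_scale: "w \<in> I \<Longrightarrow> J (r *\<^sub>R w) = r *\<^sub>R J w"
    and J_surj: "c \<in> Z \<Longrightarrow> \<exists>w\<in>I. c - J w \<in> B"
    and J_inj: "w \<in> I \<Longrightarrow> J w \<in> B \<Longrightarrow> w = 0"
begin

abbreviation "H \<equiv> quotient_module (subspace_module Z) B"

lemma J_unique: assumes "w \<in> I" "w' \<in> I" "J w - J w' \<in> B" shows "w = w'"
proof -
  have "J (w - w') = J w - J w'"
    using J_add[of w "- w'"] J_scale[of w' "-1"] assms(1,2) subspace_neg[OF I] by simp
  then show ?thesis using J_inj[of "w - w'"] assms subspace_diff[OF I] by auto
qed

definition rep :: "'c set \<Rightarrow> 'i" where "rep C = (THE w. w \<in> I \<and> J w \<in> C)"

lemma rep_eqI: assumes "w \<in> I" "c - J w \<in> B" shows "rep (coset B c) = w"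
proof -
  have mem: "J v \<in> coset B c \<longleftrightarrow> J v - c \<in> B" for v by (force simp: coset_def)
  have m: "J v - c \<in> B \<longleftrightarrow> J v - J w \<in> B" for v
  proof -
    have "J v - J w = (J v - c) + (c - J w)" "J v - c = (J v - J w) - (c - J w)" by simp_all
    then show ?thesis using subspace_add[OF B _ assms(2)] subspace_diff[OF B _ assms(2)] by metis
  qed
  show ?thesis unfolding rep_def mem m
    by (rule the_equality) (use assms(1) J_unique subspace_0[OF B] in auto)
qed

lemma rep_iso: "rep \<in> module_iso H (subspace_module I)"
proof (rule module_isoI)
  note s = quotient_module_simps[OF B]
  have ex: "\<exists>c w. C = coset B c \<and> c \<in> Z \<and> w \<in> I \<and> c - J w \<in> B" if "C \<in> carrier H" for C
    using that J_surj unfolding s by blast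
  show "rep C \<in> carrier (subspace_module I)" if "C \<in> carrier H" for C
    using ex[OF that] rep_eqI by auto
  show "rep (C \<oplus>\<^bsub>H\<^esub> C') = rep C \<oplus>\<^bsub>subspace_module I\<^esub> rep C'" if C: "C \<in> carrier H" "C' \<in> carrier H" for C C'
  proof -
    obtain c w c' w' where cw: "C = coset B c" "w \<in> I" "c - J w \<in> B" "C' = coset B c'" "w' \<in> I" "c' - J w' \<in> B"
      using ex[OF C(1)] ex[OF C(2)] by blast
    have "c + c' - J (w + w') = (c - J w) + (c' - J w')" using J_add[OF cw(2,5)] by simp
    then have "rep (coset B (c + c')) = w + w'"
      using subspace_add[OF B cw(3,6)] by (intro rep_eqI subspace_add[OF I cw(2,5)]) (simp only:)
    then show ?thesis using cw rep_eqI by (simp add: s)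
  qed
  show "rep (r \<odot>\<^bsub>H\<^esub> C) = r \<odot>\<^bsub>subspace_module I\<^esub> rep C" if C: "C \<in> carrier H" for r C
  proof -
    obtain c w where cw: "C = coset B c" "w \<in> I" "c - J w \<in> B" using ex[OF C] by blast
    have "r *\<^sub>R c - J (r *\<^sub>R w) = r *\<^sub>R (c - J w)" using J_scale[OF cw(2)] by (simp add: scaleR_diff_right)
    then have "rep (coset B (r *\<^sub>R c)) = r *\<^sub>R w"
      using subspace_scale[OF B cw(3)] by (intro rep_eqI subspace_scale[OF I cw(2)]) (simp only:)
    then show ?thesis using cw rep_eqI by (simp add: s)
  qed
  show "bij_betw rep (carrier H) (carrier (subspace_module I))"
    unfolding bij_betw_def
  proof
    show "inj_on rep (carrier H)"
    proof (rule inj_onI)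
      fix C C' assume C: "C \<in> carrier H" "C' \<in> carrier H" "rep C = rep C'"
      obtain c w c' w' where cw: "C = coset B c" "w \<in> I" "c - J w \<in> B" "C'
          = coset B c'" "w' \<in> I" "c' - J w' \<in> B"
        using ex[OF C(1)] ex[OF C(2)] by blast
      then have "w = w'" using C(3) rep_eqI by metis
      then have "c - c' = (c - J w) - (c' - J w')" by simp
      then show "C = C'" using subspace_diff[OF B cw(3,6)] unfolding cw(1,4) coset_eq_iff[OF B] by metis
    qed
    have "w \<in> rep ` carrier H" if "w \<in> I" for w
      using rep_eqI[OF that, of "J w"] J_in[OF that] subspace_0[OF B] by (force simp: s)
    moreover have "rep C \<in> I" if "C \<in> carrier H" for C using ex[OF that] rep_eqI by blast
    ultimately show "rep ` carrier H = carrier (subspace_module I)" by auto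
  qed
qed

lemma rep_zero: "rep \<zero>\<^bsub>H\<^esub> = 0" "\<zero>\<^bsub>H\<^esub> \<in> carrier H"
proof -
  have "J 0 = 0" using J_scale[OF subspace_0[OF I], of 0] by simp
  then show "rep \<zero>\<^bsub>H\<^esub> = 0"
    using rep_eqI[of 0 0] subspace_0[OF I] subspace_0[OF B] by (simp add: quotient_module_simps[OF B])
  show "\<zero>\<^bsub>H\<^esub> \<in> carrier H"
    using subspace_0[OF Z] by (auto simp: quotient_module_simps[OF B])
qed

end

text \<open>
  The induced map sends the class of \<open>J w\<close> to the class of \<open>J w\<close>, and in both quotients each class
  contains exactly one such element.
\<close>

lemma induced_iso:
  assumes "cocycle_representatives Z B I J" "cocycle_representatives Z' B' I J" "Z \<subseteq> Z'" "B \<subseteq> B'"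
  defines "f \<equiv> \<lambda>C. \<Union>c\<in>C. coset B' c"
  shows "f \<in> module_iso (quotient_module (subspace_module Z) B) (quotient_module (subspace_module Z') B')"
    and "f (coset B 0) = coset B' 0"
proof -
  interpret X: cocycle_representatives Z B I J by fact
  interpret Y: cocycle_representatives Z' B' I J by fact
  have f: "f (coset B c) = coset B' c" for c
  proof -
    have "coset B' x = coset B' c" if "x \<in> coset B c" for x
      unfolding coset_eq_iff[OF Y.B] using that assms(4) by (auto simp: coset_def)
    moreover have "c \<in> coset B c" using subspace_0[OF X.B] by (force simp: coset_def)
    ultimately show ?thesis unfolding f_def by blast
  qed
  show "f (coset B 0) = coset B' 0" by (rule f)
  note s = quotient_module_simps[OF X.B] and s' = quotient_module_simps[OF Y.B]
  show "f \<in> module_iso X.H Y.H"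
  proof (rule module_isoI)
    show "f C \<in> carrier Y.H" if "C \<in> carrier X.H" for C using that assms(3) by (auto simp: s s' f)
    show "f (C \<oplus>\<^bsub>X.H\<^esub> C') = f C \<oplus>\<^bsub>Y.H\<^esub> f C'" if "C \<in> carrier X.H" "C' \<in> carrier X.H" for C C'
      using that by (auto simp: s s' f)
    show "f (r \<odot>\<^bsub>X.H\<^esub> C) = r \<odot>\<^bsub>Y.H\<^esub> f C" if "C \<in> carrier X.H" for r C
      using that by (auto simp: s s' f)
    show "bij_betw f (carrier X.H) (carrier Y.H)"
      unfolding bij_betw_def
    proof
      show "inj_on f (carrier X.H)"
      proof (rule inj_onI)
        fix C C' assume "C \<in> carrier X.H" "C' \<in> carrier X.H" "f C = f C'"
        then obtain c c' where c: "C = coset B c" "c \<in> Z" "C' = coset B c'" "c' \<in> Z" "coset B' c = coset B' c'"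
          by (auto simp: s f)
        then have cc: "c - c' \<in> B'" "c - c' \<in> Z" using subspace_diff[OF X.Z]
            by (auto simp: coset_eq_iff[OF Y.B])
        obtain w where w: "w \<in> I" "c - c' - J w \<in> B" using X.J_surj[OF cc(2)] by blast
        have "J w = (c - c') - (c - c' - J w)" by simp
        then have "J w \<in> B'" using subspace_diff[OF Y.B cc(1)] w(2) assms(4) by (metis subsetD)
        then have "w = 0" by (rule Y.J_inj[OF w(1)])
        moreover have "J 0 = 0" using X.J_scale[OF subspace_0[OF X.I], of 0] by simp
        ultimately show "C = C'" using w(2) by (simp add: c(1,3) coset_eq_iff[OF X.B])
      qed
      have "C \<in> f ` carrier X.H" if C: "C \<in> carrier Y.H" for C
      proof -
        obtain c where c: "C = coset B' c" "c \<in> Z'" using C by (auto simp: s')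
        obtain w where w: "w \<in> I" "c - J w \<in> B'" using Y.J_surj[OF c(2)] by blast
        then have "C = f (coset B (J w))" by (simp add: f c(1) coset_eq_iff[OF Y.B])
        then show ?thesis using X.J_in[OF w(1)] by (auto simp: s)
      qed
      moreover have "f C \<in> carrier Y.H" if "C \<in> carrier X.H" for C using that assms(3) by (auto simp: s s' f)
      ultimately show "f ` carrier X.H = carrier Y.H" by blast
    qed
  qed
qed

section \<open>Cohomology of the projective algebra\<close>

text \<open>
  Cochains on the set of projective fields are identified with cochains on the coordinate space;
  \<open>sl_push\<close> is the inverse of \<open>sl_pull\<close> and supplies the required value \<open>0\<close> outside the projective
  fields.
\<close>

definition sl_pull :: "('m::finite vector_field list \<Rightarrow> 'w) \<Rightarrow> 'm sl_vec list \<Rightarrow> 'w" where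
  "sl_pull c = (\<lambda>ps. c (map proj_field ps))"

definition sl_push :: "('m::finite sl_vec list \<Rightarrow> 'w) \<Rightarrow> 'm vector_field list \<Rightarrow> 'w::real_vector" where
  "sl_push c = (\<lambda>xs. if set xs \<subseteq> sl_fields then c (map (sl_coords) xs) else 0)"

lemma proj_field_in: "proj_field p \<in> sl_fields"
  by (simp add: sl_fields_eq)

lemma inv_proj_field [simp]: "sl_coords (proj_field p) = p"
  by (rule inv_f_f[OF inj_proj_field])

lemma proj_field_inv: "X \<in> sl_fields \<Longrightarrow> proj_field (sl_coords X) = X"
  by (simp add: sl_fields_eq f_inv_into_f)

lemma set_map_proj_field: "set (map proj_field ps) \<subseteq> sl_fields"
  using proj_field_in by auto

lemma map_proj_field_inv: "set xs \<subseteq> sl_fields \<Longrightarrow> map proj_field (map (sl_coords) xs) = xs"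
  by (induction xs) (auto simp: proj_field_inv)

lemma inv_proj_field_lin:
  assumes "X \<in> sl_fields" "Y \<in> sl_fields"
  shows "sl_coords (X + Y) = sl_coords X + sl_coords Y"
    "sl_coords (r *\<^sub>R X) = r *\<^sub>R sl_coords X"
proof -
  obtain p q where "X = proj_field p" "Y = proj_field q" using assms by (auto simp: sl_fields_eq)
  then show "sl_coords (X + Y) = sl_coords X + sl_coords Y"
    "sl_coords (r *\<^sub>R X) = r *\<^sub>R sl_coords X"
    by (simp_all flip: proj_field_lin)
qed

lemma sl_fields_lin: "X \<in> sl_fields \<Longrightarrow> Y \<in> sl_fields \<Longrightarrow> X + Y \<in> sl_fields"
  "X \<in> sl_fields \<Longrightarrow> r *\<^sub>R X \<in> sl_fields"
  by (auto simp: sl_fields_def span_add span_scale)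

lemma map_inv_proj_field: "map (sl_coords) (map proj_field ps) = ps"
  by (induction ps) simp_all

lemma sl_pull_push [simp]: "sl_pull (sl_push c) = c"
  by (rule ext) (simp only: sl_pull_def sl_push_def set_map_proj_field if_True map_inv_proj_field)

lemma sl_push_pull: assumes "c \<in> alt_maps sl_fields W u" shows "sl_push (sl_pull c) = c"
proof
  fix xs show "sl_push (sl_pull c) xs = c xs"
  proof (cases "set xs \<subseteq> sl_fields")
    case True
    then show ?thesis by (simp only: sl_push_def sl_pull_def if_True map_proj_field_inv)
  next
    case False
    then show ?thesis using assms by (simp add: sl_push_def alt_maps_def)
  qed
qed

lemma alt_mapsI:
  assumes "\<And>xs. length xs = u \<Longrightarrow> set xs \<subseteq> V \<Longrightarrow> c xs \<in> W"
    and "\<And>xs. \<not> (length xs = u \<and> set xs \<subseteq> V) \<Longrightarrow> c xs = 0"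
    and "\<And>xs i x y. length xs = u \<Longrightarrow> set xs \<subseteq> V \<Longrightarrow> i < u \<Longrightarrow> x \<in> V \<Longrightarrow> y \<in> V \<Longrightarrow>
        c (xs[i := x + y]) = c (xs[i := x]) + c (xs[i := y])"
    and "\<And>xs i x r. length xs = u \<Longrightarrow> set xs \<subseteq> V \<Longrightarrow> i < u \<Longrightarrow> x \<in> V \<Longrightarrow>
        c (xs[i := r *\<^sub>R x]) = r *\<^sub>R c (xs[i := x])"
    and "\<And>xs i j. length xs = u \<Longrightarrow> set xs \<subseteq> V \<Longrightarrow> i < j \<Longrightarrow> j < u \<Longrightarrow> xs ! i = xs ! j \<Longrightarrow> c xs = 0"
  shows "c \<in> alt_maps V W u"
  unfolding alt_maps_def using assms by blast

lemma alt_mapsD: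
  assumes "c \<in> alt_maps V W u"
  shows "\<And>xs. length xs = u \<Longrightarrow> set xs \<subseteq> V \<Longrightarrow> c xs \<in> W"
    and "\<And>xs. \<not> (length xs = u \<and> set xs \<subseteq> V) \<Longrightarrow> c xs = 0"
    and "\<And>xs i x y. length xs = u \<Longrightarrow> set xs \<subseteq> V \<Longrightarrow> i < u \<Longrightarrow> x \<in> V \<Longrightarrow> y \<in> V \<Longrightarrow>
        c (xs[i := x + y]) = c (xs[i := x]) + c (xs[i := y])"
    and "\<And>xs i x r. length xs = u \<Longrightarrow> set xs \<subseteq> V \<Longrightarrow> i < u \<Longrightarrow> x \<in> V \<Longrightarrow>
        c (xs[i := r *\<^sub>R x]) = r *\<^sub>R c (xs[i := x])"
    and "\<And>xs i j. length xs = u \<Longrightarrow> set xs \<subseteq> V \<Longrightarrow> i < j \<Longrightarrow> j < u \<Longrightarrow> xs ! i = xs ! j \<Longrightarrow> c xs = 0"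
  using assms unfolding alt_maps_def by blast+

lemma alt_maps_mono: assumes "W \<subseteq> W'" shows "alt_maps V W u \<subseteq> alt_maps V W' u"
proof
  fix c assume c: "c \<in> alt_maps V W u"
  show "c \<in> alt_maps V W' u"
  proof (rule alt_mapsI)
    show "c xs \<in> W'" if "length xs = u" "set xs \<subseteq> V" for xs
      using alt_mapsD(1)[OF c that] assms by blast
  qed (rule alt_mapsD(2)[OF c] alt_mapsD(3)[OF c] alt_mapsD(4)[OF c] alt_mapsD(5)[OF c], assumption+)+
qed

lemma subspace_alt_maps:
  assumes W: "subspace W" shows "subspace (alt_maps V W u)"
proof (rule subspaceI)
  show "0 \<in> alt_maps V W u" by (rule alt_mapsI) (simp_all add: subspace_0[OF W])
  show "c + c' \<in> alt_maps V W u" if c: "c \<in> alt_maps V W u" and c': "c' \<in> alt_maps V W u" for c c'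
  proof (rule alt_mapsI, goal_cases)
    case 1 then show ?case using alt_mapsD(1)[OF c] alt_mapsD(1)[OF c'] by (simp add: subspace_add[OF W])
  next
    case (2 xs) then show ?case using alt_mapsD(2)[OF c, of xs] alt_mapsD(2)[OF c', of xs] by simp
  next
    case 3 then show ?case using alt_mapsD(3)[OF c] alt_mapsD(3)[OF c'] by simp
  next
    case 4 then show ?case using alt_mapsD(4)[OF c] alt_mapsD(4)[OF c'] by (simp add: scaleR_add_right)
  next
    case (5 xs i j) then show ?case using alt_mapsD(5)[OF c, of xs i j] alt_mapsD(5)[OF c', of xs i j] by simp
  qed
  show "r *\<^sub>R c \<in> alt_maps V W u" if c: "c \<in> alt_maps V W u" for r c
  proof (rule alt_mapsI, goal_cases)
    case 1 then show ?case using alt_mapsD(1)[OF c] by (simp add: subspace_scale[OF W])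
  next
    case (2 xs) then show ?case using alt_mapsD(2)[OF c, of xs] by simp
  next
    case 3 then show ?case using alt_mapsD(3)[OF c] by (simp add: scaleR_add_right)
  next
    case 4 then show ?case using alt_mapsD(4)[OF c] by simp
  next
    case (5 xs i j) then show ?case using alt_mapsD(5)[OF c, of xs i j] by simp
  qed
qed

lemma sl_pull_alt: assumes c: "c \<in> alt_maps sl_fields W u" shows "sl_pull c \<in> alt_maps UNIV W u"
proof (rule alt_mapsI, goal_cases)
  case (1 ps) then show ?case using alt_mapsD(1)[OF c _ set_map_proj_field, of ps] by (simp add: sl_pull_def)
next
  case (2 ps) then show ?case using alt_mapsD(2)[OF c, of "map proj_field ps"] by (simp add: sl_pull_def)
next
  case (3 ps i p q) then show ?case
    using alt_mapsD(3)[OF c _ set_map_proj_field, of ps i "proj_field p" "proj_field q"]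
    by (simp add: sl_pull_def map_update proj_field_lin proj_field_in)
next
  case (4 ps i p r) then show ?case
    using alt_mapsD(4)[OF c _ set_map_proj_field, of ps i "proj_field p" r]
    by (simp add: sl_pull_def map_update proj_field_lin proj_field_in)
next
  case (5 ps i j) then show ?case
    using alt_mapsD(5)[OF c _ set_map_proj_field, of ps i j] by (simp add: sl_pull_def)
qed

lemma sl_push_alt: assumes c: "c \<in> alt_maps UNIV W u" shows "sl_push c \<in> alt_maps sl_fields W u"
proof (rule alt_mapsI, goal_cases)
  case 1 then show ?case using alt_mapsD(1)[OF c] by (simp add: sl_push_def)
next
  case (2 xs) then show ?case using alt_mapsD(2)[OF c, of "map (sl_coords) xs"] by (auto simp: sl_push_def)
next
  case (3 xs i x y)
  then have "set (xs[i := z]) \<subseteq> sl_fields" if "z \<in> sl_fields" for z by (metis set_update_subsetI that)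
  then show ?case
    using 3 alt_mapsD(3)[OF c, of "map (sl_coords) xs" i]
    by (simp add: sl_push_def map_update inv_proj_field_lin sl_fields_lin)
next
  case (4 xs i x r)
  then have "set (xs[i := z]) \<subseteq> sl_fields" if "z \<in> sl_fields" for z by (metis set_update_subsetI that)
  then show ?case
    using 4 alt_mapsD(4)[OF c, of "map (sl_coords) xs" i]
    by (simp add: sl_push_def map_update inv_proj_field_lin(2)[OF 4(4) 4(4)] sl_fields_lin)
next
  case (5 xs i j) then show ?case
    using alt_mapsD(5)[OF c, of "map (sl_coords) xs" i j] by (simp add: sl_push_def)
qed

lemma sl_pull_lin: "sl_pull (c + c') = (\<lambda>ps. sl_pull c ps + sl_pull c' ps)"
  "sl_pull (r *\<^sub>R c) = (\<lambda>ps. r *\<^sub>R sl_pull c ps)" "sl_pull 0 = (\<lambda>ps. 0)"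
  by (simp_all add: sl_pull_def)

lemma sl_push_lin: "sl_push (\<lambda>ps. c ps + c' ps) = sl_push c + sl_push c'"
  "sl_push (\<lambda>ps. c ps - c' ps) = sl_push c - sl_push c'"
  "sl_push (\<lambda>ps. r *\<^sub>R c ps) = r *\<^sub>R sl_push c" "sl_push (\<lambda>ps. 0) = 0"
  by (rule ext; simp add: sl_push_def)+

lemma ce_sum_transport:
  "ce_sum vf_bracket (diff_op_action lam lam) c (map proj_field ps) = ce_sum sl_br (sl_act lam) (sl_pull c) ps"
  unfolding ce_sum_def sl_pull_def
  by (intro arg_cong2[where f = "(+)"] sum.cong refl)
     (simp_all add: nths_map sl_act_def proj_field_sl_br)

context coeff_module begin

abbreviation "Alt u \<equiv> alt_maps sl_fields W u"
abbreviation "Z u \<equiv> ce_cocycles sl_fields vf_bracket W (diff_op_action lam lam) u"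
abbreviation "B u \<equiv> ce_coboundaries sl_fields vf_bracket W (diff_op_action lam lam) u"
abbreviation "D u \<equiv> ce_diff sl_fields vf_bracket (diff_op_action lam lam) u"

lemma sl_pull_cochain:
  assumes "c \<in> Alt u" shows "ml (sl_pull c)" "skew (sl_pull c)" "of_degree u (sl_pull c)"
  using sl_pull_alt[OF assms] unfolding alt_maps_UNIV_iff[OF W] by blast+

lemma sl_push_cochain: "ml c \<Longrightarrow> skew c \<Longrightarrow> of_degree u c \<Longrightarrow> sl_push c \<in> Alt u"
  using alt_maps_UNIV_iff[OF W] by (intro sl_push_alt) blast

lemma ce_diff_transport: assumes c: "c \<in> Alt u" shows "D u c = sl_push (d (sl_pull c))"
proof
  fix xs :: "'m vector_field list"
  note s = sl_pull_cochain[OF c]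
  show "D u c xs = sl_push (d (sl_pull c)) xs"
  proof (cases "set xs \<subseteq> sl_fields")
    case True
    define ps where "ps = map (sl_coords) xs"
    have xs: "xs = map proj_field ps" unfolding ps_def by (rule map_proj_field_inv[OF True, symmetric])
    have m: "sl_act lam x (- w) = - sl_act lam x w" for x and w :: "'m sf_op"
      by (simp add: fun_eq_iff sl_act_apply lie_deriv_eq)
    have "ce_sum sl_br (sl_act lam) (sl_pull c) ps = d (sl_pull c) ps"
      by (rule ce_sum_eq_cochain_d[where act = "sl_act lam", OF s(2) m])
    moreover have "sl_push (d (sl_pull c)) xs = d (sl_pull c) ps"
      using True by (simp add: sl_push_def ps_def)
    moreover have "d (sl_pull c) ps = 0" if "length xs \<noteq> Suc u"
      using of_degree_d[OF s(3)] that unfolding of_degree_def ps_def by (metis length_map)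
    ultimately show ?thesis
      using True unfolding ce_diff_eq_ce_sum by (simp add: xs ce_sum_transport)
  qed (simp add: ce_diff_eq_ce_sum sl_push_def)
qed

lemma sl_pull_ce_diff: "c \<in> Alt u \<Longrightarrow> sl_pull (D u c) = d (sl_pull c)"
  by (simp only: ce_diff_transport sl_pull_push)

lemma Z_iff: "c \<in> Z u \<longleftrightarrow> c \<in> Alt u \<and> (\<forall>ps. d (sl_pull c) ps = 0)"
proof -
  have "D u c = 0 \<longleftrightarrow> (\<forall>ps. d (sl_pull c) ps = 0)" if c: "c \<in> Alt u"
  proof
    assume "D u c = 0"
    then show "\<forall>ps. d (sl_pull c) ps = 0" unfolding sl_pull_ce_diff[OF c, symmetric]
        by (simp only: sl_pull_lin simp_thms)
  next
    assume "\<forall>ps. d (sl_pull c) ps = 0"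
    then have "d (sl_pull c) = (\<lambda>ps. 0)" by blast
    then show "D u c = 0" by (simp only: ce_diff_transport[OF c] sl_push_lin)
  qed
  then show ?thesis by (auto simp: ce_cocycles_def)
qed

lemma D_lin: "c \<in> Alt u \<Longrightarrow> c' \<in> Alt u \<Longrightarrow> D u (c + c') = D u c + D u c'"
  "c \<in> Alt u \<Longrightarrow> D u (r *\<^sub>R c) = r *\<^sub>R D u c"
proof -
  note sub = subspace_alt_maps[OF W, of sl_fields u]
  show "D u (c + c') = D u c + D u c'" if "c \<in> Alt u" "c' \<in> Alt u"
  proof -
    have "d (sl_pull (c + c')) = (\<lambda>ps. d (sl_pull c) ps + d (sl_pull c') ps)"
      unfolding sl_pull_lin by (rule ext) (rule d_add[OF sl_pull_cochain(1)[OF that(1)]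
          sl_pull_cochain(1)[OF that(2)]])
    then show ?thesis
      by (simp only: ce_diff_transport[OF that(1)] ce_diff_transport[OF that(2)] ce_diff_transport[OF
        subspace_add[OF sub that]] sl_push_lin)
  qed
  show "D u (r *\<^sub>R c) = r *\<^sub>R D u c" if "c \<in> Alt u"
  proof -
    have "d (sl_pull (r *\<^sub>R c)) = (\<lambda>ps. r *\<^sub>R d (sl_pull c) ps)"
      unfolding sl_pull_lin by (rule ext) (rule d_scale[OF sl_pull_cochain(1)[OF that]])
    then show ?thesis
      by (simp only: ce_diff_transport[OF that] ce_diff_transport[OF subspace_scale[OF sub that]] sl_push_lin)
  qed
qed

lemma subspace_Z: "subspace (Z u)"
proof (rule subspaceI)
  note sub = subspace_alt_maps[OF W, of sl_fields u]
  show "0 \<in> Z u" unfolding Z_iff using subspace_0[OF sub] by (simp only: sl_pull_lin d_zero simp_thms)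
  show "c + c' \<in> Z u" if "c \<in> Z u" "c' \<in> Z u" for c c'
  proof -
    have c: "c \<in> Alt u" "c' \<in> Alt u" "\<And>ps. d (sl_pull c) ps = 0" "\<And>ps. d (sl_pull c') ps = 0"
      using that by (simp_all add: Z_iff)
    have "d (\<lambda>ps. sl_pull c ps + sl_pull c' ps) ps = 0" for ps
      by (simp only: d_add[OF sl_pull_cochain(1)[OF c(1)] sl_pull_cochain(1)[OF c(2)]] c(3,4) add_0)
    then show ?thesis unfolding Z_iff sl_pull_lin using subspace_add[OF sub c(1,2)] by blast
  qed
  show "r *\<^sub>R c \<in> Z u" if "c \<in> Z u" for r c
  proof -
    have c: "c \<in> Alt u" "\<And>ps. d (sl_pull c) ps = 0" using that by (simp_all add: Z_iff)
    have "d (\<lambda>ps. r *\<^sub>R sl_pull c ps) ps = 0" for ps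
      by (simp only: d_scale[OF sl_pull_cochain(1)[OF c(1)]] c(2) scaleR_zero_right)
    then show ?thesis unfolding Z_iff sl_pull_lin using subspace_scale[OF sub c(1)] by blast
  qed
qed

lemma subspace_B: "subspace (B u)"
proof (cases u)
  case 0
  then show ?thesis by (simp add: ce_coboundaries_def)
next
  case (Suc v)
  note sub = subspace_alt_maps[OF W, of sl_fields v]
  have B: "B u = D v ` Alt v" using Suc by (simp add: ce_coboundaries_def)
  show ?thesis unfolding B
  proof (rule subspaceI)
    have "D v (0 :: 'm vector_field list \<Rightarrow> 'm sf_op) = 0" using D_lin(2)[OF subspace_0[OF sub], of 0]
        by (simp only: scaleR_zero_left)
    then show "0 \<in> D v ` Alt v" using subspace_0[OF sub] by (metis image_eqI)
    show "x + y \<in> D v ` Alt v" if "x \<in> D v ` Alt v" "y \<in> D v ` Alt v" for x y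
    proof -
      obtain a b where "a \<in> Alt v" "b \<in> Alt v" "x = D v a" "y = D v b"
          using \<open>x \<in> D v ` Alt v\<close> \<open>y \<in> D v ` Alt v\<close> by blast
      then show ?thesis using D_lin(1)[of a v b] subspace_add[OF sub, of a b] by (metis image_eqI)
    qed
    show "r *\<^sub>R x \<in> D v ` Alt v" if "x \<in> D v ` Alt v" for r x
    proof -
      obtain a where "a \<in> Alt v" "x = D v a" using \<open>x \<in> D v ` Alt v\<close> by blast
      then show ?thesis using D_lin(2)[of a v r] subspace_scale[OF sub, of a r] by (metis image_eqI)
    qed
  qed
qed

lemma D_Alt: assumes "c \<in> Alt v" shows "D v c \<in> Alt (Suc v)"
  unfolding ce_diff_transport[OF assms]
  by (intro sl_push_cochain multilinear_d skew_d of_degree_d sl_pull_cochain[OF assms])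

lemma B_subset_Z: "B u \<subseteq> Z u"
proof (cases u)
  case 0
  then show ?thesis using subspace_0[OF subspace_Z] by (simp add: ce_coboundaries_def)
next
  case (Suc v)
  have "D v c \<in> Z u" if "c \<in> Alt v" for c
    unfolding Z_iff sl_pull_ce_diff[OF that] using d_d[OF sl_pull_cochain(1)[OF that]] D_Alt[OF that] Suc
        by blast
  then show ?thesis using Suc by (auto simp: ce_coboundaries_def)
qed

text \<open>
  This holds for both coefficient modules, with the same map from invariant forms to cocycles.
\<close>

lemma representatives: "cocycle_representatives (Z u) (B u) (gl_invariants u) (\<lambda>w. sl_push (gl_lift w))"
proof
  show "subspace (Z u)" "subspace (B u)" "B u \<subseteq> Z u" "subspace (gl_invariants u)"
    by (rule subspace_Z subspace_B B_subset_Z subspace_gl_invariants)+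
  fix w w' :: "(real ^ 'm ^ 'm) list \<Rightarrow> real" and r :: real
  assume w: "w \<in> gl_invariants u"
  then have wf: "w \<in> alt_forms u" by (simp add: gl_invariants_def)
  note l = gl_lift_alt[OF wf]
  show "sl_push (gl_lift w) \<in> Z u"
    unfolding Z_iff sl_pull_push using sl_push_cochain[OF l(1-3)] gl_lift_cocycle[OF w] by blast
  have "w + w' = (\<lambda>As. w As + w' As)" by (simp add: plus_fun_def)
  then have "gl_lift (w + w') = (\<lambda>ps. gl_lift w ps + gl_lift w' ps)"
    by (intro ext) (simp only: gl_lift_add)
  then show "sl_push (gl_lift (w + w')) = sl_push (gl_lift w) + sl_push (gl_lift w')"
    by (simp only: sl_push_lin)
  have "r *\<^sub>R w = (\<lambda>As. r * w As)" by (simp add: scaleR_fun_def)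
  then have "gl_lift (r *\<^sub>R w) = (\<lambda>ps. r *\<^sub>R gl_lift w ps)"
    by (intro ext) (simp only: gl_lift_scale)
  then show "sl_push (gl_lift (r *\<^sub>R w)) = r *\<^sub>R sl_push (gl_lift w)"
    by (simp only: sl_push_lin)
  show "w = 0" if b: "sl_push (gl_lift w) \<in> B u"
  proof (cases u)
    case 0
    then have "sl_push (gl_lift w) = 0" using b by (simp add: ce_coboundaries_def)
    then have "gl_lift w = (\<lambda>ps. 0)" using sl_pull_push[of "gl_lift w"] by (simp only: sl_pull_lin)
    then have "gl_restrict (gl_lift w) As = 0" for As by (simp add: gl_restrict_def)
    then show ?thesis using gl_restrict_lift[of w] wf by (auto simp: alt_forms_def)
  next
    case (Suc v)
    then obtain e where e: "e \<in> Alt v" "sl_push (gl_lift w) = D v e" using b by (auto simp: ce_coboundaries_def)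
    then have "gl_lift w = d (sl_pull e)" using sl_pull_push[of "gl_lift w"]
        by (simp only: sl_pull_ce_diff[OF e(1)])
    then show ?thesis using gl_lift_exact_imp_0[OF w[unfolded Suc] sl_pull_cochain[OF e(1)]] by blast
  qed
next
  fix c assume "c \<in> Z u"
  then have c: "c \<in> Alt u" "\<And>ps. d (sl_pull c) ps = 0" by (auto simp: Z_iff)
  obtain w b where w: "w \<in> gl_invariants u" and b: "ml b" "skew b" "of_degree (u - 1) b"
    and cw: "\<And>ps. sl_pull c ps = gl_lift w ps + (if u = 0 then 0 else d b ps)"
    using cocycle_cohomologous_gl_lift[OF sl_pull_cochain[OF c(1)] c(2)] by metis
  have "(\<lambda>ps. if u = 0 then 0 else d b ps) = (\<lambda>ps. sl_pull c ps - gl_lift w ps)"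
    by (rule ext) (simp only: cw add_diff_cancel_left')
  then have diff: "c - sl_push (gl_lift w) = sl_push (\<lambda>ps. if u = 0 then 0 else d b ps)"
    by (simp only: sl_push_lin sl_push_pull[OF c(1)])
  have "sl_push (\<lambda>ps. if u = 0 then 0 else d b ps) \<in> B u"
  proof (cases u)
    case 0
    then show ?thesis by (simp only: simp_thms if_True sl_push_lin ce_coboundaries_def nat.case singletonI)
  next
    case (Suc v)
    have pb: "sl_push b \<in> Alt v" using b Suc by (intro sl_push_cochain) simp_all
    have "sl_push (d b) = D v (sl_push b)" by (simp only: ce_diff_transport[OF pb] sl_pull_push)
    then show ?thesis using pb Suc by (simp add: ce_coboundaries_def)
  qed
  then show "\<exists>w\<in>gl_invariants u. c - sl_push (gl_lift w) \<in> B u" using w diff by metis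
qed

lemma sl_cohomology_eq:
  "sl_cohomology lam lam W = direct_sum_module (\<lambda>u. quotient_module (subspace_module (Z u)) (B u))"
  unfolding sl_cohomology_def ce_cohomology_def ce_cohomology_deg_def[abs_def] ..

end

theorem theorem9p2:
  fixes lam :: real
  assumes "CARD('m::finite) > 1"
  shows "modules_isomorphic
           (sl_cohomology lam lam (diff_ops_le 0 :: ('m smooth_fun \<Rightarrow> 'm smooth_fun) set))
           (gl_inv_forms :: (real, nat \<Rightarrow> (real^'m^'m) list \<Rightarrow> real) module)
       \<and> ce_induced_map sl_fields vf_bracket diff_ops (diff_op_action lam lam) id
           \<in> module_iso
               (sl_cohomology lam lam (diff_ops_le 0 :: ('m smooth_fun \<Rightarrow> 'm smooth_fun) set))
               (sl_cohomology lam lam (diff_ops :: ('m smooth_fun \<Rightarrow> 'm smooth_fun) set))"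
proof
  interpret D0: coeff_module lam "diff_ops_le 0 :: 'm sf_op set" by standard simp
  interpret D: coeff_module lam "diff_ops :: 'm sf_op set" by standard simp
  have gl: "(gl_inv_forms :: (real, nat \<Rightarrow> (real^'m^'m) list \<Rightarrow> real) module)
      = direct_sum_module (\<lambda>u. subspace_module (gl_invariants u))"
    by (simp add: gl_inv_forms_def gl_inv_forms_deg_eq)
  show "modules_isomorphic (sl_cohomology lam lam (diff_ops_le 0 :: 'm sf_op set)) (gl_inv_forms :: (real,
      nat \<Rightarrow> (real^'m^'m) list \<Rightarrow> real) module)"
    unfolding modules_isomorphic_def D0.sl_cohomology_eq gl
    using module_iso_direct_sum[OF cocycle_representatives.rep_iso[OF D0.representatives]
        cocycle_representatives.rep_zero(2)[OF D0.representatives]]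
      cocycle_representatives.rep_zero(1)[OF D0.representatives] by fastforce
  have sub: "D0.Z u \<subseteq> D.Z u" "D0.B u \<subseteq> D.B u" for u
  proof -
    have Alt: "D0.Alt u \<subseteq> D.Alt u" for u by (rule alt_maps_mono[OF diff_ops_le_subset])
    then show "D0.Z u \<subseteq> D.Z u" unfolding ce_cocycles_def by blast
    show "D0.B u \<subseteq> D.B u"
      by (cases u) (simp_all add: ce_coboundaries_def image_mono[OF Alt])
  qed
  note ind = induced_iso[OF D0.representatives D.representatives sub]
  have "ce_induced_map sl_fields vf_bracket diff_ops (diff_op_action lam lam) id
      = (\<lambda>h u. \<Union>c\<in>h u. coset (D.B u) c)"
    by (simp add: ce_induced_map_def fun_eq_iff a_r_coset_eq)
  then show "ce_induced_map sl_fields vf_bracket diff_ops (diff_op_action lam lam) id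
           \<in> module_iso (sl_cohomology lam lam (diff_ops_le 0 :: 'm sf_op set)) (sl_cohomology lam lam
               (diff_ops :: 'm sf_op set))"
    unfolding D0.sl_cohomology_eq D.sl_cohomology_eq
    using module_iso_direct_sum[OF ind(1)] ind(2) cocycle_representatives.rep_zero(2)[OF D0.representatives]
    by (simp add: quotient_module_simps[OF D0.subspace_B] quotient_module_simps[OF D.subspace_B])
qed

end
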